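(* Let $0<r<\frac14$ and $t\in(0,\frac12)$. For each integer $k\ge 1$ let $\alpha_k\in(0,\frac{\pi}{2})$ be defined by $\sin\alpha_k=e^{-t^{-k}}$, and put $$A^{r,t}_k:=\{r^k e^{i\theta}:\ -2\alpha_k\le\theta\le 2\alpha_k\},\qquad A^{r,t}:=\bigcup_{k=1}^{\infty}A^{r,t}_k\cup\{0\},\qquad D^{r,t}:=\{z\in\mathbb C:|z|<1\}\setminus A^{r,t}.$$ Then: (1) $D^{r,t}$ is Bergman exhaustive if and only if $r^2\le t$; (2) if $t\le r^4$, then $D^{r,t}$ is not Bergman complete.
   Context: Let $D\subset\mathbb C$ be a bounded domain. $L^2_h(D)$ denotes the Hilbert space of holomorphic functions on $D$ that are square integrable with respect to Lebesgue measure, with norm $\|\cdot\|_D$ the $L^2(D)$ norm. The Bergman kernel of $D$ (on the diagonal) is $$K_D(z)=\sup\left\{\frac{|f(z)|^2}{\|f\|_D^2}: f\in L^2_h(D),\ f\not\equiv 0\right\},\quad z\in D.$$ The Bergman metric of $D$ is the conformal Hermitian metric $\beta_D(z)|dz|^2$ with $\beta_D(z)=\frac{\partial^2}{\partial z\,\partial\bar z}\log K_D(z)$. The Bergman distance between two points of $D$ is the infimum of the Bergman lengths $\int_0^1\sqrt{\beta_D(\gamma(s))}\,|\gamma'(s)|\,ds$ over piecewise $C^1$ curves $\gamma:[0,1]\to D$ joining them. $D$ is Bergman exhaustive at $z_0\in\partial D$ if $\lim_{D\ni z\to z_0}K_D(z)=\infty$. $D$ is Bergman exhaustive if it is Bergman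 exhaustive at every $z_0\in\partial D$. $D$ is Bergman complete if every Cauchy sequence with respect to the Bergman distance converges, in the standard topology of $D$, to some point of $D$. *)

theory Defs
  imports "HOL-Analysis.Analysis" "HOL-Complex_Analysis.Complex_Analysis"
begin

definition L2_hol :: "complex set \<Rightarrow> (complex \<Rightarrow> complex) set" where
  "L2_hol D = {f. f holomorphic_on D \<and> set_integrable lebesgue D (\<lambda>z. (cmod (f z))\<^sup>2)}"

definition L2_norm_on :: "complex set \<Rightarrow> (complex \<Rightarrow> complex) \<Rightarrow> real" where
  "L2_norm_on D f = sqrt (LINT z:D|lebesgue. (cmod (f z))\<^sup>2)"

text \<open>
  Functions are total, so the condition that \<open>f\<close> is not identically zero refers to its values
  on \<open>D\<close> only. For a bounded nonempty open set \<open>D\<close> and \<open>z \<in> D\<close> the set below is nonempty and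
  bounded above, hence the supremum may be taken in the reals.
\<close>

definition bergman_kernel :: "complex set \<Rightarrow> complex \<Rightarrow> real" where
  "bergman_kernel D z =
     Sup {(cmod (f z))\<^sup>2 / (L2_norm_on D f)\<^sup>2 | f. f \<in> L2_hol D \<and> (\<exists>w\<in>D. f w \<noteq> 0)}"

text \<open>
  The Wirtinger operators \<open>(\<partial>/\<partial>x - \<i> \<partial>/\<partial>y) / 2\<close> and \<open>(\<partial>/\<partial>x + \<i> \<partial>/\<partial>y) / 2\<close>; the partial
  derivatives are the values of the real derivative in the directions \<open>1\<close> and \<open>\<i>\<close>.
\<close>

definition wirtinger_dz :: "(complex \<Rightarrow> complex) \<Rightarrow> complex \<Rightarrow> complex" where
  "wirtinger_dz u z =
     (frechet_derivative u (at z) 1 - \<i> * frechet_derivative u (at z) \<i>) / 2"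

definition wirtinger_dzbar :: "(complex \<Rightarrow> complex) \<Rightarrow> complex \<Rightarrow> complex" where
  "wirtinger_dzbar u z =
     (frechet_derivative u (at z) 1 + \<i> * frechet_derivative u (at z) \<i>) / 2"

text \<open>
  The mixed derivative of a real-valued function is real, so \<open>Re\<close> only changes the type.
\<close>

definition bergman_metric :: "complex set \<Rightarrow> complex \<Rightarrow> real" where
  "bergman_metric D z =
     Re (wirtinger_dz (wirtinger_dzbar (\<lambda>w. complex_of_real (ln (bergman_kernel D w)))) z)"

text \<open>
  A \<^const>\<open>valid_path\<close> may have an unbounded derivative near its finitely many break points, so
  it may fail to be rectifiable. Lengths are therefore taken in \<open>[0, \<infinity>]\<close>; paths of
  infinite length do not affect the infimum.
\<close>

definition bergman_length :: "complex set \<Rightarrow> (real \<Rightarrow> complex) \<Rightarrow> ennreal" where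
  "bergman_length D \<gamma> =
     (\<integral>\<^sup>+ s\<in>{0..1}. ennreal (sqrt (bergman_metric D (\<gamma> s)) * cmod (vector_derivative \<gamma> (at s))) \<partial>lebesgue)"

definition bergman_dist :: "complex set \<Rightarrow> complex \<Rightarrow> complex \<Rightarrow> ennreal" where
  "bergman_dist D z w =
     (INF \<gamma> \<in> {\<gamma>. valid_path \<gamma> \<and> path_image \<gamma> \<subseteq> D \<and> pathstart \<gamma> = z \<and> pathfinish \<gamma> = w}.
        bergman_length D \<gamma>)"

definition bergman_exhaustive_at :: "complex set \<Rightarrow> complex \<Rightarrow> bool" where
  "bergman_exhaustive_at D z0 \<longleftrightarrow> filterlim (bergman_kernel D) at_top (at z0 within D)"

definition bergman_exhaustive :: "complex set \<Rightarrow> bool" where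
  "bergman_exhaustive D \<longleftrightarrow> (\<forall>z0\<in>frontier D. bergman_exhaustive_at D z0)"

definition bergman_Cauchy :: "complex set \<Rightarrow> (nat \<Rightarrow> complex) \<Rightarrow> bool" where
  "bergman_Cauchy D x \<longleftrightarrow>
     (\<forall>\<epsilon>::real. \<epsilon> > 0 \<longrightarrow> (\<exists>N. \<forall>m\<ge>N. \<forall>n\<ge>N. bergman_dist D (x m) (x n) < ennreal \<epsilon>))"

definition bergman_complete :: "complex set \<Rightarrow> bool" where
  "bergman_complete D \<longleftrightarrow>
     (\<forall>x. (\<forall>n. x n \<in> D) \<and> bergman_Cauchy D x \<longrightarrow> (\<exists>l\<in>D. x \<longlonglongrightarrow> l))"

text \<open>
  The half-angles \<open>\<alpha>\<close> are a parameter here; only their values at \<open>k \<ge> 1\<close> are used.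
\<close>

definition arc_set :: "real \<Rightarrow> (nat \<Rightarrow> real) \<Rightarrow> nat \<Rightarrow> complex set" where
  "arc_set r \<alpha> k = {complex_of_real (r ^ k) * exp (\<i> * complex_of_real \<theta>) | \<theta>.
                      - 2 * \<alpha> k \<le> \<theta> \<and> \<theta> \<le> 2 * \<alpha> k}"

definition arc_union :: "real \<Rightarrow> (nat \<Rightarrow> real) \<Rightarrow> complex set" where
  "arc_union r \<alpha> = (\<Union>k\<in>{1..}. arc_set r \<alpha> k) \<union> {0}"

definition arc_domain :: "real \<Rightarrow> (nat \<Rightarrow> real) \<Rightarrow> complex set" where
  "arc_domain r \<alpha> = {z. cmod z < 1} - arc_union r \<alpha>"

end

theory Submission
  imports Defs "HOL-Real_Asymp.Real_Asymp"
begin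

text \<open>
  The arc \<open>A\<^sub>k\<close> has logarithmic capacity \<open>r\<^sup>k sin \<alpha>\<^sub>k\<close>, so a function of norm one can have a pole-like
  part of size at most about \<open>\<surd>(t\<^sup>k)\<close> there. Upper bounds at a point \<open>x\<close> of the negative axis come
  from the identity \<open>\<integral> f \<nabla>\<eta> / (z - x) = c f(x)\<close>, where \<open>\<eta>\<close> is a product of
  logarithmic cutoffs around the arcs and \<open>\<bar>c\<bar> \<ge> 1\<close>: the \<open>k\<close>-th arc contributes
  \<open>\<surd>(t\<^sup>k) / (r\<^sup>k + \<bar>x\<bar>)\<close> to the bound for \<open>\<bar>f(x)\<bar>\<close>, and
  \<open>\<surd>(t\<^sup>k) / (r\<^sup>k + \<bar>x\<bar>)\<^sup>2\<close> to the bound for \<open>\<bar>f'(x)\<bar>\<close> when \<open>f(x) = 0\<close>. If \<open>t < r\<^sup>2\<close>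
  the former sum is bounded, so the kernel stays bounded at \<open>0\<close>. If \<open>t \<le> r\<^sup>4\<close> the latter sum is
  \<open>O(1 / \<surd>\<bar>x\<bar>)\<close>, so the negative axis has finite Bergman length near \<open>0\<close>.

  For \<open>r\<^sup>2 \<le> t\<close> let \<open>g\<^sub>k\<close> be the conformal map of the complement of \<open>A\<^sub>k\<close> to the disc vanishing at
  \<open>\<infinity>\<close>, normalised by \<open>g\<^sub>k(0) = 1\<close>. The averages \<open>(g\<^sub>1 + \<dots> + g\<^sub>n) / n\<close> are \<open>1\<close> at \<open>0\<close> while
  their \<open>L\<^sup>2\<close> norms tend to \<open>0\<close>, because the \<open>g\<^sub>k\<close> concentrate on disjoint annuli. At all other
  boundary points \<open>1 / (1 + n \<surd>m)\<close> peaks for a suitable Moebius map \<open>m\<close>.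
\<close>

section \<open>Integrals of squares and of derivatives\<close>

text \<open>Only a lower bound for the constant of the Cauchy-Pompeiu formula is wanted, and it
  comes from the positivity of a radial density. Cauchy-Schwarz on each cutoff pairs the norm of f
  with the square root of a Dirichlet energy; that energy is the reciprocal of a logarithm, about
  t^k for the k-th arc, whence the roots. The negative axis is the right place to look because -y
  has distance comparable to r^k + y from the k-th arc for all k at once. The metric is accessible
  because metric times kernel is the supremum of |f'(x)|^2 over unit f with f(x) = 0, while
  constants bound the kernel of a bounded domain from below. In the case r^2 <= t the squared norm
  of a single g_k near its arc is of order (r^2 / t)^k, which at t = r^2 is bounded but does not
  tend to 0. This is why no single g_k is enough and n of them are averaged: the mean gains a factor
  1/n.\<close>

lemma quadratic_nonneg_imp_discriminant:
  fixes A B C :: real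
  assumes "\<And>s. 0 \<le> A + 2 * s * B + s\<^sup>2 * C" and "0 \<le> C"
  shows "B\<^sup>2 \<le> A * C"
proof (cases "C = 0")
  case True
  have "B = 0"
  proof (rule ccontr)
    assume "B \<noteq> 0"
    \<comment> \<open>With \<open>C = 0\<close> the quadratic is affine in \<open>s\<close>; at this
      point it equals -1.\<close>
    then show False
      using assms(1)[of "- (A + 1) / (2 * B)"] True by (simp add: field_simps)
  qed
  then show ?thesis by (simp add: True)
next
  case False
  then have C: "0 < C" using assms(2) by simp
  have "0 \<le> A + 2 * (- B / C) * B + (- B / C)\<^sup>2 * C" by (rule assms)
  also have "\<dots> = (A * C - B\<^sup>2) / C"
    using C by (simp add: field_simps power2_eq_square)
  finally show ?thesis using C by (simp add: zero_le_divide_iff)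
qed

lemma integrable_mult_of_squares:
  fixes f g :: "'a \<Rightarrow> real"
  assumes [measurable]: "f \<in> borel_measurable M" "g \<in> borel_measurable M"
    and f: "integrable M (\<lambda>x. (f x)\<^sup>2)" and g: "integrable M (\<lambda>x. (g x)\<^sup>2)"
  shows "integrable M (\<lambda>x. f x * g x)"
proof (rule Bochner_Integration.integrable_bound)
  show "integrable M (\<lambda>x. (f x)\<^sup>2 + (g x)\<^sup>2)" using f g by simp
  have "\<bar>a * b\<bar> \<le> \<bar>a\<^sup>2 + b\<^sup>2\<bar>" for a b :: real
  proof -
    have "0 \<le> (\<bar>a\<bar> - \<bar>b\<bar>)\<^sup>2" "0 \<le> \<bar>a * b\<bar>" by auto
    moreover have "(\<bar>a\<bar> - \<bar>b\<bar>)\<^sup>2 = a\<^sup>2 + b\<^sup>2 - 2 * \<bar>a * b\<bar>"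
      by (simp add: power2_diff abs_mult)
    ultimately show ?thesis by linarith
  qed
  then show "AE x in M. norm (f x * g x) \<le> norm ((f x)\<^sup>2 + (g x)\<^sup>2)" by simp
qed simp

lemma integral_Cauchy_Schwarz:
  fixes f g :: "'a \<Rightarrow> real"
  assumes m: "f \<in> borel_measurable M" "g \<in> borel_measurable M"
    and f: "integrable M (\<lambda>x. (f x)\<^sup>2)" and g: "integrable M (\<lambda>x. (g x)\<^sup>2)"
  shows "(\<integral>x. f x * g x \<partial>M)\<^sup>2 \<le> (\<integral>x. (f x)\<^sup>2 \<partial>M) * (\<integral>x. (g x)\<^sup>2 \<partial>M)"
proof (rule quadratic_nonneg_imp_discriminant)
  fix s :: real
  have fg: "integrable M (\<lambda>x. f x * g x)" by (rule integrable_mult_of_squares[OF m f g])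
  have "0 \<le> (\<integral>x. (f x + s * g x)\<^sup>2 \<partial>M)" by simp
  also have "\<dots> = (\<integral>x. (f x)\<^sup>2 + 2 * s * (f x * g x) + s\<^sup>2 * (g x)\<^sup>2 \<partial>M)"
    by (intro Bochner_Integration.integral_cong) (auto simp: power2_eq_square algebra_simps)
  also have "\<dots> = (\<integral>x. (f x)\<^sup>2 \<partial>M) + 2 * s * (\<integral>x. f x * g x \<partial>M) + s\<^sup>2 * (\<integral>x. (g x)\<^sup>2 \<partial>M)"
    using f g fg by simp
  finally show "0 \<le> \<dots>" .
qed simp

lemma integral_translate:
  fixes u :: "'a::euclidean_space \<Rightarrow> 'b::{banach, second_countable_topology}"
  assumes "u \<in> borel_measurable borel"
  shows "(\<integral>z. u (a + z) \<partial>lborel) = (\<integral>z. u z \<partial>lborel)"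
proof -
  have "(\<integral>z. u z \<partial>lborel) = (\<integral>z. u z \<partial>distr lborel borel ((+) a))"
    by (simp add: lborel_distr_plus)
  also have "\<dots> = (\<integral>z. u (a + z) \<partial>lborel)"
    by (rule integral_distr) (use assms in auto)
  finally show ?thesis by simp
qed

text \<open>Translation invariance makes the integral of every difference quotient of
  \<open>u\<close> zero, and dominated convergence carries this over to the derivative. The uniform
  bound on \<open>u'\<close> makes \<open>u\<close> Lipschitz, hence the quotients bounded.\<close>

lemma integral_directional_derivative_zero:
  fixes u :: "'a::euclidean_space \<Rightarrow> 'b::euclidean_space"
  assumes der: "\<And>z. (u has_derivative u' z) (at z)"
    and bnd: "\<And>z w. norm (u' z w) \<le> B * norm w"
    and supp: "\<And>z. norm z > R \<Longrightarrow> u z = 0"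
  shows "integrable lborel (\<lambda>z. u' z v)" "(\<integral>z. u' z v \<partial>lborel) = 0"
proof -
  have B: "B \<ge> 0"
  proof -
    obtain b :: 'a where "b \<in> Basis" by (meson nonempty_Basis ex_in_conv)
    then have "norm b = 1" by simp
    then show ?thesis using order_trans[OF norm_ge_zero bnd[of 0 b]] by simp
  qed
  have cont: "continuous_on UNIV u"
    by (rule has_derivative_continuous_on) (use der has_derivative_at_withinI in blast)
  then have [measurable]: "u \<in> borel_measurable borel" by (rule borel_measurable_continuous_onI)
  have onorm: "onorm (u' z) \<le> B" for z by (rule onorm_bound) (use B bnd in auto)
  have lip: "norm (u x - u y) \<le> B * norm (x - y)" for x y
    by (rule differentiable_bound[of UNIV u u']) (use der onorm in auto)
  define h where "h n = 1 / real (Suc n)" for n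
  have h: "h n > 0" "h n \<le> 1" for n by (auto simp: h_def)
  have h0: "h \<longlonglongrightarrow> 0" unfolding h_def by (rule LIMSEQ_Suc) (rule lim_1_over_n)
  define s where "s n z = (u (h n *\<^sub>R v + z) - u z) /\<^sub>R h n" for n z
  have [measurable]: "s n \<in> borel_measurable lborel" for n unfolding s_def by measurable
  have lim: "(\<lambda>n. s n z) \<longlonglongrightarrow> u' z v" for z
  proof -
    have lin: "bounded_linear (u' z)" using der has_derivative_bounded_linear by blast
    have gd: "((\<lambda>t. u (z + t *\<^sub>R v)) has_vector_derivative u' z v) (at 0)"
    proof -
      have "((\<lambda>t. z + t *\<^sub>R v) has_derivative (\<lambda>t. t *\<^sub>R v)) (at (0::real))"
        by (auto intro!: derivative_eq_intros)
      moreover have "(u has_derivative u' z) (at (z + 0 *\<^sub>R v))" using der by simp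
      ultimately have "((\<lambda>t. u (z + t *\<^sub>R v)) has_derivative (\<lambda>t. u' z (t *\<^sub>R v))) (at 0)"
        by (rule has_derivative_compose)
      then show ?thesis using linear_scale[OF bounded_linear.linear[OF lin]]
        by (simp add: has_vector_derivative_def)
    qed
    then have "((\<lambda>t. norm (u (z + t *\<^sub>R v) - u z - t *\<^sub>R u' z v) / norm t) \<longlongrightarrow> 0) (at 0)"
      by (simp add: has_vector_derivative_def has_derivative_at)
    then have "(\<lambda>n. norm (u (z + h n *\<^sub>R v) - u z - h n *\<^sub>R u' z v) / norm (h n)) \<longlonglongrightarrow> 0"
      by (rule filterlim_compose) (use h0 h(1) in \<open>simp add: filterlim_at less_imp_neq[symmetric]\<close>)
    moreover have "norm (u (z + h n *\<^sub>R v) - u z - h n *\<^sub>R u' z v) / norm (h n) = norm (s n z - u' z v)" for n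
    proof -
      have "s n z - u' z v = (u (z + h n *\<^sub>R v) - u z - h n *\<^sub>R u' z v) /\<^sub>R h n"
        using h(1)[of n] by (simp add: s_def scaleR_diff_right add.commute)
      then show ?thesis by (simp add: divide_inverse mult.commute)
    qed
    ultimately have "(\<lambda>n. s n z - u' z v) \<longlonglongrightarrow> 0"
      by (simp add: tendsto_norm_zero_iff)
    then show ?thesis by (rule LIM_zero_cancel)
  qed
  \<comment> \<open>The steps \<open>h n\<close> are at most 1, so the quotient at \<open>z\<close>
    can see the support only if \<open>norm z\<close> is at most \<open>R + norm v\<close>.\<close>
  define w where "w z = B * norm v * indicat_real (cball 0 (R + norm v)) z" for z :: 'a
  have wint: "integrable lborel w" unfolding w_def
    by (intro integrable_mult_right integrable_real_indicator) (use emeasure_lborel_cball_finite in auto)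
  have dom: "norm (s n z) \<le> w z" for n z
  proof (cases "z \<in> cball 0 (R + norm v)")
    case True
    have "norm (s n z) = norm (u (h n *\<^sub>R v + z) - u z) / h n"
      unfolding s_def using h[of n] by (simp add: divide_inverse mult.commute)
    also have "\<dots> \<le> (B * norm (h n *\<^sub>R v)) / h n"
      using lip[of "h n *\<^sub>R v + z" z] h(1)[of n] by (intro divide_right_mono) auto
    also have "\<dots> = w z" using h(1)[of n] True by (simp add: w_def)
    finally show ?thesis .
  next
    case False
    then have z: "norm z > R + norm v" by simp
    have "norm (h n *\<^sub>R v) \<le> norm v" using h[of n] by (simp add: mult_left_le_one_le)
    then have "norm (h n *\<^sub>R v + z) > R"
      using z norm_diff_ineq[of z "h n *\<^sub>R v"] by (simp add: add.commute)
    moreover have "norm z > R" using z by (smt (verit) norm_ge_zero)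
    ultimately show ?thesis using supp B by (simp add: s_def w_def)
  qed
  have [measurable]: "(\<lambda>z. u' z v) \<in> borel_measurable lborel"
    by (rule borel_measurable_LIMSEQ_metric[of s]) (use lim in auto)
  show "integrable lborel (\<lambda>z. u' z v)"
    by (rule integrable_dominated_convergence[of _ _ s w]) (use lim wint dom in auto)
  have "(\<lambda>n. \<integral>z. s n z \<partial>lborel) \<longlonglongrightarrow> (\<integral>z. u' z v \<partial>lborel)"
    by (rule integral_dominated_convergence[of _ _ _ w]) (use lim wint dom in auto)
  moreover have "(\<integral>z. s n z \<partial>lborel) = 0" for n
  proof -
    have iu: "integrable lborel u"
    proof -
      have "compact (u ` cball 0 R)"
        by (rule compact_continuous_image) (use cont continuous_on_subset in auto)
      then obtain M where M: "\<And>z. z \<in> cball 0 R \<Longrightarrow> norm (u z) \<le> M"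
        by (meson bounded_iff compact_imp_bounded imageI)
      have "norm (u z) \<le> norm (M * indicat_real (cball 0 R) z)" for z
        using M[of z] supp[of z] by (cases "z \<in> cball 0 R") auto
      moreover have "integrable lborel (\<lambda>z. M * indicat_real (cball (0::'a) R) z)"
        by (intro integrable_mult_right integrable_real_indicator) (use emeasure_lborel_cball_finite in auto)
      ultimately show ?thesis
        by (intro Bochner_Integration.integrable_bound[of _ "\<lambda>z. M * indicat_real (cball 0 R) z" u]) auto
    qed
    moreover have "integrable lborel (\<lambda>z. u (h n *\<^sub>R v + z))"
    proof -
      have "integrable (distr lborel borel ((+) (h n *\<^sub>R v))) u"
        using iu by (simp add: lborel_distr_plus)
      then show ?thesis by (subst (asm) integrable_distr_eq) auto
    qed
    ultimately show ?thesis
      unfolding s_def by (simp add: integral_translate)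
  qed
  ultimately show "(\<integral>z. u' z v \<partial>lborel) = 0"
    by (simp add: LIMSEQ_const_iff)
qed

section \<open>Holomorphic functions tested against gradients\<close>

lemma GDERIV_unique_zero:
  assumes "GDERIV f z :> G" "open S" "z \<in> S" "\<And>w. w \<in> S \<Longrightarrow> f w = c"
  shows "G = (0::'a::real_inner)"
proof -
  have "((\<lambda>w. c) has_derivative (\<lambda>h. inner h G)) (at z)"
    using assms(1) unfolding gderiv_def
    by (rule has_derivative_transform_within_open[OF _ assms(2,3)]) (use assms(4) in auto)
  then have "(\<lambda>h. inner h G) = (\<lambda>h. 0)"
    using has_derivative_const has_derivative_unique by blast
  then have "inner G G = 0" by metis
  then show ?thesis by simp
qed

text \<open>As a complex number the gradient of \<eta> is its x-derivative plus i times its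
  y-derivative, twice the derivative in the conjugate variable. Since \<open>g\<close> is
  holomorphic, \<open>g z * G z\<close> is the same expression for the compactly supported product
  of \<open>g\<close> and \<eta>, whose partial derivatives integrate to zero.\<close>

lemma integral_holomorphic_mult_gradient:
  fixes g :: "complex \<Rightarrow> complex" and \<eta> :: "complex \<Rightarrow> real"
  assumes D: "open D" and g: "g holomorphic_on D"
    and der: "\<And>z. GDERIV \<eta> z :> G z" and cont: "continuous_on UNIV G"
    and K: "compact K" "K \<subseteq> D" and supp: "\<And>z. z \<notin> K \<Longrightarrow> \<eta> z = 0"
  shows "integrable lborel (\<lambda>z. g z * G z)" "(\<integral>z. g z * G z \<partial>lborel) = 0"
proof -
  have G0: "G z = 0" if "z \<notin> K" for z
    by (rule GDERIV_unique_zero[OF der, of "- K" z 0])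
      (use that K supp in \<open>auto simp: compact_imp_closed open_Compl\<close>)
  define u where "u z = g z * of_real (\<eta> z)" for z
  define u' where "u' z v = (if z \<in> K then deriv g z * v * of_real (\<eta> z) + g z * of_real (inner v (G z)) else 0)" for z v
  have contchi: "continuous_on UNIV \<eta>"
    by (rule has_derivative_continuous_on) (use der[unfolded gderiv_def] has_derivative_at_withinI in blast)
  have du: "(u has_derivative u' z) (at z)" for z
  proof (cases "z \<in> K")
    case True
    then have "(g has_field_derivative deriv g z) (at z)"
      using K D g holomorphic_derivI by blast
    then have 1: "(g has_derivative (\<lambda>v. deriv g z * v)) (at z)"
      by (simp add: has_field_derivative_def)
    have 2: "((\<lambda>z. complex_of_real (\<eta> z)) has_derivative (\<lambda>v. of_real (inner v (G z)))) (at z)"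
      using der[of z] unfolding gderiv_def by (rule has_derivative_of_real)
    show ?thesis
      unfolding u_def[abs_def]
      by (rule has_derivative_eq_rhs[OF has_derivative_mult[OF 1 2]])
        (use True in \<open>auto simp: u'_def fun_eq_iff algebra_simps\<close>)
  next
    case False
    have "((\<lambda>_. 0) has_derivative (\<lambda>v. 0)) (at z)" by simp
    then have "(u has_derivative (\<lambda>v. 0)) (at z)"
      by (rule has_derivative_transform_within_open[of _ _ _ _ "- K"])
        (use False K supp in \<open>auto simp: u_def compact_imp_closed open_Compl\<close>)
    then show ?thesis using False by (simp add: u'_def[abs_def])
  qed
  have bdd: "\<exists>M\<ge>0. \<forall>z\<in>K. norm (h z) \<le> M" if "continuous_on K h" for h :: "complex \<Rightarrow> complex"
  proof -
    have "bounded (h ` K)" using compact_continuous_image[OF that K(1)] compact_imp_bounded by blast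
    then obtain M where "\<forall>x\<in>h ` K. norm x \<le> M" unfolding bounded_iff by blast
    then show ?thesis by (intro exI[of _ "max 0 M"]) auto
  qed
  have cg: "continuous_on K g" "continuous_on K (deriv g)"
    using g K D holomorphic_deriv[OF g D]
    by (auto intro: continuous_on_subset holomorphic_on_imp_continuous_on)
  obtain M1 where M1: "M1 \<ge> 0" "\<And>z. z \<in> K \<Longrightarrow> norm (deriv g z * of_real (\<eta> z)) \<le> M1"
    using bdd[OF continuous_on_mult[OF cg(2) continuous_on_of_real[OF continuous_on_subset[OF contchi]]]]
    by auto
  obtain M2 where M2: "M2 \<ge> 0" "\<And>z. z \<in> K \<Longrightarrow> norm (g z * G z) \<le> M2"
    using bdd[OF continuous_on_mult[OF cg(1) continuous_on_subset[OF cont]]]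
    by auto
  have bnd: "norm (u' z v) \<le> (M1 + M2) * norm v" for z v
  proof (cases "z \<in> K")
    case True
    have "norm (u' z v) \<le> norm (deriv g z * v * of_real (\<eta> z)) + norm (g z * of_real (inner v (G z)))"
      using True by (simp add: u'_def norm_triangle_ineq)
    also have "\<dots> \<le> norm (deriv g z * of_real (\<eta> z)) * norm v + norm (g z * G z) * norm v"
      using mult_left_mono[OF Cauchy_Schwarz_ineq2[of v "G z"], of "norm (g z)"]
      by (simp add: norm_mult mult_ac)
    also have "\<dots> \<le> M1 * norm v + M2 * norm v"
      using M1(2)[OF True] M2(2)[OF True] by (intro add_mono mult_right_mono) auto
    finally show ?thesis by (simp add: distrib_right)
  next
    case False
    then show ?thesis using M1 M2 by (simp add: u'_def)
  qed
  obtain R where R: "\<And>z. z \<in> K \<Longrightarrow> norm z \<le> R"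
    using K(1) compact_imp_bounded bounded_iff by metis
  have u0: "norm z > R \<Longrightarrow> u z = 0" for z
    using R[of z] supp[of z] by (force simp: u_def)
  note I = integral_directional_derivative_zero[of u u' "M1 + M2" R, OF du bnd u0]
  \<comment> \<open>The two terms with \<open>deriv g\<close> cancel because 1 + i * i = 0: the
    Cauchy-Riemann equations.\<close>
  have eq: "u' z 1 + \<i> * u' z \<i> = g z * G z" for z
  proof (cases "z \<in> K")
    case True
    have "g z * G z = g z * (of_real (Re (G z)) + \<i> * of_real (Im (G z)))"
      by (simp add: complex_eq[symmetric])
    then show ?thesis using True by (simp add: u'_def inner_complex_def algebra_simps)
  qed (simp add: u'_def G0)
  have "integrable lborel (\<lambda>z. u' z 1 + \<i> * u' z \<i>)"
    by (intro Bochner_Integration.integrable_add integrable_mult_right I(1))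
  then show "integrable lborel (\<lambda>z. g z * G z)" by (simp add: eq)
  have "(\<integral>z. u' z 1 + \<i> * u' z \<i> \<partial>lborel) = 0"
    using I by (subst Bochner_Integration.integral_add) auto
  then show "(\<integral>z. g z * G z \<partial>lborel) = 0" by (simp add: eq)
qed

text \<open>A transition from 0 to 1 over the unit interval. Both corners have the form
  \<open>(max 0 x)\<^sup>2\<close>, which is continuously differentiable, so \<open>step\<close> is
  C^1 without being defined by cases.\<close>

definition step :: "real \<Rightarrow> real" where
  "step u = 1 - (max 0 (1 - (max 0 u)\<^sup>2))\<^sup>2"

definition step' :: "real \<Rightarrow> real" where
  "step' u = 4 * max 0 (1 - (max 0 u)\<^sup>2) * max 0 u"

lemma has_real_derivative_max_0_power2:
  "((\<lambda>u::real. (max 0 u)\<^sup>2) has_real_derivative 2 * max 0 u) (at u)"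
proof -
  consider "u < 0" | "u > 0" | "u = 0" by linarith
  then show ?thesis
  proof cases
    case 1
    have "((\<lambda>u::real. 0) has_real_derivative 0) (at u)" by simp
    then have "((\<lambda>u::real. (max 0 u)\<^sup>2) has_real_derivative 0) (at u)"
      by (rule has_field_derivative_transform_within_open[of _ _ _ "{..<0}"]) (use 1 in auto)
    then show ?thesis using 1 by simp
  next
    case 2
    have "((\<lambda>u::real. u\<^sup>2) has_real_derivative 2 * u) (at u)"
      by (auto intro!: derivative_eq_intros)
    then have "((\<lambda>u::real. (max 0 u)\<^sup>2) has_real_derivative 2 * u) (at u)"
      by (rule has_field_derivative_transform_within_open[of _ _ _ "{0<..}"]) (use 2 in auto)
    then show ?thesis using 2 by simp
  next
    case 3
    have "((\<lambda>h::real. (max 0 h)\<^sup>2 / h) \<longlongrightarrow> 0) (at 0)"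
    proof (rule Lim_null_comparison)
      show "\<forall>\<^sub>F h::real in at 0. norm ((max 0 h)\<^sup>2 / h) \<le> \<bar>h\<bar>"
        by (rule always_eventually) (auto simp: max_def power2_eq_square)
      show "((\<lambda>h::real. \<bar>h\<bar>) \<longlongrightarrow> 0) (at 0)" by (rule tendsto_rabs_zero) simp
    qed
    then show ?thesis by (simp add: 3 DERIV_def)
  qed
qed

lemma step_DERIV: "(step has_real_derivative step' u) (at u)"
proof -
  have "((\<lambda>u. 1 - (max 0 (1 - (max 0 u)\<^sup>2))\<^sup>2) has_real_derivative
      0 - 2 * max 0 (1 - (max 0 u)\<^sup>2) * (0 - 2 * max 0 u)) (at u)"
    by (intro DERIV_diff DERIV_const has_real_derivative_max_0_power2
        DERIV_chain2[of "\<lambda>y. (max 0 y)\<^sup>2" _ "\<lambda>u. 1 - (max 0 u)\<^sup>2"])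
  then show ?thesis by (simp add: step_def[abs_def] step'_def mult.assoc)
qed

lemma continuous_step': "continuous_on S step'"
  unfolding step'_def[abs_def] by (intro continuous_intros)

lemma step_bounds: "0 \<le> step u" "step u \<le> 1"
proof -
  have "0 \<le> max 0 (1 - (max 0 u)\<^sup>2)" "max 0 (1 - (max 0 u)\<^sup>2) \<le> 1" by auto
  then show "0 \<le> step u" unfolding step_def by (simp add: power_le_one)
  show "step u \<le> 1" unfolding step_def by simp
qed

lemma step_eq_0: "u \<le> 0 \<Longrightarrow> step u = 0" by (simp add: step_def)

lemma step_eq_1: "u \<ge> 1 \<Longrightarrow> step u = 1"
  using one_le_power[of u 2] by (simp add: step_def)

lemma step'_nonneg: "step' u \<ge> 0" by (simp add: step'_def)

lemma step'_eq_0: "u \<le> 0 \<or> u \<ge> 1 \<Longrightarrow> step' u = 0"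
  using one_le_power[of u 2] by (auto simp: step'_def)

lemma step'_le: "step' u \<le> 4"
proof (cases "0 < u \<and> u < 1")
  case True
  then have "(1 - u\<^sup>2) * u \<le> 1 * 1" by (intro mult_mono) auto
  moreover have "u\<^sup>2 \<le> 1" using True by (simp add: power_le_one)
  ultimately have "max 0 (1 - u\<^sup>2) * u \<le> 1" by simp
  then show ?thesis using True by (simp add: step'_def)
next
  case False
  then have "step' u = 0" by (intro step'_eq_0) auto
  then show ?thesis by simp
qed

lemma GDERIV_radial_step:
  fixes c z :: complex
  assumes "(\<phi> has_real_derivative d) (at ((cmod (z - c))\<^sup>2))"
  shows "GDERIV (\<lambda>z. step (\<phi> ((cmod (z - c))\<^sup>2))) z :> of_real (2 * step' (\<phi> ((cmod (z - c))\<^sup>2)) * d) * (z - c)"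
proof -
  have "((\<lambda>y. step (\<phi> y)) has_real_derivative step' (\<phi> ((cmod (z - c))\<^sup>2)) * d) (at ((cmod (z - c))\<^sup>2))"
    by (rule DERIV_chain2[OF step_DERIV assms])
  moreover have "((\<lambda>z. (cmod (z - c))\<^sup>2) has_derivative (\<lambda>h. 2 * inner h (z - c))) (at z)"
    unfolding power2_norm_eq_inner
    by (auto intro!: derivative_eq_intros simp: inner_commute)
  ultimately have "((\<lambda>z. step (\<phi> ((cmod (z - c))\<^sup>2))) has_derivative
      (\<lambda>h. step' (\<phi> ((cmod (z - c))\<^sup>2)) * d * (2 * inner h (z - c)))) (at z)"
    unfolding has_field_derivative_def by (rule has_derivative_compose[rotated])
  then show ?thesis
    unfolding gderiv_def
    by (rule has_derivative_eq_rhs)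
      (simp add: fun_eq_iff scaleR_conv_of_real[symmetric] del: of_real_mult)
qed

lemma measure_ball_complex: "r \<ge> 0 \<Longrightarrow> measure lborel (ball (c::complex) r) = pi * r\<^sup>2"
  "r \<ge> 0 \<Longrightarrow> measure lborel (cball (c::complex) r) = pi * r\<^sup>2"
  by (auto simp: content_ball content_cball unit_ball_vol_2)

text \<open>Dividing the gradient of a radial function by \<open>z - x\<close> leaves a nonnegative
  real density \<kappa>. Its integral is 2 pi by polar coordinates; the lower bound 1 follows from a
  single annulus on which \<kappa> is large.\<close>

lemma bump_at_point:
  fixes x :: complex and \<delta> :: real
  assumes "\<delta> > 0"
  obtains \<psi> :: "complex \<Rightarrow> real" and \<kappa> :: "complex \<Rightarrow> real" where
    "\<And>z. GDERIV \<psi> z :> (of_real (\<kappa> z) * (z - x))"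
    "continuous_on UNIV \<kappa>" "\<And>z. \<kappa> z \<ge> 0"
    "\<And>z. cmod (z - x) \<le> \<delta> / 2 \<Longrightarrow> \<psi> z = 0"
    "\<And>z. cmod (z - x) \<ge> \<delta> \<Longrightarrow> \<psi> z = 1"
    "\<And>z. cmod (z - x) \<le> \<delta> / 2 \<or> cmod (z - x) \<ge> \<delta> \<Longrightarrow> \<kappa> z = 0"
    "integrable lborel \<kappa>" "1 \<le> (\<integral>z. \<kappa> z \<partial>lborel)"
proof -
  define \<phi> where "\<phi> y = (4 / \<delta>\<^sup>2) * y - 1" for y
  define \<psi> where "\<psi> z = step (\<phi> ((cmod (z - x))\<^sup>2))" for z
  define \<kappa> where "\<kappa> z = 2 * step' (\<phi> ((cmod (z - x))\<^sup>2)) * (4 / \<delta>\<^sup>2)" for z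
  have d\<phi>: "(\<phi> has_real_derivative 4 / \<delta>\<^sup>2) (at y)" for y
    unfolding \<phi>_def[abs_def]
    using DERIV_diff[OF DERIV_cmult_Id[of "4 / \<delta>\<^sup>2"] DERIV_const[of 1]] by simp
  have 1: "GDERIV \<psi> z :> (of_real (\<kappa> z) * (z - x))" for z
    unfolding \<psi>_def[abs_def] \<kappa>_def by (rule GDERIV_radial_step[OF d\<phi>])
  have 2: "continuous_on UNIV \<kappa>"
    unfolding \<kappa>_def[abs_def] \<phi>_def[abs_def]
    by (intro continuous_intros continuous_on_compose2[OF continuous_step'[of UNIV]])
      (use assms in auto)
  have 3: "\<kappa> z \<ge> 0" for z
    unfolding \<kappa>_def using step'_nonneg by simp
  have le: "\<phi> ((cmod (z - x))\<^sup>2) \<le> 0" if "cmod (z - x) \<le> \<delta> / 2" for z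
  proof -
    have "(cmod (z - x))\<^sup>2 \<le> (\<delta> / 2)\<^sup>2" using that by (intro power_mono) auto
    then show ?thesis using assms by (simp add: \<phi>_def field_simps power2_eq_square)
  qed
  have ge: "\<phi> ((cmod (z - x))\<^sup>2) \<ge> 1" if "cmod (z - x) \<ge> \<delta>" for z
  proof -
    have "\<delta>\<^sup>2 \<le> (cmod (z - x))\<^sup>2" using that assms by (intro power_mono) auto
    then have "(4 / \<delta>\<^sup>2) * \<delta>\<^sup>2 \<le> (4 / \<delta>\<^sup>2) * (cmod (z - x))\<^sup>2" by (intro mult_left_mono) auto
    then show ?thesis using assms by (simp add: \<phi>_def)
  qed
  have 4: "cmod (z - x) \<le> \<delta> / 2 \<Longrightarrow> \<psi> z = 0" for z
    unfolding \<psi>_def using le by (intro step_eq_0)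
  have 5: "cmod (z - x) \<ge> \<delta> \<Longrightarrow> \<psi> z = 1" for z
    unfolding \<psi>_def using ge by (intro step_eq_1)
  have 6: "cmod (z - x) \<le> \<delta> / 2 \<or> cmod (z - x) \<ge> \<delta> \<Longrightarrow> \<kappa> z = 0" for z
    unfolding \<kappa>_def using le[of z] ge[of z] step'_eq_0 by auto
  have 7: "integrable lborel \<kappa>"
  proof -
    have "(\<lambda>z. indicat_real (cball x \<delta>) z *\<^sub>R \<kappa> z) = \<kappa>"
    proof (rule ext)
      fix z show "indicat_real (cball x \<delta>) z *\<^sub>R \<kappa> z = \<kappa> z"
        using 6[of z] by (cases "z \<in> cball x \<delta>") (auto simp: dist_norm norm_minus_commute)
    qed
    moreover have "integrable lborel (\<lambda>z. indicat_real (cball x \<delta>) z *\<^sub>R \<kappa> z)"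
      by (rule borel_integrable_compact) (use 2 continuous_on_subset in auto)
    ultimately show ?thesis by (simp only:)
  qed
  have 8: "1 \<le> (\<integral>z. \<kappa> z \<partial>lborel)"
  proof -
    \<comment> \<open>At these radii \<phi> takes the values 1/4 and 1/2. Between them
      \<open>step'\<close> is at least 3/4, so \<kappa> is at least 6 / \<delta>^2 on an annulus of
      area pi \<delta>^2 / 16, and 3 pi / 8 > 1.\<close>
    define a b where "a = \<delta> * sqrt (5 / 16)" and "b = \<delta> * sqrt (3 / 8)"
    have ab: "0 \<le> a" "a \<le> b" "0 \<le> b" using assms by (auto simp: a_def b_def)
    have a2: "a\<^sup>2 = \<delta>\<^sup>2 * (5 / 16)" and b2: "b\<^sup>2 = \<delta>\<^sup>2 * (3/8)"
      by (auto simp: a_def b_def power_mult_distrib)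
    define A where "A = ball x b - ball x a"
    have mA: "measure lborel A = pi * (\<delta>\<^sup>2 / 16)"
    proof -
      have "measure lborel A = measure lborel (ball x b) - measure lborel (ball x a)"
        unfolding A_def using ab
        by (intro measure_Diff) (use emeasure_lborel_ball_finite[of x b] in \<open>auto simp: less_top[symmetric]\<close>)
      also have "\<dots> = pi * (\<delta>\<^sup>2 / 16)"
        using ab by (simp add: measure_ball_complex a2 b2 algebra_simps)
      finally show ?thesis .
    qed
    have fin: "emeasure lborel A < \<infinity>"
      unfolding A_def by (intro emeasure_bounded_finite) (auto intro: bounded_subset[OF bounded_ball])
    have low: "6 / \<delta>\<^sup>2 \<le> \<kappa> z" if "z \<in> A" for z
    proof -
      define y where "y = (cmod (z - x))\<^sup>2"
      have "a \<le> cmod (z - x)" "cmod (z - x) \<le> b"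
        using that by (auto simp: A_def dist_norm norm_minus_commute)
      then have "a\<^sup>2 \<le> y" "y \<le> b\<^sup>2" unfolding y_def using ab by (auto intro: power_mono)
      then have u: "1/4 \<le> \<phi> y" "\<phi> y \<le> 1/2"
        using assms by (auto simp: \<phi>_def a2 b2 field_simps)
      have "(\<phi> y)\<^sup>2 \<le> (1/2)\<^sup>2" using u by (intro power_mono) auto
      then have "3/4 * (1/4) \<le> (1 - (\<phi> y)\<^sup>2) * \<phi> y"
        using u by (intro mult_mono) (auto simp: power2_eq_square)
      moreover have "(1 - (\<phi> y)\<^sup>2) * \<phi> y \<le> max 0 (1 - (\<phi> y)\<^sup>2) * \<phi> y"
        using u by (intro mult_right_mono) auto
      ultimately have "3/16 \<le> max 0 (1 - (\<phi> y)\<^sup>2) * \<phi> y" by linarith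
      moreover have "max 0 (\<phi> y) = \<phi> y" using u by simp
      then have "step' (\<phi> y) = 4 * (max 0 (1 - (\<phi> y)\<^sup>2) * \<phi> y)"
        by (simp only: step'_def mult.assoc)
      ultimately have "3/4 \<le> step' (\<phi> y)" by linarith
      then show ?thesis using assms by (simp add: \<kappa>_def y_def[symmetric] field_simps)
    qed
    have "(\<integral>z. (6 / \<delta>\<^sup>2) * indicat_real A z \<partial>lborel) \<le> (\<integral>z. \<kappa> z \<partial>lborel)"
    proof (rule integral_mono[OF _ 7])
      show "integrable lborel (\<lambda>z. (6 / \<delta>\<^sup>2) * indicat_real A z)"
        using fin by (intro integrable_mult_right integrable_real_indicator) (auto simp: A_def)
      show "6 / \<delta>\<^sup>2 * indicat_real A z \<le> \<kappa> z" for z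
        using low 3 by (cases "z \<in> A") auto
    qed
    also have "(\<integral>z. (6 / \<delta>\<^sup>2) * indicat_real A z \<partial>lborel) = 6 / \<delta>\<^sup>2 * (pi * (\<delta>\<^sup>2 / 16))"
      by (simp add: mA)
    also have "\<dots> = 3 * pi / 8" using assms by simp
    finally show ?thesis using pi_gt3 by simp
  qed
  show ?thesis using that[of \<psi> \<kappa>] 1 2 3 4 5 6 7 8 by blast
qed

text \<open>Multiplying \<eta> by the bump \<psi> removes the pole of 1 / (z - x) from the support,
  so the gradient of the product integrates to zero against it. That gradient is the sum of
  \<open>G\<close> and the gradient of \<psi>, which live on disjoint sets, so the integral in
  question is minus the integral of \<kappa>.\<close>

lemma cauchy_weight:
  fixes \<eta> :: "complex \<Rightarrow> real"
  assumes der: "\<And>z. GDERIV \<eta> z :> G z" and cont: "continuous_on UNIV G"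
    and K: "compact K" and supp: "\<And>z. z \<notin> K \<Longrightarrow> \<eta> z = 0"
    and one: "\<delta> > 0" "\<And>z. cmod (z - x) < \<delta> \<Longrightarrow> \<eta> z = 1"
  shows "integrable lborel (\<lambda>z. G z / (z - x))" "1 \<le> cmod (\<integral>z. G z / (z - x) \<partial>lborel)"
proof -
  \<comment> \<open>With half the radius the whole transition of \<psi> takes place where \<eta> is
    1.\<close>
  define \<delta>' where "\<delta>' = \<delta> / 2"
  have \<delta>': "\<delta>' > 0" "\<delta>' < \<delta>" using one(1) by (auto simp: \<delta>'_def)
  obtain \<psi> \<kappa> where \<psi>: "\<And>z. GDERIV \<psi> z :> (of_real (\<kappa> z) * (z - x))"
    "continuous_on UNIV \<kappa>" "\<And>z. \<kappa> z \<ge> 0"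
    "\<And>z. cmod (z - x) \<le> \<delta>' / 2 \<Longrightarrow> \<psi> z = 0"
    "\<And>z. cmod (z - x) \<ge> \<delta>' \<Longrightarrow> \<psi> z = 1"
    "\<And>z. cmod (z - x) \<le> \<delta>' / 2 \<or> cmod (z - x) \<ge> \<delta>' \<Longrightarrow> \<kappa> z = 0"
    "integrable lborel \<kappa>" "1 \<le> (\<integral>z. \<kappa> z \<partial>lborel)"
    using bump_at_point[OF \<delta>'(1), of x] by blast
  have G0: "G z = 0" if "cmod (z - x) < \<delta>" for z
    by (rule GDERIV_unique_zero[OF der, of "ball x \<delta>" z 1])
      (use that one in \<open>auto simp: dist_norm norm_minus_commute\<close>)
  define H where "H z = \<eta> z *\<^sub>R (of_real (\<kappa> z) * (z - x)) + \<psi> z *\<^sub>R G z" for z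
  have contpsi: "continuous_on UNIV \<psi>"
    by (rule has_derivative_continuous_on)
      (use \<psi>(1)[unfolded gderiv_def] has_derivative_at_withinI in blast)
  have conteta: "continuous_on UNIV \<eta>"
    by (rule has_derivative_continuous_on)
      (use der[unfolded gderiv_def] has_derivative_at_withinI in blast)
  have dH: "GDERIV (\<lambda>z. \<eta> z * \<psi> z) z :> H z" for z
    unfolding H_def by (rule GDERIV_mult[OF der \<psi>(1)])
  have cH: "continuous_on UNIV H"
    unfolding H_def[abs_def] using contpsi conteta \<psi>(2) cont by (intro continuous_intros) auto
  have "compact (K - ball x (\<delta>' / 2))" using K by (simp add: compact_diff)
  moreover have "(\<lambda>z. 1 / (z - x)) holomorphic_on - {x}" by (auto intro!: holomorphic_intros)
  moreover have "\<eta> z * \<psi> z = 0" if "z \<notin> K - ball x (\<delta>' / 2)" for z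
    using that supp[of z] \<psi>(4)[of z] by (auto simp: dist_norm norm_minus_commute)
  ultimately have I: "integrable lborel (\<lambda>z. 1 / (z - x) * H z)" "(\<integral>z. 1 / (z - x) * H z \<partial>lborel) = 0"
    using integral_holomorphic_mult_gradient[of "- {x}" "\<lambda>z. 1 / (z - x)" "\<lambda>z. \<eta> z * \<psi> z" H "K - ball x (\<delta>' / 2)"]
      dH cH \<delta>' by (auto simp: dist_norm)
  have eq: "1 / (z - x) * H z = of_real (\<kappa> z) + G z / (z - x)" for z
  proof (cases "z = x")
    case True
    then show ?thesis using \<psi>(6)[of x] \<delta>' G0[of x] one by simp
  next
    case False
    have "\<eta> z * \<kappa> z = \<kappa> z" using \<psi>(6)[of z] one(2)[of z] \<delta>' by (cases "cmod (z - x) < \<delta>'") auto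
    moreover have "\<psi> z *\<^sub>R G z = G z"
      using \<psi>(5)[of z] G0[of z] \<delta>' by (cases "cmod (z - x) < \<delta>'") auto
    moreover have "H z = of_real (\<eta> z * \<kappa> z) * (z - x) + \<psi> z *\<^sub>R G z"
      by (simp add: H_def scaleR_conv_of_real)
    ultimately have "H z = of_real (\<kappa> z) * (z - x) + G z" by (simp only:)
    then show ?thesis using False by (simp add: field_simps)
  qed
  have i\<kappa>: "integrable lborel (\<lambda>z. complex_of_real (\<kappa> z))" using \<psi>(7) by simp
  have "integrable lborel (\<lambda>z. (of_real (\<kappa> z) + G z / (z - x)) - of_real (\<kappa> z))"
    using Bochner_Integration.integrable_diff[OF I(1)[unfolded eq] i\<kappa>] .
  then show ig: "integrable lborel (\<lambda>z. G z / (z - x))" by simp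
  have "(\<integral>z. G z / (z - x) \<partial>lborel) = - of_real (\<integral>z. \<kappa> z \<partial>lborel)"
    using I(2) i\<kappa> ig unfolding eq by (subst (asm) Bochner_Integration.integral_add) (auto simp: add_eq_0_iff)
  then show "1 \<le> cmod (\<integral>z. G z / (z - x) \<partial>lborel)" using \<psi>(8) by simp
qed

text \<open>A weak form of the Cauchy--Pompeiu formula, in which the constant is only bounded below.\<close>

lemma holomorphic_le_weighted_integral:
  fixes \<eta> :: "complex \<Rightarrow> real"
  assumes D: "open D" and f: "f holomorphic_on D" and x: "x \<in> D"
    and der: "\<And>z. GDERIV \<eta> z :> G z" and cont: "continuous_on UNIV G"
    and K: "compact K" "K \<subseteq> D" and supp: "\<And>z. z \<notin> K \<Longrightarrow> \<eta> z = 0"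
    and one: "\<delta> > 0" "\<And>z. cmod (z - x) < \<delta> \<Longrightarrow> \<eta> z = 1"
  shows "cmod (f x) \<le> cmod (\<integral>z. f z * G z / (z - x) \<partial>lborel)"
proof -
  \<comment> \<open>Writing f(z) / (z - x) = g(z) + f(x) / (z - x) isolates the pole:
    \<open>g\<close> is holomorphic and integrates to zero against the gradient, so only the weight
    of \<open>cauchy_weight\<close> remains.\<close>
  define g where "g = (\<lambda>z. if z = x then deriv f x else (f z - f x) / (z - x))"
  have g: "g holomorphic_on D" unfolding g_def by (rule pole_lemma_open[OF f D])
  note I = integral_holomorphic_mult_gradient[OF D g der cont K supp]
  note W = cauchy_weight[where x = x, OF der cont K(1) supp one]
  have G0: "G x = 0"
    by (rule GDERIV_unique_zero[OF der, of "ball x \<delta>" x 1])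
      (use one in \<open>auto simp: dist_norm norm_minus_commute\<close>)
  have eq: "f z * G z / (z - x) = g z * G z + f x * (G z / (z - x))" for z
    using G0 by (auto simp: g_def add_divide_distrib[symmetric] left_diff_distrib)
  have "(\<integral>z. f z * G z / (z - x) \<partial>lborel) = f x * (\<integral>z. G z / (z - x) \<partial>lborel)"
    unfolding eq using I W by (subst Bochner_Integration.integral_add) (auto simp del: times_divide_eq_right)
  then have "cmod (\<integral>z. f z * G z / (z - x) \<partial>lborel) = cmod (f x) * cmod (\<integral>z. G z / (z - x) \<partial>lborel)"
    by (simp add: norm_mult)
  moreover have "cmod (f x) * 1 \<le> cmod (f x) * cmod (\<integral>z. G z / (z - x) \<partial>lborel)"
    using W(2) by (intro mult_left_mono) auto
  ultimately show ?thesis by simp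
qed

text \<open>Since \<open>f x = 0\<close>, the quotient f(z) / (z - x) extends holomorphically with
  value \<open>deriv f x\<close> at \<open>x\<close>. The bound for values, applied to it,
  contributes the second factor \<open>z - x\<close>.\<close>

lemma deriv_le_weighted_integral:
  fixes \<eta> :: "complex \<Rightarrow> real"
  assumes D: "open D" and f: "f holomorphic_on D" and x: "x \<in> D" and f0: "f x = 0"
    and der: "\<And>z. GDERIV \<eta> z :> G z" and cont: "continuous_on UNIV G"
    and K: "compact K" "K \<subseteq> D" and supp: "\<And>z. z \<notin> K \<Longrightarrow> \<eta> z = 0"
    and one: "\<delta> > 0" "\<And>z. cmod (z - x) < \<delta> \<Longrightarrow> \<eta> z = 1"
  shows "cmod (deriv f x) \<le> cmod (\<integral>z. f z * G z / (z - x)\<^sup>2 \<partial>lborel)"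
proof -
  define g where "g = (\<lambda>z. if z = x then deriv f x else (f z - f x) / (z - x))"
  have g: "g holomorphic_on D" unfolding g_def by (rule pole_lemma_open[OF f D])
  have G0: "G x = 0"
    by (rule GDERIV_unique_zero[OF der, of "ball x \<delta>" x 1])
      (use one in \<open>auto simp: dist_norm norm_minus_commute\<close>)
  have "cmod (g x) \<le> cmod (\<integral>z. g z * G z / (z - x) \<partial>lborel)"
    by (rule holomorphic_le_weighted_integral[OF D g x der cont K supp one])
  moreover have "g z * G z / (z - x) = f z * G z / (z - x)\<^sup>2" for z
    using G0 f0 by (auto simp: g_def field_simps power2_eq_square)
  ultimately show ?thesis by (simp add: g_def)
qed

section \<open>Logarithmic cutoffs\<close>

text \<open>The exact value is 2 pi ln (b / a). The shell is covered by discs of radii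
  \<open>a * 2 ^ Suc j\<close>, the j-th carrying the weight \<open>1 / (a * 2 ^ j)\<^sup>2\<close>.
  Each contributes 4 pi, and their number is at most 1 plus the binary logarithm of b / a, so disc
  areas suffice.\<close>

lemma shell_integral:
  fixes c :: complex
  assumes "0 < a" "a \<le> b"
  defines "h \<equiv> \<lambda>w. indicat_real {w. a \<le> cmod (w - c) \<and> cmod (w - c) \<le> b} w / (cmod (w - c))\<^sup>2"
  shows "integrable lborel h" "(\<integral>w. h w \<partial>lborel) \<le> 4 * pi * (1 + ln (b / a) / ln 2)"
proof -
  define n where "n = nat \<lfloor>log 2 (b / a)\<rfloor>"
  define H where "H w = (\<Sum>j\<le>n. 1 / (a * 2 ^ j)\<^sup>2 * indicat_real (cball c (a * 2 ^ Suc j)) w)" for w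
  have le: "h w \<le> H w" for w
  proof (cases "a \<le> cmod (w - c) \<and> cmod (w - c) \<le> b")
    case True
    define y where "y = cmod (w - c)"
    have y: "a \<le> y" "y \<le> b" "0 < y" using True assms(1) by (auto simp: y_def)
    define j where "j = nat \<lfloor>log 2 (y / a)\<rfloor>"
    have l0: "0 \<le> log 2 (y / a)" using y assms by simp
    have jn: "j \<le> n" unfolding j_def n_def
      using y assms by (intro nat_mono floor_mono) (auto simp: divide_right_mono)
    have "real j \<le> log 2 (y / a)" using l0 unfolding j_def by (simp add: of_nat_nat)
    then have "2 powr real j \<le> y / a" using y assms by (simp add: le_log_iff)
    then have 1: "a * 2 ^ j \<le> y" using assms by (simp add: powr_realpow field_simps)
    have "log 2 (y / a) < real (Suc j)" using l0 unfolding j_def by linarith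
    then have "y / a < 2 powr real (Suc j)" using y assms by (subst (asm) log_less_iff) auto
    then have 2: "y < a * 2 ^ Suc j" using assms by (simp add: powr_realpow field_simps del: power_Suc of_nat_Suc)
    have "h w = 1 / y\<^sup>2" using True by (simp add: h_def y_def)
    also have "\<dots> \<le> 1 / (a * 2 ^ j)\<^sup>2" using 1 assms y by (intro divide_left_mono power_mono) auto
    also have "\<dots> = 1 / (a * 2 ^ j)\<^sup>2 * indicat_real (cball c (a * 2 ^ Suc j)) w"
      using 2 by (simp add: y_def dist_norm norm_minus_commute)
    also have "\<dots> \<le> H w"
      unfolding H_def using jn by (intro member_le_sum) auto
    finally show ?thesis .
  next
    case False
    have "0 \<le> H w" unfolding H_def by (intro sum_nonneg) auto
    then show ?thesis using False by (simp add: h_def)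
  qed
  have iH: "integrable lborel H"
    unfolding H_def
    by (intro Bochner_Integration.integrable_sum integrable_mult_right integrable_real_indicator)
      (use emeasure_lborel_cball_finite in auto)
  have hn: "0 \<le> h w" for w by (simp add: h_def)
  show ih: "integrable lborel h"
  proof (rule Bochner_Integration.integrable_bound[OF iH])
    have "{w. a \<le> cmod (w - c) \<and> cmod (w - c) \<le> b} \<in> sets borel"
      by (intro borel_closed) (auto intro!: closed_Collect_conj closed_Collect_le continuous_intros)
    then show "h \<in> borel_measurable lborel" unfolding h_def by measurable
    show "AE w in lborel. norm (h w) \<le> norm (H w)" using le hn by (auto intro!: AE_I2 order_trans[OF le abs_ge_self])
  qed
  have "(\<integral>w. h w \<partial>lborel) \<le> (\<integral>w. H w \<partial>lborel)" by (rule integral_mono[OF ih iH le])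
  also have "\<dots> = (\<Sum>j\<le>n. 1 / (a * 2 ^ j)\<^sup>2 * (pi * (a * 2 ^ Suc j)\<^sup>2))"
    unfolding H_def using assms
    by (subst Bochner_Integration.integral_sum)
      (auto intro!: integrable_mult_right integrable_real_indicator sum.cong
        simp: measure_ball_complex emeasure_lborel_cball_finite[simplified] simp del: power_Suc)
  also have "\<dots> = (\<Sum>j\<le>n. 4 * pi)"
    using assms by (intro sum.cong) (auto simp: power_mult_distrib field_simps power2_eq_square)
  also have "\<dots> = 4 * pi * (real n + 1)" by (simp add: algebra_simps)
  also have "\<dots> \<le> 4 * pi * (1 + ln (b / a) / ln 2)"
  proof -
    have "real n \<le> log 2 (b / a)" using assms unfolding n_def by (simp add: of_nat_nat)
    then show ?thesis by (simp add: log_def)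
  qed
  finally show "(\<integral>w. h w \<partial>lborel) \<le> 4 * pi * (1 + ln (b / a) / ln 2)" .
qed

text \<open>\<open>E\<close> bounds the square root of the Dirichlet energy: after Cauchy-Schwarz
  these roots are what is added up.\<close>

definition cutoff :: "(complex \<Rightarrow> real) \<Rightarrow> (complex \<Rightarrow> complex) \<Rightarrow> real \<Rightarrow> bool" where
  "cutoff \<eta> G E \<longleftrightarrow> (\<forall>z. GDERIV \<eta> z :> (G z)) \<and> continuous_on UNIV G \<and> (\<forall>z. 0 \<le> \<eta> z \<and> \<eta> z \<le> 1) \<and>
    integrable lborel (\<lambda>z. (cmod (G z))\<^sup>2) \<and> 0 \<le> E \<and> (\<integral>z. (cmod (G z))\<^sup>2 \<partial>lborel) \<le> E\<^sup>2"

lemma cutoff_mono: "cutoff \<eta> G E \<Longrightarrow> E \<le> E' \<Longrightarrow> cutoff \<eta> G E'"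
  unfolding cutoff_def by (auto intro: order_trans power_mono)

text \<open>The logarithm is the potential of a disc, so this profile separates radius
  \<open>a\<close> from radius \<open>b\<close> with energy of the optimal order 1 / L. The shift by
  \<open>a\<^sup>2\<close> keeps the logarithm smooth at the centre, and the divisor
  \<open>2 * a\<^sup>2\<close> then puts its zero at radius \<open>a\<close>.\<close>

lemma log_cutoff:
  fixes c :: complex and a b :: real
  assumes a: "0 < a" and b: "0 < b"
  defines "L \<equiv> ln (b\<^sup>2 / (2 * a\<^sup>2))"
  assumes L: "L \<ge> 1"
  obtains \<eta> :: "complex \<Rightarrow> real" and G :: "complex \<Rightarrow> complex" where
    "cutoff \<eta> G (46 / sqrt L)"
    "\<And>z. cmod (z - c) \<le> a \<Longrightarrow> \<eta> z = 0" "\<And>z. b \<le> cmod (z - c) \<Longrightarrow> \<eta> z = 1"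
    "\<And>z. G z \<noteq> 0 \<Longrightarrow> a < cmod (z - c) \<and> cmod (z - c) < b"
proof -
  define \<phi> where "\<phi> y = ln ((y + a\<^sup>2) / (2 * a\<^sup>2)) / L" for y
  define \<eta> where "\<eta> z = step (\<phi> ((cmod (z - c))\<^sup>2))" for z
  define k where "k z = 2 * step' (\<phi> ((cmod (z - c))\<^sup>2)) * (1 / (((cmod (z - c))\<^sup>2 + a\<^sup>2) * L))" for z
  define G where "G z = of_real (k z) * (z - c)" for z
  have pos: "0 < y + a\<^sup>2" if "0 \<le> y" for y using that a by (simp add: add_nonneg_pos)
  have d\<phi>: "(\<phi> has_real_derivative 1 / ((y + a\<^sup>2) * L)) (at y)" if "0 \<le> y" for y
  proof -
    have "((\<lambda>y. (y + a\<^sup>2) / (2 * a\<^sup>2)) has_real_derivative 1 / (2 * a\<^sup>2)) (at y)"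
      by (intro DERIV_cdivide) (auto intro!: derivative_eq_intros)
    then have "((\<lambda>y. ln ((y + a\<^sup>2) / (2 * a\<^sup>2))) has_real_derivative
        1 / ((y + a\<^sup>2) / (2 * a\<^sup>2)) * (1 / (2 * a\<^sup>2))) (at y)"
      using pos[OF that] a by (intro DERIV_chain2[OF DERIV_ln_divide]) auto
    from DERIV_cdivide[OF this, of L] show ?thesis
      using a pos[OF that] unfolding \<phi>_def[abs_def] by simp
  qed
  have 1: "GDERIV \<eta> z :> G z" for z
    unfolding \<eta>_def[abs_def] G_def k_def by (rule GDERIV_radial_step[OF d\<phi>]) simp
  have "continuous_on UNIV (\<lambda>z. \<phi> ((cmod (z - c))\<^sup>2))"
    unfolding \<phi>_def[abs_def] using a L pos by (intro continuous_intros) (auto simp: less_imp_neq[symmetric])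
  then have ck: "continuous_on UNIV k"
    unfolding k_def[abs_def] using L pos a
    by (intro continuous_intros continuous_on_compose2[OF continuous_step'[of UNIV]])
      (auto simp: less_imp_neq[symmetric])
  have 2: "continuous_on UNIV G"
    unfolding G_def[abs_def] by (intro continuous_intros ck)
  have le: "\<phi> ((cmod (z - c))\<^sup>2) \<le> 0" if "cmod (z - c) \<le> a" for z
  proof -
    have "(cmod (z - c))\<^sup>2 \<le> a\<^sup>2" using that by (intro power_mono) auto
    then have "((cmod (z - c))\<^sup>2 + a\<^sup>2) / (2 * a\<^sup>2) \<le> 1" using a by simp
    then have "ln (((cmod (z - c))\<^sup>2 + a\<^sup>2) / (2 * a\<^sup>2)) \<le> 0" using a pos by (intro ln_le_zero_iff[THEN iffD2]) auto
    then show ?thesis unfolding \<phi>_def using L by (simp add: divide_nonpos_pos)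
  qed
  have ge: "\<phi> ((cmod (z - c))\<^sup>2) \<ge> 1" if "cmod (z - c) \<ge> b" for z
  proof -
    have "b\<^sup>2 \<le> (cmod (z - c))\<^sup>2" using that b by (intro power_mono) auto
    then have "b\<^sup>2 / (2 * a\<^sup>2) \<le> ((cmod (z - c))\<^sup>2 + a\<^sup>2) / (2 * a\<^sup>2)"
      by (intro divide_right_mono) (auto intro: add_increasing2)
    then have "L \<le> ln (((cmod (z - c))\<^sup>2 + a\<^sup>2) / (2 * a\<^sup>2))"
      unfolding L_def using a b by (intro ln_mono) auto
    then show ?thesis unfolding \<phi>_def using L by simp
  qed
  have 5: "cmod (z - c) \<le> a \<Longrightarrow> \<eta> z = 0" for z
    unfolding \<eta>_def using le by (intro step_eq_0)
  have 6: "b \<le> cmod (z - c) \<Longrightarrow> \<eta> z = 1" for z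
    unfolding \<eta>_def using ge by (intro step_eq_1)
  have 7: "a < cmod (z - c) \<and> cmod (z - c) < b" if "G z \<noteq> 0" for z
  proof (rule ccontr)
    assume "\<not> ?thesis"
    then have "k z = 0" unfolding k_def using le[of z] ge[of z] step'_eq_0 by auto
    then show False using that by (simp add: G_def)
  qed
  have ab: "a \<le> b"
  proof (rule ccontr)
    assume "\<not> a \<le> b"
    then have "b\<^sup>2 \<le> a\<^sup>2" using b by (intro power_mono) auto
    then have "b\<^sup>2 \<le> 2 * a\<^sup>2" using zero_le_power2[of a] by linarith
    then have "b\<^sup>2 / (2 * a\<^sup>2) \<le> 1" using a by simp
    then have "L \<le> 0" unfolding L_def using a b by (intro ln_le_zero_iff[THEN iffD2]) auto
    then show False using L by simp
  qed
  define h where "h w = indicat_real {w. a \<le> cmod (w - c) \<and> cmod (w - c) \<le> b} w / (cmod (w - c))\<^sup>2" for w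
  note h = shell_integral[OF a ab, of c, folded h_def]
  have G: "(cmod (G z))\<^sup>2 \<le> 64 / L\<^sup>2 * h z" for z
  proof (cases "G z = 0")
    case True
    then show ?thesis by (simp add: h_def)
  next
    case False
    define y where "y = cmod (z - c)"
    have y: "a < y" "y < b" using 7[OF False] by (auto simp: y_def)
    have k0: "0 \<le> k z" unfolding k_def using step'_nonneg L pos[of "(cmod (z - c))\<^sup>2"] by simp
    have "k z \<le> 2 * 4 * (1 / ((y\<^sup>2 + a\<^sup>2) * L))"
      unfolding k_def y_def using step'_le L pos[of "(cmod (z - c))\<^sup>2"] by (intro mult_right_mono mult_left_mono) auto
    also have "\<dots> \<le> 8 * (1 / (y\<^sup>2 * L))"
      using L a y by (simp add: frac_le)
    finally have k: "k z \<le> 8 / (y\<^sup>2 * L)" by simp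
    have "cmod (G z) = k z * y" by (simp add: G_def norm_mult y_def k0)
    also have "\<dots> \<le> 8 / (y\<^sup>2 * L) * y" using k y a by (intro mult_right_mono) auto
    also have "\<dots> = 8 / (y * L)" using y a by (simp add: power2_eq_square)
    finally have "(cmod (G z))\<^sup>2 \<le> (8 / (y * L))\<^sup>2" by (intro power_mono) auto
    also have "\<dots> = 64 / L\<^sup>2 * h z" using y by (simp add: h_def y_def[symmetric] power_divide power_mult_distrib)
    finally show ?thesis .
  qed
  have 8: "integrable lborel (\<lambda>z. (cmod (G z))\<^sup>2)"
  proof (rule Bochner_Integration.integrable_bound[of _ "\<lambda>z. 64 / L\<^sup>2 * h z"])
    show "integrable lborel (\<lambda>z. 64 / L\<^sup>2 * h z)" using h(1) by simp
    show "(\<lambda>z. (cmod (G z))\<^sup>2) \<in> borel_measurable lborel"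
      using borel_measurable_continuous_onI[OF 2] by simp
    show "AE z in lborel. norm ((cmod (G z))\<^sup>2) \<le> norm (64 / L\<^sup>2 * h z)"
      using G by (auto intro!: AE_I2 order_trans[OF G abs_ge_self] simp del: times_divide_eq_left)
  qed
  have 9: "(\<integral>z. (cmod (G z))\<^sup>2 \<partial>lborel) \<le> (46 / sqrt L)\<^sup>2"
  proof -
    have "(\<integral>z. (cmod (G z))\<^sup>2 \<partial>lborel) \<le> (\<integral>z. 64 / L\<^sup>2 * h z \<partial>lborel)"
      using h(1) by (intro integral_mono 8 G) auto
    also have "\<dots> = 64 / L\<^sup>2 * (\<integral>z. h z \<partial>lborel)" by simp
    also have "\<dots> \<le> 64 / L\<^sup>2 * (4 * pi * (1 + ln (b / a) / ln 2))"
      by (intro mult_left_mono h(2)) simp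
    \<comment> \<open>Origin of the constant 46: the product 64 * 4 * (22 / 7) * (5 / 2) is below
      2012, and 46^2 = 2116.\<close>
    also have "\<dots> \<le> 64 / L\<^sup>2 * (4 * (22/7) * (5 / 2 * L))"
    proof -
      have e: "L = 2 * ln (b / a) - ln 2"
        unfolding L_def using a b by (simp add: ln_div ln_mult ln_realpow)
      have l2: "ln 2 \<ge> (1/2 :: real)" using ln2_ge_two_thirds by simp
      have "ln (b / a) / ln 2 = L / (2 * ln 2) + 1 / 2"
        using l2 by (simp add: e field_simps)
      also have "\<dots> \<le> L / 1 + 1/2" using L l2 by (intro add_mono divide_left_mono) auto
      finally have "1 + ln (b / a) / ln 2 \<le> 5 / 2 * L" using L by linarith
      moreover have "0 \<le> ln (b / a) / ln 2" using ab a by simp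
      ultimately show ?thesis using pi_less_4 pi_approx(2)
        by (intro mult_left_mono mult_mono) auto
    qed
    also have "\<dots> \<le> (46 / sqrt L)\<^sup>2"
      using L by (simp add: power_divide field_simps power2_eq_square)
    finally show ?thesis .
  qed
  have "cutoff \<eta> G (46 / sqrt L)"
    unfolding cutoff_def using 1 2 8 9 step_bounds L by (simp add: \<eta>_def)
  then show ?thesis using that 5 6 7 by blast
qed

section \<open>Pointwise bounds from cutoffs\<close>

text \<open>A function in the Bergman space is arbitrary off \<open>D\<close>. Cutting it off there
  makes it Borel measurable, so that the Lebesgue integrals over \<open>D\<close> become integrals
  over \<open>lborel\<close>.\<close>

abbreviation restr :: "'a set \<Rightarrow> ('a \<Rightarrow> complex) \<Rightarrow> 'a \<Rightarrow> complex" where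
  "restr D f z \<equiv> indicator D z *\<^sub>R f z"

lemma borel_measurable_holomorphic_indicator:
  assumes "open D" "f holomorphic_on D"
  shows "(\<lambda>z. restr D f z) \<in> borel_measurable borel"
  using assms by (intro borel_measurable_continuous_on_indicator holomorphic_on_imp_continuous_on) auto

lemma
  assumes "open D" "f holomorphic_on D"
  shows set_integrable_norm_square_iff: "set_integrable lebesgue D (\<lambda>z. (cmod (f z))\<^sup>2) \<longleftrightarrow>
      integrable lborel (\<lambda>z. (cmod (restr D f z))\<^sup>2)"
    and set_integral_norm_square_eq: "(LINT z:D|lebesgue. (cmod (f z))\<^sup>2) = (\<integral>z. (cmod (restr D f z))\<^sup>2 \<partial>lborel)"
proof -
  note [measurable] = borel_measurable_holomorphic_indicator[OF assms]
  have eq: "indicat_real D z *\<^sub>R (cmod (f z))\<^sup>2 = (cmod (restr D f z))\<^sup>2" for z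
    by (auto simp: indicator_def)
  show "set_integrable lebesgue D (\<lambda>z. (cmod (f z))\<^sup>2) \<longleftrightarrow>
      integrable lborel (\<lambda>z. (cmod (restr D f z))\<^sup>2)"
    unfolding set_integrable_def eq by (rule integrable_completion) measurable
  show "(LINT z:D|lebesgue. (cmod (f z))\<^sup>2) = (\<integral>z. (cmod (restr D f z))\<^sup>2 \<partial>lborel)"
    unfolding set_lebesgue_integral_def eq by (rule integral_completion) measurable
qed

lemma L2_hol_iff:
  "open D \<Longrightarrow> f \<in> L2_hol D \<longleftrightarrow>
    f holomorphic_on D \<and> integrable lborel (\<lambda>z. (cmod (restr D f z))\<^sup>2)"
  by (auto simp: L2_hol_def set_integrable_norm_square_iff)

lemma L2_norm_on_eq:
  assumes "open D" "f holomorphic_on D"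
  shows "(L2_norm_on D f)\<^sup>2 = (\<integral>z. (cmod (restr D f z))\<^sup>2 \<partial>lborel)"
  using assms by (simp add: L2_norm_on_def set_integral_norm_square_eq)

lemma L2_norm_on_nonneg: "open D \<Longrightarrow> f holomorphic_on D \<Longrightarrow> 0 \<le> L2_norm_on D f"
  by (simp add: L2_norm_on_def set_integral_norm_square_eq)

section \<open>Products of cutoffs\<close>

lemma GDERIV_prod:
  assumes "finite J" "\<And>j z. j \<in> J \<Longrightarrow> GDERIV (\<eta> j) z :> (G j z)"
  shows "GDERIV (\<lambda>z. \<Prod>j\<in>J. \<eta> j z) z :> (\<Sum>j\<in>J. (\<Prod>i\<in>J - {j}. \<eta> i z) *\<^sub>R G j z)"
  using assms
proof (induction J rule: finite_induct)
  case empty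
  then show ?case by (simp add: GDERIV_const)
next
  case (insert k J)
  have "GDERIV (\<lambda>z. \<eta> k z * (\<Prod>j\<in>J. \<eta> j z)) z :>
      (\<eta> k z *\<^sub>R (\<Sum>j\<in>J. (\<Prod>i\<in>J - {j}. \<eta> i z) *\<^sub>R G j z) + (\<Prod>j\<in>J. \<eta> j z) *\<^sub>R G k z)"
    using insert by (intro GDERIV_mult) auto
  moreover have "(\<Sum>j\<in>J. (\<Prod>i\<in>insert k J - {j}. \<eta> i z) *\<^sub>R G j z) =
      \<eta> k z *\<^sub>R (\<Sum>j\<in>J. (\<Prod>i\<in>J - {j}. \<eta> i z) *\<^sub>R G j z)"
    unfolding scaleR_sum_right
  proof (rule sum.cong)
    fix j assume j: "j \<in> J"
    then have "insert k J - {j} = insert k (J - {j})" using insert by auto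
    then show "(\<Prod>i\<in>insert k J - {j}. \<eta> i z) *\<^sub>R G j z = \<eta> k z *\<^sub>R (\<Prod>i\<in>J - {j}. \<eta> i z) *\<^sub>R G j z"
      using insert by simp
  qed simp
  ultimately show ?case using insert by (simp add: insert_Diff_if add.commute)
qed

text \<open>Each cutoff removes one piece of the complement of \<open>D\<close>: off the compact set
  \<open>K\<close> some factor vanishes, so the product is compactly supported in \<open>D\<close>,
  and all factors are 1 near \<open>x\<close>. The gradient of the j-th cutoff stays at distance
  \<open>d j\<close> from \<open>x\<close>.\<close>

locale cutoff_family =
  fixes D :: "complex set" and x :: complex and J :: "'j set"
    and \<eta> :: "'j \<Rightarrow> complex \<Rightarrow> real" and G :: "'j \<Rightarrow> complex \<Rightarrow> complex"
    and E d :: "'j \<Rightarrow> real" and K :: "complex set" and \<delta> :: real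
  assumes D: "open D" and x: "x \<in> D" and J: "finite J"
    and cut: "\<And>j. j \<in> J \<Longrightarrow> cutoff (\<eta> j) (G j) (E j)"
    and d: "\<And>j. j \<in> J \<Longrightarrow> 0 < d j" "\<And>j z. j \<in> J \<Longrightarrow> G j z \<noteq> 0 \<Longrightarrow> d j \<le> cmod (z - x)"
    and K: "compact K" "K \<subseteq> D" and supp: "\<And>z. z \<notin> K \<Longrightarrow> \<exists>j\<in>J. \<eta> j z = 0"
    and one: "0 < \<delta>" "\<And>j z. j \<in> J \<Longrightarrow> cmod (z - x) < \<delta> \<Longrightarrow> \<eta> j z = 1"
begin

lemma
  assumes "j \<in> J"
  shows der: "GDERIV (\<eta> j) z :> (G j z)" and cont: "continuous_on UNIV (G j)"
    and bounds: "0 \<le> \<eta> j z" "\<eta> j z \<le> 1"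
    and int: "integrable lborel (\<lambda>z. (cmod (G j z))\<^sup>2)"
    and E: "0 \<le> E j" "(\<integral>z. (cmod (G j z))\<^sup>2 \<partial>lborel) \<le> (E j)\<^sup>2"
  using cut[OF assms] unfolding cutoff_def by auto

definition prod_cutoff :: "complex \<Rightarrow> real" where
  "prod_cutoff z = (\<Prod>j\<in>J. \<eta> j z)"

definition prod_grad :: "complex \<Rightarrow> complex" where
  "prod_grad z = (\<Sum>j\<in>J. (\<Prod>i\<in>J - {j}. \<eta> i z) *\<^sub>R G j z)"

lemma prod_der: "GDERIV prod_cutoff z :> (prod_grad z)"
  unfolding prod_cutoff_def[abs_def] prod_grad_def by (rule GDERIV_prod[OF J der])

lemma prod_supp: "z \<notin> K \<Longrightarrow> prod_cutoff z = 0"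
  using supp J by (auto simp: prod_cutoff_def)

lemma prod_one: "cmod (z - x) < \<delta> \<Longrightarrow> prod_cutoff z = 1"
  using one by (simp add: prod_cutoff_def)

lemma continuous_cutoff: "j \<in> J \<Longrightarrow> continuous_on UNIV (\<eta> j)"
  by (rule has_derivative_continuous_on)
    (use der[unfolded gderiv_def] has_derivative_at_withinI in blast)

lemma prod_grad_cont: "continuous_on UNIV prod_grad"
  unfolding prod_grad_def[abs_def] by (intro continuous_intros continuous_cutoff cont) auto

lemma prod_grad_le: "cmod (prod_grad z) \<le> (\<Sum>j\<in>J. cmod (G j z))"
  unfolding prod_grad_def
proof (rule order_trans[OF norm_sum], rule sum_mono)
  fix j assume "j \<in> J"
  have "0 \<le> (\<Prod>i\<in>J - {j}. \<eta> i z)" "(\<Prod>i\<in>J - {j}. \<eta> i z) \<le> 1"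
    using bounds by (auto intro!: prod_nonneg prod_le_1)
  then show "cmod ((\<Prod>i\<in>J - {j}. \<eta> i z) *\<^sub>R G j z) \<le> cmod (G j z)"
    by (simp add: mult_left_le_one_le)
qed

text \<open>The gradient of a product of functions with values in [0, 1] is dominated by the sum of
  the gradients. Cauchy-Schwarz is applied to each of them separately, after bounding the power of
  \<open>z - x\<close> below by that of \<open>d j\<close>. Exponent 1 serves the values of
  \<open>f\<close>, exponent 2 the derivative.\<close>

lemma weighted_integral_le:
  assumes f: "f \<in> L2_hol D"
  shows "cmod (\<integral>z. f z * prod_grad z / (z - x) ^ m \<partial>lborel) \<le> L2_norm_on D f * (\<Sum>j\<in>J. E j / d j ^ m)"
proof -
  have hol: "f holomorphic_on D" and fint: "integrable lborel (\<lambda>z. (cmod (restr D f z))\<^sup>2)"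
    using f D by (auto simp: L2_hol_iff)
  note [measurable] = borel_measurable_holomorphic_indicator[OF D hol]
  define F where "F z = cmod (restr D f z)" for z
  have [measurable]: "F \<in> borel_measurable lborel" unfolding F_def[abs_def] by measurable
  have Fint: "integrable lborel (\<lambda>z. (F z)\<^sup>2)" using fint by (simp only: F_def)
  have GM: "(\<lambda>z. cmod (G j z)) \<in> borel_measurable lborel" if "j \<in> J" for j
    using borel_measurable_continuous_onI[OF cont[OF that]] by simp
  define B where "B z = (\<Sum>j\<in>J. F z * cmod (G j z) / d j ^ m)" for z
  have iFG: "integrable lborel (\<lambda>z. F z * cmod (G j z))" if "j \<in> J" for j
    by (rule integrable_mult_of_squares) (use Fint int[OF that] GM[OF that] in auto)
  have iB: "integrable lborel B"
    unfolding B_def[abs_def] using iFG by (intro Bochner_Integration.integrable_sum) auto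
  have grad0: "prod_grad z = 0" if "z \<notin> K" for z
    by (rule GDERIV_unique_zero[OF prod_der, of "- K" z 0])
      (use that K prod_supp in \<open>auto simp: compact_imp_closed open_Compl\<close>)
  have le: "cmod (f z * prod_grad z / (z - x) ^ m) \<le> B z" for z
  proof (cases "z \<in> D")
    case False
    then have "prod_grad z = 0" using grad0 K by blast
    moreover have "0 \<le> B z" unfolding B_def using d(1) by (intro sum_nonneg) (auto simp: F_def less_imp_le)
    ultimately show ?thesis by simp
  next
    case True
    have "cmod (f z * prod_grad z / (z - x) ^ m) \<le> F z * (\<Sum>j\<in>J. cmod (G j z)) / cmod (z - x) ^ m"
      using True prod_grad_le[of z]
      by (auto simp: F_def norm_mult norm_divide norm_power intro!: divide_right_mono mult_left_mono)
    also have "\<dots> = (\<Sum>j\<in>J. F z * cmod (G j z) / cmod (z - x) ^ m)"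
      by (simp add: sum_distrib_left sum_divide_distrib)
    also have "\<dots> \<le> B z"
      unfolding B_def
    proof (rule sum_mono)
      fix j assume j: "j \<in> J"
      show "F z * cmod (G j z) / cmod (z - x) ^ m \<le> F z * cmod (G j z) / d j ^ m"
      proof (cases "G j z = 0")
        case False
        then have "d j \<le> cmod (z - x)" using d j by blast
        moreover have "0 < d j" using d(1) j .
        ultimately have "d j ^ m \<le> cmod (z - x) ^ m" "0 < d j ^ m" by (auto intro: power_mono)
        then show ?thesis by (intro divide_left_mono) (auto simp: F_def intro!: mult_pos_pos)
      qed simp
    qed
    finally show ?thesis .
  qed
  have "cmod (\<integral>z. f z * prod_grad z / (z - x) ^ m \<partial>lborel) \<le> (\<integral>z. B z \<partial>lborel)"
  \<comment> \<open>A non-integrable function has Bochner integral 0, so that case holds because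
    \<open>B\<close> is nonnegative.\<close>
  proof (cases "integrable lborel (\<lambda>z. f z * prod_grad z / (z - x) ^ m)")
    case True
    then show ?thesis by (rule Bochner_Integration.integral_norm_bound_integral[OF _ iB]) (rule le)
  next
    case False
    have "0 \<le> B z" for z using order_trans[OF norm_ge_zero le] .
    then show ?thesis using False by (simp add: not_integrable_integral_eq)
  qed
  also have "\<dots> = (\<Sum>j\<in>J. (\<integral>z. F z * cmod (G j z) \<partial>lborel) / d j ^ m)"
    unfolding B_def using iFG by (subst Bochner_Integration.integral_sum) auto
  also have "\<dots> \<le> (\<Sum>j\<in>J. (L2_norm_on D f * E j) / d j ^ m)"
  proof (intro sum_mono divide_right_mono)
    fix j assume j: "j \<in> J"
    show "0 \<le> d j ^ m" using d(1)[OF j] by simp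
    have "(\<integral>z. F z * cmod (G j z) \<partial>lborel)\<^sup>2 \<le> (\<integral>z. (F z)\<^sup>2 \<partial>lborel) * (\<integral>z. (cmod (G j z))\<^sup>2 \<partial>lborel)"
      by (rule integral_Cauchy_Schwarz) (use Fint int[OF j] GM[OF j] in auto)
    also have "\<dots> \<le> (L2_norm_on D f)\<^sup>2 * (E j)\<^sup>2"
      using E(2)[OF j] by (intro mult_mono) (auto simp: L2_norm_on_eq[OF D hol] F_def[abs_def])
    finally have "(\<integral>z. F z * cmod (G j z) \<partial>lborel)\<^sup>2 \<le> (L2_norm_on D f * E j)\<^sup>2"
      by (simp add: power_mult_distrib)
    then show "(\<integral>z. F z * cmod (G j z) \<partial>lborel) \<le> L2_norm_on D f * E j"
      by (rule power2_le_imp_le) (use E(1)[OF j] L2_norm_on_nonneg[OF D hol] in simp)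
  qed
  also have "\<dots> = L2_norm_on D f * (\<Sum>j\<in>J. E j / d j ^ m)"
    by (simp add: sum_distrib_left)
  finally show ?thesis .
qed

lemma eval_bound:
  assumes f: "f \<in> L2_hol D"
  shows "cmod (f x) \<le> L2_norm_on D f * (\<Sum>j\<in>J. E j / d j)"
proof -
  have "f holomorphic_on D" using f by (simp add: L2_hol_def)
  from holomorphic_le_weighted_integral[OF D this x prod_der prod_grad_cont K prod_supp one(1) prod_one]
  show ?thesis using weighted_integral_le[OF f, of 1] by simp
qed

lemma deriv_bound:
  assumes f: "f \<in> L2_hol D" and f0: "f x = 0"
  shows "cmod (deriv f x) \<le> L2_norm_on D f * (\<Sum>j\<in>J. E j / (d j)\<^sup>2)"
proof -
  have "f holomorphic_on D" using f by (simp add: L2_hol_def)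
  from deriv_le_weighted_integral[OF D this x f0 prod_der prod_grad_cont K prod_supp one(1) prod_one]
  show ?thesis using weighted_integral_le[OF f, of 2] by simp
qed

end

section \<open>Interior estimates\<close>

lemma ln_9_2_ge_1: "ln (9 / 2 :: real) \<ge> 1"
proof -
  have "exp 1 \<le> (9/2 :: real)" using exp_le by simp
  then show ?thesis by (subst ln_ge_iff) auto
qed

text \<open>Dirichlet energy is invariant under scaling, so a fixed ratio of radii gives a constant
  independent of \<rho>. Ratio 3 makes L = ln (9 / 2), which is at least 1.\<close>

lemma outer_cutoff:
  fixes c :: complex and \<rho> :: real
  assumes \<rho>: "0 < \<rho>"
  obtains \<eta> :: "complex \<Rightarrow> real" and G :: "complex \<Rightarrow> complex" where
    "cutoff \<eta> G 46"
    "\<And>z. cmod (z - c) \<le> \<rho> / 3 \<Longrightarrow> \<eta> z = 1" "\<And>z. \<rho> \<le> cmod (z - c) \<Longrightarrow> \<eta> z = 0"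
    "\<And>z. G z \<noteq> 0 \<Longrightarrow> \<rho> / 3 < cmod (z - c) \<and> cmod (z - c) < \<rho>"
proof -
  have e: "\<rho>\<^sup>2 / (2 * (\<rho> / 3)\<^sup>2) = 9 / 2" using \<rho> by (simp add: power2_eq_square)
  have \<rho>3: "0 < \<rho> / 3" using \<rho> by simp
  obtain \<eta> G where \<eta>: "cutoff \<eta> G (46 / sqrt (ln (9 / 2)))"
    "\<And>z. cmod (z - c) \<le> \<rho> / 3 \<Longrightarrow> \<eta> z = 0" "\<And>z. \<rho> \<le> cmod (z - c) \<Longrightarrow> \<eta> z = 1"
    "\<And>z. G z \<noteq> 0 \<Longrightarrow> \<rho> / 3 < cmod (z - c) \<and> cmod (z - c) < \<rho>"
    using log_cutoff[OF \<rho>3 \<rho>, of c, unfolded e, OF ln_9_2_ge_1] by blast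
  have "46 / sqrt (ln (9 / 2)) \<le> (46 :: real)"
    using ln_9_2_ge_1 by (simp add: divide_le_eq)
  with \<eta>(1) have "cutoff \<eta> G 46" by (rule cutoff_mono)
  then have "cutoff (\<lambda>z. 1 - \<eta> z) (\<lambda>z. - G z) 46"
    unfolding cutoff_def using GDERIV_diff[OF GDERIV_const, of \<eta> _ _ 1] by (simp add: continuous_on_minus)
  then show ?thesis using that[of "\<lambda>z. 1 - \<eta> z" "\<lambda>z. - G z"] \<eta> by simp
qed

text \<open>The family has one member, a cutoff centred at \<open>x\<close> itself: 138 / \<rho> is
  46 / (\<rho> / 3). This makes point evaluations continuous on the Bergman space.\<close>

lemma L2_hol_eval_bound:
  assumes D: "open D" and \<rho>: "0 < \<rho>" "cball x \<rho> \<subseteq> D" and f: "f \<in> L2_hol D"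
  shows "cmod (f x) \<le> 138 / \<rho> * L2_norm_on D f"
proof -
  obtain \<eta> G where \<eta>: "cutoff \<eta> G 46"
    "\<And>z. cmod (z - x) \<le> \<rho> / 3 \<Longrightarrow> \<eta> z = 1" "\<And>z. \<rho> \<le> cmod (z - x) \<Longrightarrow> \<eta> z = 0"
    "\<And>z. G z \<noteq> 0 \<Longrightarrow> \<rho> / 3 < cmod (z - x) \<and> cmod (z - x) < \<rho>"
    using outer_cutoff[OF \<rho>(1), of x] by blast
  interpret cutoff_family D x "{()}" "\<lambda>_. \<eta>" "\<lambda>_. G" "\<lambda>_. 46" "\<lambda>_. \<rho> / 3" "cball x \<rho>" "\<rho> / 3"
  proof
    show "\<exists>j\<in>{()}. \<eta> z = 0" if "z \<notin> cball x \<rho>" for z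
      using that \<eta>(3)[of z] by (simp add: dist_norm norm_minus_commute)
  qed (use D \<rho> \<eta> in \<open>auto simp: less_imp_le\<close>)
  show ?thesis using eval_bound[OF f] by (simp add: mult.commute)
qed

section \<open>The Bergman space as a Hilbert space\<close>

text \<open>Members of \<open>H\<close> remain total functions, without passing to a quotient: their
  values off \<open>D\<close> are arbitrary and invisible to \<open>N\<close> and \<open>ip\<close>.
  Hence \<open>N\<close> is only a seminorm, and representers are determined only on
  \<open>D\<close>.\<close>

locale bergman_space =
  fixes D :: "complex set"
  assumes open_D: "open D" and bounded_D: "bounded D"
begin

abbreviation H :: "(complex \<Rightarrow> complex) set" where "H \<equiv> L2_hol D"

abbreviation N :: "(complex \<Rightarrow> complex) \<Rightarrow> real" where "N \<equiv> L2_norm_on D"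

definition ip :: "(complex \<Rightarrow> complex) \<Rightarrow> (complex \<Rightarrow> complex) \<Rightarrow> complex" where
  "ip f g = (\<integral>z. restr D f z * cnj (restr D g z) \<partial>lborel)"

lemma H_hol: "f \<in> H \<Longrightarrow> f holomorphic_on D"
  by (simp add: L2_hol_def)

lemma H_measurable:
  assumes "f \<in> H"
  shows "(\<lambda>z. restr D f z) \<in> borel_measurable borel"
  using borel_measurable_holomorphic_indicator[OF open_D H_hol[OF assms]] .

lemma H_integrable_square: "f \<in> H \<Longrightarrow> integrable lborel (\<lambda>z. (cmod (restr D f z))\<^sup>2)"
  using L2_hol_iff[OF open_D] by blast

lemma N_square: "f \<in> H \<Longrightarrow> (N f)\<^sup>2 = (\<integral>z. (cmod (restr D f z))\<^sup>2 \<partial>lborel)"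
  by (rule L2_norm_on_eq[OF open_D H_hol])

lemma N_nonneg: "f \<in> H \<Longrightarrow> 0 \<le> N f"
  by (rule L2_norm_on_nonneg[OF open_D H_hol])

lemma ip_integrable:
  assumes "f \<in> H" "g \<in> H"
  shows "integrable lborel (\<lambda>z. restr D f z * cnj (restr D g z))"
proof -
  note [measurable] = H_measurable[OF assms(1)] H_measurable[OF assms(2)]
  have "integrable lborel (\<lambda>z. cmod (restr D f z) * cmod (restr D g z))"
    by (rule integrable_mult_of_squares) (use assms H_integrable_square in \<open>auto simp del: norm_scaleR\<close>)
  then show ?thesis
  proof (rule Bochner_Integration.integrable_bound)
    have [measurable]: "cnj \<in> borel_measurable borel"
      by (intro borel_measurable_continuous_onI continuous_intros)
    show "(\<lambda>z. restr D f z * cnj (restr D g z)) \<in> borel_measurable lborel"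
      by measurable
    show "AE z in lborel. norm (restr D f z * cnj (restr D g z))
        \<le> norm (cmod (restr D f z) * cmod (restr D g z))"
      by (simp add: norm_mult)
  qed
qed

lemma H_scale: assumes "f \<in> H" shows "(\<lambda>z. c * f z) \<in> H"
proof -
  have "integrable lborel (\<lambda>z. (cmod c)\<^sup>2 * (cmod (restr D f z))\<^sup>2)"
    using H_integrable_square[OF assms] by simp
  moreover have "(cmod c)\<^sup>2 * (cmod (restr D f z))\<^sup>2 = (cmod (indicator D z *\<^sub>R (c * f z)))\<^sup>2" for z
    by (simp add: norm_mult power_mult_distrib)
  ultimately have "integrable lborel (\<lambda>z. (cmod (indicator D z *\<^sub>R (c * f z)))\<^sup>2)" by (simp only:)
  moreover have "(\<lambda>z. c * f z) holomorphic_on D" using H_hol[OF assms] by (intro holomorphic_intros)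
  ultimately show ?thesis unfolding L2_hol_iff[OF open_D] by blast
qed

lemma H_add: assumes "f \<in> H" "g \<in> H" shows "(\<lambda>z. f z + g z) \<in> H"
proof -
  note [measurable] = H_measurable[OF assms(1)] H_measurable[OF assms(2)]
  have hol: "(\<lambda>z. f z + g z) holomorphic_on D"
    using assms by (intro holomorphic_intros H_hol)
  note [measurable] = borel_measurable_holomorphic_indicator[OF open_D hol]
  have sq: "integrable lborel (\<lambda>z. 2 * (cmod (restr D f z))\<^sup>2 + 2 * (cmod (restr D g z))\<^sup>2)"
    using assms H_integrable_square by (intro Bochner_Integration.integrable_add integrable_mult_right)
  have "(cmod (indicator D z *\<^sub>R (f z + g z)))\<^sup>2 \<le>
      2 * (cmod (restr D f z))\<^sup>2 + 2 * (cmod (restr D g z))\<^sup>2" for z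
  proof -
    have "(cmod (a + b))\<^sup>2 \<le> 2 * (cmod a)\<^sup>2 + 2 * (cmod b)\<^sup>2" for a b :: complex
    proof -
      have "(cmod (a + b))\<^sup>2 \<le> (cmod a + cmod b)\<^sup>2" by (intro power_mono norm_triangle_ineq) auto
      also have "\<dots> \<le> 2 * (cmod a)\<^sup>2 + 2 * (cmod b)\<^sup>2"
        using sum_squares_bound[of "cmod a" "cmod b"] by (simp add: power2_sum)
      finally show ?thesis .
    qed
    then show ?thesis by (simp only: scaleR_add_right)
  qed
  then have le: "norm ((cmod (indicator D z *\<^sub>R (f z + g z)))\<^sup>2) \<le>
      norm (2 * (cmod (restr D f z))\<^sup>2 + 2 * (cmod (restr D g z))\<^sup>2)" for z
    unfolding real_norm_def abs_of_nonneg[OF zero_le_power2] by (rule order_trans[OF _ abs_ge_self])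
  have "integrable lborel (\<lambda>z. (cmod (indicator D z *\<^sub>R (f z + g z)))\<^sup>2)"
  proof (rule Bochner_Integration.integrable_bound[OF sq])
    show "(\<lambda>z. (cmod (indicator D z *\<^sub>R (f z + g z)))\<^sup>2) \<in> borel_measurable lborel" by measurable
  qed (rule AE_I2, rule le)
  then show ?thesis unfolding L2_hol_iff[OF open_D] using hol by blast
qed

lemma H_diff: "f \<in> H \<Longrightarrow> g \<in> H \<Longrightarrow> (\<lambda>z. f z - g z) \<in> H"
  using H_add[OF _ H_scale[of g "-1"], of f] by simp

lemma ip_add_left: "f \<in> H \<Longrightarrow> g \<in> H \<Longrightarrow> h \<in> H \<Longrightarrow> ip (\<lambda>z. f z + g z) h = ip f h + ip g h"
  unfolding ip_def scaleR_add_right distrib_right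
  by (rule Bochner_Integration.integral_add) (simp_all only: ip_integrable)

lemma ip_scale_left: "ip (\<lambda>z. c * f z) h = c * ip f h"
proof -
  have "indicator D z *\<^sub>R (c * f z) * cnj (restr D h z) =
      c * (restr D f z * cnj (restr D h z))" for z
    by simp
  then show ?thesis unfolding ip_def by (simp only: integral_mult_right_zero)
qed

lemma ip_sym: "ip g f = cnj (ip f g)"
proof -
  have "ip g f = (\<integral>z. cnj (restr D f z * cnj (restr D g z)) \<partial>lborel)"
    unfolding ip_def by (simp add: mult.commute)
  then show ?thesis unfolding ip_def by (simp only: Bochner_Integration.integral_cnj)
qed

lemma ip_self: "f \<in> H \<Longrightarrow> ip f f = of_real ((N f)\<^sup>2)"
  unfolding ip_def complex_norm_square[symmetric] N_square
  by (simp only: integral_complex_of_real of_real_power[symmetric])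

lemma ip_add_right: "f \<in> H \<Longrightarrow> g \<in> H \<Longrightarrow> h \<in> H \<Longrightarrow> ip h (\<lambda>z. f z + g z) = ip h f + ip h g"
  by (subst (1 2 3) ip_sym) (simp add: ip_add_left)

lemma ip_scale_right: "ip h (\<lambda>z. c * f z) = cnj c * ip h f"
  by (subst (1 2) ip_sym) (simp add: ip_scale_left)

lemma ip_diff_left: "f \<in> H \<Longrightarrow> g \<in> H \<Longrightarrow> h \<in> H \<Longrightarrow> ip (\<lambda>z. f z - g z) h = ip f h - ip g h"
  using ip_add_left[OF _ H_scale[of g "-1"], of f h] ip_scale_left[of "-1" g h] by simp

lemma ip_diff_right: "f \<in> H \<Longrightarrow> g \<in> H \<Longrightarrow> h \<in> H \<Longrightarrow> ip h (\<lambda>z. f z - g z) = ip h f - ip h g"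
  using ip_add_right[OF _ H_scale[of g "-1"], of f h] ip_scale_right[of h "-1" g] by simp

lemma N_square_perturb:
  assumes "f \<in> H" "g \<in> H"
  shows "(N (\<lambda>z. f z + of_real s * g z))\<^sup>2 = (N f)\<^sup>2 + 2 * s * Re (ip f g) + s\<^sup>2 * (N g)\<^sup>2"
proof -
  have sg: "(\<lambda>z. of_real s * g z) \<in> H" by (rule H_scale[OF assms(2)])
  have "complex_of_real ((N (\<lambda>z. f z + of_real s * g z))\<^sup>2) =
      ip (\<lambda>z. f z + of_real s * g z) (\<lambda>z. f z + of_real s * g z)"
    by (rule ip_self[symmetric]) (rule H_add[OF assms(1) sg])
  also have "\<dots> = ip f f + of_real s * ip f g + of_real s * cnj (ip f g) + of_real s * (of_real s * ip g g)"
    using assms sg ip_sym[of g f]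
    by (simp add: ip_add_left ip_add_right H_add ip_scale_left ip_scale_right algebra_simps)
  also have "\<dots> = of_real ((N f)\<^sup>2 + 2 * s * Re (ip f g) + s\<^sup>2 * (N g)\<^sup>2)"
    using assms by (simp add: ip_self complex_eq_iff power2_eq_square algebra_simps)
  finally show ?thesis by (simp only: of_real_eq_iff)
qed

lemma ip_Cauchy_Schwarz:
  assumes "f \<in> H" "g \<in> H"
  shows "cmod (ip f g) \<le> N f * N g"
proof (cases "ip f g = 0")
  case True
  then show ?thesis using assms N_nonneg by simp
next
  case False
  \<comment> \<open>Multiplying \<open>g\<close> by the phase of \<open>ip f g\<close> makes the
    inner product real and nonnegative, so that the real discriminant argument applies.\<close>
  define c where "c = sgn (ip f g)"
  have c: "cmod c = 1" using False by (simp add: c_def norm_sgn)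
  have cg: "(\<lambda>z. c * g z) \<in> H" by (rule H_scale[OF assms(2)])
  have "ip f (\<lambda>z. c * g z) = cnj c * (c * of_real (cmod (ip f g)))"
    unfolding ip_scale_right using False by (simp add: c_def sgn_eq)
  also have "\<dots> = of_real (cmod (ip f g))"
    using c by (simp add: mult.assoc[symmetric] complex_norm_square[symmetric] mult.commute)
  finally have "ip f (\<lambda>z. c * g z) = of_real (cmod (ip f g))" .
  then have R: "Re (ip f (\<lambda>z. c * g z)) = cmod (ip f g)" by simp
  have Nc: "(N (\<lambda>z. c * g z))\<^sup>2 = (N g)\<^sup>2"
  proof -
    have "complex_of_real ((N (\<lambda>z. c * g z))\<^sup>2) = c * cnj c * of_real ((N g)\<^sup>2)"
      using ip_self[OF cg] ip_self[OF assms(2)] by (simp add: ip_scale_left ip_scale_right mult.assoc)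
    also have "c * cnj c = 1" using c by (simp add: complex_norm_square[symmetric])
    finally show ?thesis by (simp only: mult_1 of_real_eq_iff)
  qed
  have "(cmod (ip f g))\<^sup>2 \<le> (N f)\<^sup>2 * (N g)\<^sup>2"
  proof (rule quadratic_nonneg_imp_discriminant)
    fix s :: real
    show "0 \<le> (N f)\<^sup>2 + 2 * s * cmod (ip f g) + s\<^sup>2 * (N g)\<^sup>2"
      using N_square_perturb[OF assms(1) cg, of s] zero_le_power2 unfolding R Nc by metis
  qed simp
  then show ?thesis
    using assms N_nonneg by (auto intro: power2_le_imp_le simp: power_mult_distrib)
qed

lemma H_const: "(\<lambda>z. c) \<in> H"
proof -
  have "integrable lborel (\<lambda>z. (cmod c)\<^sup>2 * indicat_real D z)"
    using open_D emeasure_bounded_finite[OF bounded_D]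
    by (intro integrable_mult_right integrable_real_indicator) auto
  moreover have "(cmod c)\<^sup>2 * indicat_real D z = (cmod (indicator D z *\<^sub>R c))\<^sup>2" for z
    by (simp add: indicator_def)
  ultimately show ?thesis by (simp add: L2_hol_iff[OF open_D])
qed

lemma eval_bound: "0 < \<rho> \<Longrightarrow> cball z \<rho> \<subseteq> D \<Longrightarrow> f \<in> H \<Longrightarrow> cmod (f z) \<le> 138 / \<rho> * N f"
  by (rule L2_hol_eval_bound[OF open_D])

text \<open>The evaluation bound turns Cauchy sequences for \<open>N\<close> into locally uniformly
  Cauchy ones, whose limit is holomorphic. Fatou's lemma then transfers the bound on the differences
  \<open>f n - f m\<close> to \<open>f n - g\<close>.\<close>

lemma complete:
  assumes f: "\<And>n. f n \<in> H"
    and cauchy: "\<And>\<epsilon>. \<epsilon> > 0 \<Longrightarrow> \<exists>M. \<forall>m\<ge>M. \<forall>n\<ge>M. N (\<lambda>z. f m z - f n z) \<le> \<epsilon>"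
  obtains g where "g \<in> H" "(\<lambda>n. N (\<lambda>z. f n z - g z)) \<longlonglongrightarrow> 0"
proof -
  define g where "g z = lim (\<lambda>n. f n z)" for z
  have diff: "(\<lambda>z. f m z - f n z) \<in> H" for m n by (rule H_diff[OF f f])
  have loc: "\<exists>M. \<forall>m\<ge>M. \<forall>n\<ge>M. \<forall>z\<in>cball x \<rho>. cmod (f m z - f n z) \<le> \<epsilon>"
    if \<rho>: "0 < \<rho>" "cball x (2 * \<rho>) \<subseteq> D" and \<epsilon>: "\<epsilon> > 0" for x \<rho> \<epsilon>
  proof -
    obtain M where M: "\<forall>m\<ge>M. \<forall>n\<ge>M. N (\<lambda>z. f m z - f n z) \<le> \<epsilon> * \<rho> / 138"
      using cauchy[of "\<epsilon> * \<rho> / 138"] \<rho> \<epsilon> by auto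
    have "cmod (f m z - f n z) \<le> \<epsilon>" if "m \<ge> M" "n \<ge> M" "z \<in> cball x \<rho>" for m n z
    proof -
      have "cball z \<rho> \<subseteq> cball x (2 * \<rho>)"
      proof
        fix w assume "w \<in> cball z \<rho>"
        then show "w \<in> cball x (2 * \<rho>)" using that(3) dist_triangle[of x w z] by simp
      qed
      then have "cmod (f m z - f n z) \<le> 138 / \<rho> * N (\<lambda>z. f m z - f n z)"
        using \<rho> eval_bound[OF \<rho>(1) _ diff] by blast
      also have "\<dots> \<le> 138 / \<rho> * (\<epsilon> * \<rho> / 138)" using M that \<rho> by (intro mult_left_mono) auto
      finally show ?thesis using \<rho> by simp
    qed
    then show ?thesis by blast
  qed
  have rad: "\<exists>\<rho>>0. cball x (2 * \<rho>) \<subseteq> D" if "x \<in> D" for x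
  proof -
    have "\<exists>e>0. cball x e \<subseteq> D" using open_contains_cball_eq[OF open_D] that by simp
    then obtain e where e: "e > 0" "cball x e \<subseteq> D" by (elim exE conjE)
    then have "e / 2 > 0 \<and> cball x (2 * (e / 2)) \<subseteq> D" by simp
    then show ?thesis by (rule exI)
  qed
  have lim: "(\<lambda>n. f n z) \<longlonglongrightarrow> g z" if z: "z \<in> D" for z
  proof -
    obtain \<rho> where \<rho>: "\<rho> > 0" "cball z (2 * \<rho>) \<subseteq> D" using rad[OF z] by blast
    have "Cauchy (\<lambda>n. f n z)"
    proof (rule metric_CauchyI)
      fix e :: real assume "e > 0"
      then obtain M where "\<forall>m\<ge>M. \<forall>n\<ge>M. \<forall>w\<in>cball z \<rho>. cmod (f m w - f n w) \<le> e / 2"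
        using loc[OF \<rho>, of "e / 2"] by auto
      moreover have "z \<in> cball z \<rho>" "e / 2 < e" using \<rho> \<open>e > 0\<close> by auto
      ultimately show "\<exists>M. \<forall>m\<ge>M. \<forall>n\<ge>M. dist (f m z) (f n z) < e"
        unfolding dist_norm by (meson le_less_trans)
    qed
    then have "convergent (\<lambda>n. f n z)" by (rule Cauchy_convergent)
    then show ?thesis unfolding g_def by (rule convergent_LIMSEQ_iff[THEN iffD1])
  qed
  have hol: "g holomorphic_on D"
  proof (rule holomorphic_uniform_sequence[OF open_D, of f])
    show "f n holomorphic_on D" for n using f H_hol by blast
    fix x assume x: "x \<in> D"
    obtain \<rho> where \<rho>: "\<rho> > 0" "cball x (2 * \<rho>) \<subseteq> D" using rad[OF x] by blast
    have sub: "cball x \<rho> \<subseteq> D" using \<rho> subset_cball[of \<rho> "2 * \<rho>" x] by auto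
    have "uniform_limit (cball x \<rho>) f g sequentially"
    proof (rule uniform_limitI)
      fix e :: real assume e: "e > 0"
      obtain M where M: "\<forall>m\<ge>M. \<forall>n\<ge>M. \<forall>z\<in>cball x \<rho>. cmod (f m z - f n z) \<le> e / 2"
        using loc[OF \<rho>, of "e / 2"] e by auto
      have "dist (f n z) (g z) < e" if "n \<ge> M" "z \<in> cball x \<rho>" for n z
      proof -
        have "(\<lambda>m. cmod (f n z - f m z)) \<longlonglongrightarrow> cmod (f n z - g z)"
          using sub that by (intro tendsto_intros lim) auto
        then have "cmod (f n z - g z) \<le> e / 2"
          by (rule LIMSEQ_le_const2) (use M that in blast)
        then show ?thesis using e by (simp add: dist_norm)
      qed
      then show "\<forall>\<^sub>F n in sequentially. \<forall>z\<in>cball x \<rho>. dist (f n z) (g z) < e"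
        unfolding eventually_sequentially by blast
    qed
    then show "\<exists>d>0. cball x d \<subseteq> D \<and> uniform_limit (cball x d) f g sequentially"
      using \<rho>(1) sub by blast
  qed
  have est: "(\<lambda>z. f n z - g z) \<in> H \<and> N (\<lambda>z. f n z - g z) \<le> \<epsilon>"
    if \<epsilon>: "\<epsilon> > 0" and M: "\<And>m. m \<ge> M \<Longrightarrow> N (\<lambda>z. f n z - f m z) \<le> \<epsilon>" for n M \<epsilon>
  proof -
    define F where "F m z = (cmod (indicator D z *\<^sub>R (f n z - f m z)))\<^sup>2" for m z
    define F0 where "F0 z = (cmod (indicator D z *\<^sub>R (f n z - g z)))\<^sup>2" for z
    have hol0: "(\<lambda>z. f n z - g z) holomorphic_on D"
      using f H_hol hol by (intro holomorphic_intros) auto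
    have [measurable]: "F m \<in> borel_measurable borel" for m
      unfolding F_def[abs_def] using H_measurable[OF diff[of n m]] by measurable
    have [measurable]: "F0 \<in> borel_measurable borel"
      unfolding F0_def[abs_def] using borel_measurable_holomorphic_indicator[OF open_D hol0] by measurable
    have nn: "0 \<le> F m z" "0 \<le> F0 z" for m z by (auto simp: F_def F0_def)
    have FI: "(\<integral>\<^sup>+z. ennreal (F m z) \<partial>lborel) = ennreal ((N (\<lambda>z. f n z - f m z))\<^sup>2)" for m
      using H_integrable_square[OF diff[of n m]] N_square[OF diff[of n m]] nn
      by (subst nn_integral_eq_integral) (auto simp: F_def[abs_def] simp del: norm_scaleR)
    have conv: "(\<lambda>m. F m z) \<longlonglongrightarrow> F0 z" for z
    proof (cases "z \<in> D")
      case True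
      show ?thesis unfolding F_def F0_def by (intro tendsto_intros lim True)
    qed (simp add: F_def F0_def)
    have "(\<integral>\<^sup>+z. ennreal (F0 z) \<partial>lborel) = (\<integral>\<^sup>+z. liminf (\<lambda>m. ennreal (F m z)) \<partial>lborel)"
    proof (rule nn_integral_cong)
      fix z
      have "(\<lambda>m. ennreal (F m z)) \<longlonglongrightarrow> ennreal (F0 z)" by (intro tendsto_ennrealI conv)
      then show "ennreal (F0 z) = liminf (\<lambda>m. ennreal (F m z))"
        using lim_imp_Liminf[OF sequentially_bot] by metis
    qed
    also have "\<dots> \<le> liminf (\<lambda>m. \<integral>\<^sup>+z. ennreal (F m z) \<partial>lborel)"
      by (rule nn_integral_liminf) measurable
    also have "\<dots> \<le> ennreal (\<epsilon>\<^sup>2)"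
    proof -
      have "(\<integral>\<^sup>+z. ennreal (F m z) \<partial>lborel) \<le> ennreal (\<epsilon>\<^sup>2)" if "m \<ge> M" for m
        unfolding FI using M[OF that] N_nonneg[OF diff] by (intro ennreal_leI power_mono)
      then have "\<forall>\<^sub>F m in sequentially. (\<integral>\<^sup>+z. ennreal (F m z) \<partial>lborel) \<le> ennreal (\<epsilon>\<^sup>2)"
        unfolding eventually_sequentially by blast
      then have "liminf (\<lambda>m. \<integral>\<^sup>+z. ennreal (F m z) \<partial>lborel) \<le> liminf (\<lambda>m. ennreal (\<epsilon>\<^sup>2))"
        by (rule Liminf_mono)
      then show ?thesis by (simp add: Liminf_const)
    qed
    finally have le: "(\<integral>\<^sup>+z. ennreal (F0 z) \<partial>lborel) \<le> ennreal (\<epsilon>\<^sup>2)" .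
    then have int: "integrable lborel F0"
      using nn by (intro integrableI_nonneg) (auto intro: le_less_trans)
    then have mem: "(\<lambda>z. f n z - g z) \<in> H"
      unfolding L2_hol_iff[OF open_D] using hol0 by (simp only: F0_def[abs_def] simp_thms)
    have "ennreal (\<integral>z. F0 z \<partial>lborel) \<le> ennreal (\<epsilon>\<^sup>2)"
      using le int nn by (subst (asm) nn_integral_eq_integral) auto
    then have "(N (\<lambda>z. f n z - g z))\<^sup>2 \<le> \<epsilon>\<^sup>2"
      unfolding N_square[OF mem] F0_def[symmetric] by (simp add: ennreal_le_iff)
    then show ?thesis using mem \<epsilon> by (auto intro: power2_le_imp_le)
  qed
  have tail: "\<exists>M. \<forall>n\<ge>M. (\<lambda>z. f n z - g z) \<in> H \<and> N (\<lambda>z. f n z - g z) \<le> \<epsilon>" if \<epsilon>: "\<epsilon> > 0" for \<epsilon>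
  proof -
    obtain M where "\<forall>m\<ge>M. \<forall>n\<ge>M. N (\<lambda>z. f m z - f n z) \<le> \<epsilon>" using cauchy[OF \<epsilon>] by blast
    then show ?thesis using est[OF \<epsilon>, of M] by blast
  qed
  obtain n where n: "(\<lambda>z. f n z - g z) \<in> H" using tail[of 1] by auto
  have g: "g \<in> H" using H_diff[OF f[of n] n] by simp
  moreover have "(\<lambda>n. N (\<lambda>z. f n z - g z)) \<longlonglongrightarrow> 0"
  proof (rule LIMSEQ_I)
    fix e :: real assume e: "e > 0"
    obtain M where M: "\<forall>n\<ge>M. (\<lambda>z. f n z - g z) \<in> H \<and> N (\<lambda>z. f n z - g z) \<le> e / 2"
      using tail[of "e / 2"] e by auto
    have "norm (N (\<lambda>z. f n z - g z) - 0) < e" if "n \<ge> M" for n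
      using M that e N_nonneg[of "\<lambda>z. f n z - g z"] by fastforce
    then show "\<exists>M. \<forall>n\<ge>M. norm (N (\<lambda>z. f n z - g z) - 0) < e" by blast
  qed
  ultimately show ?thesis by (rule that)
qed

text \<open>Dirichlet's principle: the minimiser of the functional \<open>J\<close> is the
  representer. Minimising sequences are Cauchy by the parallelogram law, and the vanishing of the
  first variation at the limit is the representation formula.\<close>

lemma riesz:
  assumes add: "\<And>f g. f \<in> H \<Longrightarrow> g \<in> H \<Longrightarrow> L (\<lambda>z. f z + g z) = L f + L g"
    and scale: "\<And>c f. f \<in> H \<Longrightarrow> L (\<lambda>z. c * f z) = c * L f"
    and bound: "\<And>f. f \<in> H \<Longrightarrow> cmod (L f) \<le> C * N f"
  obtains k where "k \<in> H" "\<And>f. f \<in> H \<Longrightarrow> ip f k = L f"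
proof -
  define J where "J f = (N f)\<^sup>2 - 2 * Re (L f)" for f
  have Jlow: "- C\<^sup>2 \<le> J f" if "f \<in> H" for f
  proof -
    have "Re (L f) \<le> C * N f" using complex_Re_le_cmod bound[OF that] order_trans by blast
    moreover have "0 \<le> (N f - C)\<^sup>2" by simp
    ultimately show ?thesis by (simp add: J_def power2_diff algebra_simps)
  qed
  have ne: "J ` H \<noteq> {}" using H_const by blast
  have bdd: "bdd_below (J ` H)" using Jlow by (intro bdd_belowI[of _ "- C\<^sup>2"]) auto
  define m where "m = Inf (J ` H)"
  have m: "m \<le> J f" if "f \<in> H" for f unfolding m_def using bdd that by (intro cInf_lower) auto
  have "\<exists>f\<in>H. J f < m + 1 / (real n + 1)" for n :: nat
    using cInf_lessD[OF ne, of "m + 1 / (real n + 1)"] unfolding m_def by auto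
  then obtain f where f: "\<And>n. f n \<in> H" "\<And>n. J (f n) < m + 1 / (real n + 1)" by metis
  \<comment> \<open>The linear part of \<open>J\<close> cancels, since the value of \<open>L\<close>
    at the midpoint is the mean of its values; what is left is the parallelogram law.\<close>
  have para: "(N (\<lambda>z. g z - h z))\<^sup>2 = 2 * J g + 2 * J h - 4 * J (\<lambda>z. (1 / 2) * (g z + h z))"
    if g: "g \<in> H" and h: "h \<in> H" for g h
  proof -
    have 1: "(N (\<lambda>z. g z - h z))\<^sup>2 = (N g)\<^sup>2 - 2 * Re (ip g h) + (N h)\<^sup>2"
      using N_square_perturb[OF g h, of "-1"] by simp
    have 2: "(N (\<lambda>z. g z + h z))\<^sup>2 = (N g)\<^sup>2 + 2 * Re (ip g h) + (N h)\<^sup>2"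
      using N_square_perturb[OF g h, of "1"] by simp
    have gh: "(\<lambda>z. g z + h z) \<in> H" by (rule H_add[OF g h])
    have "complex_of_real ((N (\<lambda>z. (1 / 2) * (g z + h z)))\<^sup>2) = of_real ((N (\<lambda>z. g z + h z))\<^sup>2 / 4)"
      unfolding ip_self[OF H_scale[OF gh], symmetric] ip_scale_left ip_scale_right ip_self[OF gh] by simp
    then have 3: "(N (\<lambda>z. (1 / 2) * (g z + h z)))\<^sup>2 = (N (\<lambda>z. g z + h z))\<^sup>2 / 4"
      by (simp only: of_real_eq_iff)
    have 4: "L (\<lambda>z. (1 / 2) * (g z + h z)) = (1 / 2) * (L g + L h)"
      using scale[OF gh, of "1/2"] add[OF g h] by simp
    show ?thesis unfolding J_def 1 3 2 4 by (simp add: field_simps)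
  qed
  have near: "(N (\<lambda>z. f i z - f j z))\<^sup>2 \<le> 2 / (real i + 1) + 2 / (real j + 1)" for i j
  proof -
    have "m \<le> J (\<lambda>z. (1 / 2) * (f i z + f j z))" by (rule m[OF H_scale[OF H_add[OF f(1) f(1)]]])
    then show ?thesis unfolding para[OF f(1) f(1)] using f(2)[of i] f(2)[of j] by simp
  qed
  have cauchy: "\<exists>M. \<forall>i\<ge>M. \<forall>j\<ge>M. N (\<lambda>z. f i z - f j z) \<le> \<epsilon>" if \<epsilon>: "\<epsilon> > 0" for \<epsilon>
  proof -
    obtain M where M: "4 / \<epsilon>\<^sup>2 < real M" using reals_Archimedean2 by blast
    have "N (\<lambda>z. f i z - f j z) \<le> \<epsilon>" if "i \<ge> M" "j \<ge> M" for i j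
    proof -
      have b: "2 / (real i + 1) \<le> \<epsilon>\<^sup>2 / 2" if "i \<ge> M" for i
      proof -
        have "4 / \<epsilon>\<^sup>2 \<le> real i + 1" using M that by linarith
        then show ?thesis using \<epsilon> by (simp add: field_simps)
      qed
      have "(N (\<lambda>z. f i z - f j z))\<^sup>2 \<le> \<epsilon>\<^sup>2 / 2 + \<epsilon>\<^sup>2 / 2"
        by (rule order_trans[OF near add_mono[OF b[OF that(1)] b[OF that(2)]]])
      then have "(N (\<lambda>z. f i z - f j z))\<^sup>2 \<le> \<epsilon>\<^sup>2" by (simp only: field_sum_of_halves)
      then show ?thesis using \<epsilon> by (auto intro: power2_le_imp_le)
    qed
    then show ?thesis by blast
  qed
  obtain k where k: "k \<in> H" "(\<lambda>n. N (\<lambda>z. f n z - k z)) \<longlonglongrightarrow> 0"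
    using complete[OF f(1) cauchy] by blast
  have Re: "Re (ip k g) = Re (L g)" if g: "g \<in> H" for g
  proof -
    have "(\<lambda>n. ip (f n) g - ip k g) \<longlonglongrightarrow> 0"
    proof (rule Lim_null_comparison)
      show "\<forall>\<^sub>F n in sequentially. cmod (ip (f n) g - ip k g) \<le> N (\<lambda>z. f n z - k z) * N g"
        using ip_Cauchy_Schwarz[OF H_diff[OF f(1) k(1)] g] ip_diff_left[OF f(1) k(1) g] by simp
      show "(\<lambda>n. N (\<lambda>z. f n z - k z) * N g) \<longlonglongrightarrow> 0" using tendsto_mult_right[OF k(2), of "N g"] by simp
    qed
    then have lim: "(\<lambda>n. ip (f n) g) \<longlonglongrightarrow> ip k g" by (rule LIM_zero_cancel)
    \<comment> \<open>First variation at the minimiser. The inequality is proved for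
      \<open>f n\<close>, whose excess over the infimum is below 1 / (n + 1), and passed to the
      limit; that excess becomes the factor 0 here.\<close>
    have "(Re (ip k g) - Re (L g))\<^sup>2 \<le> 0 * (N g)\<^sup>2"
    proof (rule quadratic_nonneg_imp_discriminant)
      fix s :: real
      have step: "0 \<le> 1 / (real n + 1) + 2 * s * (Re (ip (f n) g) - Re (L g)) + s\<^sup>2 * (N g)\<^sup>2" for n
      proof -
        have "m \<le> J (\<lambda>z. f n z + of_real s * g z)" by (rule m[OF H_add[OF f(1) H_scale[OF g]]])
        also have "\<dots> = J (f n) + 2 * s * (Re (ip (f n) g) - Re (L g)) + s\<^sup>2 * (N g)\<^sup>2"
          unfolding J_def N_square_perturb[OF f(1) g] add[OF f(1) H_scale[OF g]] scale[OF g]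
          by (simp add: algebra_simps)
        finally show ?thesis using f(2)[of n] by simp
      qed
      have "(\<lambda>n. 1 / (real n + 1) + 2 * s * (Re (ip (f n) g) - Re (L g)) + s\<^sup>2 * (N g)\<^sup>2) \<longlonglongrightarrow>
          0 + 2 * s * (Re (ip k g) - Re (L g)) + s\<^sup>2 * (N g)\<^sup>2"
        by (intro tendsto_intros lim) (use lim_inverse_n' LIMSEQ_Suc[OF lim_1_over_n] in \<open>simp add: add.commute\<close>)
      then show "0 \<le> 0 + 2 * s * (Re (ip k g) - Re (L g)) + s\<^sup>2 * (N g)\<^sup>2"
        by (rule LIMSEQ_le_const) (use step in auto)
    qed simp
    then show ?thesis by simp
  qed
  have "ip g k = L g" if g: "g \<in> H" for g
  proof -
    have r: "Re (ip g k) = Re (L g)" using Re[OF g] ip_sym[of g k] by simp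
    have "Re (ip (\<lambda>z. \<i> * g z) k) = Re (L (\<lambda>z. \<i> * g z))"
      using Re[OF H_scale[OF g]] ip_sym[of "\<lambda>z. \<i> * g z" k] by simp
    then have "Im (ip g k) = Im (L g)" unfolding ip_scale_left scale[OF g] by simp
    with r show ?thesis by (simp add: complex_eq_iff)
  qed
  then show ?thesis using that k(1) by blast
qed

end

section \<open>The Bergman kernel and metric through representers\<close>

lemma has_derivative_from_quadratic:
  fixes F :: "complex \<Rightarrow> complex"
  assumes lin: "bounded_linear A" and \<epsilon>: "\<epsilon> > 0"
    and le: "\<And>h. cmod h < \<epsilon> \<Longrightarrow> cmod (F (w + h) - F w - A h) \<le> M * (cmod h)\<^sup>2"
  shows "(F has_derivative A) (at w)"
  unfolding has_derivative_at
proof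
  show "(\<lambda>h. cmod (F (w + h) - F w - A h) / cmod h) \<midarrow>0\<rightarrow> 0"
  proof (rule Lim_null_comparison)
    have "cmod (F (w + h) - F w - A h) / cmod h \<le> M * cmod h" if "cmod h < \<epsilon>" for h
    proof -
      have "cmod (F (w + h) - F w - A h) / cmod h \<le> M * (cmod h)\<^sup>2 / cmod h"
        by (intro divide_right_mono le that) auto
      then show ?thesis by (cases "h = 0") (auto simp: power2_eq_square)
    qed
    then show "\<forall>\<^sub>F h in at 0. norm (cmod (F (w + h) - F w - A h) / cmod h) \<le> M * cmod h"
      using \<epsilon> unfolding eventually_at by (intro exI[of _ \<epsilon>]) auto
    show "((\<lambda>h. M * cmod h) \<longlongrightarrow> 0) (at 0)"
      by (rule tendsto_eq_intros refl tendsto_norm)+ auto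
  qed
qed (rule lin)

context bergman_space
begin

text \<open>The interior estimate combined with the Cauchy inequality. One constant serves a whole
  neighbourhood of \<open>w\<close>, as the Taylor remainders in \<open>repr_perturb\<close>
  require.\<close>

lemma higher_deriv_bound:
  assumes w: "w \<in> D"
  obtains \<epsilon> C where "\<epsilon> > 0" "ball w \<epsilon> \<subseteq> D" "0 \<le> C"
    "\<And>f y. f \<in> H \<Longrightarrow> y \<in> ball w \<epsilon> \<Longrightarrow> cmod ((deriv ^^ n) f y) \<le> C * N f"
proof -
  have "\<exists>e>0. cball w e \<subseteq> D" using open_contains_cball_eq[OF open_D] w by simp
  then obtain e where e: "e > 0" "cball w e \<subseteq> D" by blast
  \<comment> \<open>One third of \<open>e\<close> is spent on each of three steps: from
    \<open>w\<close> to \<open>y\<close>, from \<open>y\<close> to the Cauchy circle, and from there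
    across the disc of the evaluation bound.\<close>
  define \<epsilon> where "\<epsilon> = e / 3"
  have \<epsilon>: "\<epsilon> > 0" using e by (simp add: \<epsilon>_def)
  have sub: "cball u \<epsilon> \<subseteq> D" if "dist w u \<le> 2 * \<epsilon>" for u
  proof
    fix v assume "v \<in> cball u \<epsilon>"
    then have "v \<in> cball w e" using that dist_triangle[of w v u] by (simp add: \<epsilon>_def)
    then show "v \<in> D" using e by blast
  qed
  define C where "C = fact n * (138 / \<epsilon>) / \<epsilon> ^ n"
  have bnd: "cmod ((deriv ^^ n) f y) \<le> C * N f" if f: "f \<in> H" and y: "y \<in> ball w \<epsilon>" for f y
  proof -
    have yD: "cball y \<epsilon> \<subseteq> D" using y \<epsilon> by (intro sub) auto
    have "cmod ((deriv ^^ n) f y) \<le> fact n * (138 / \<epsilon> * N f) / \<epsilon> ^ n"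
    proof (rule Cauchy_inequality[OF _ _ \<epsilon>])
      show "f holomorphic_on ball y \<epsilon>"
        using H_hol[OF f] yD ball_subset_cball holomorphic_on_subset by blast
      show "continuous_on (cball y \<epsilon>) f"
        using H_hol[OF f] yD holomorphic_on_imp_continuous_on continuous_on_subset by blast
      fix u assume "cmod (y - u) = \<epsilon>"
      then have "dist w u \<le> 2 * \<epsilon>" using y dist_triangle[of w u y] by (simp add: dist_norm)
      then show "cmod (f u) \<le> 138 / \<epsilon> * N f" by (intro eval_bound[OF \<epsilon> sub f])
    qed
    then show ?thesis by (simp add: C_def)
  qed
  have "ball w \<epsilon> \<subseteq> D" using sub[of w] \<epsilon> ball_subset_cball by auto
  moreover have "0 \<le> C" using \<epsilon> by (simp add: C_def)
  ultimately show ?thesis using that[OF \<epsilon>] bnd by blast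
qed

text \<open>On \<open>D\<close>, \<open>repr 0 w\<close> is the Bergman kernel function K(., w), and
  \<open>repr n w\<close> is its n-th derivative in the conjugate of \<open>w\<close>.\<close>

definition repr :: "nat \<Rightarrow> complex \<Rightarrow> complex \<Rightarrow> complex" where
  "repr n w = (SOME k. k \<in> H \<and> (\<forall>f\<in>H. ip f k = (deriv ^^ n) f w))"

lemma repr:
  assumes w: "w \<in> D"
  shows "repr n w \<in> H" "f \<in> H \<Longrightarrow> ip f (repr n w) = (deriv ^^ n) f w"
proof -
  obtain \<epsilon> C where \<epsilon>: "\<epsilon> > 0" and C: "\<And>f y. f \<in> H \<Longrightarrow> y \<in> ball w \<epsilon> \<Longrightarrow> cmod ((deriv ^^ n) f y) \<le> C * N f"
    using higher_deriv_bound[OF w, of n] by metis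
  obtain k where "k \<in> H" "\<And>f. f \<in> H \<Longrightarrow> ip f k = (deriv ^^ n) f w"
  proof (rule riesz[of "\<lambda>f. (deriv ^^ n) f w" C])
    show "(deriv ^^ n) (\<lambda>z. f z + g z) w = (deriv ^^ n) f w + (deriv ^^ n) g w" if "f \<in> H" "g \<in> H" for f g
      using that H_hol open_D w by (intro higher_deriv_add[where S = D]) auto
    show "(deriv ^^ n) (\<lambda>z. c * f z) w = c * (deriv ^^ n) f w" if "f \<in> H" for c f
      using that H_hol open_D w by (intro higher_deriv_cmult[where A = D]) auto
    show "cmod ((deriv ^^ n) f w) \<le> C * N f" if "f \<in> H" for f
      using C[OF that] \<epsilon> by simp
  qed blast
  then have "\<exists>k. k \<in> H \<and> (\<forall>f\<in>H. ip f k = (deriv ^^ n) f w)" by blast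
  from someI_ex[OF this] show "repr n w \<in> H" "f \<in> H \<Longrightarrow> ip f (repr n w) = (deriv ^^ n) f w"
    unfolding repr_def by blast+
qed

text \<open>By the reproducing property the squared norm of the remainder \<open>e\<close> is the
  first-order Taylor remainder of the n-th derivative of \<open>e\<close> itself, hence at most C *
  N e * |h|^2; dividing by \<open>N e\<close> gives the bound.\<close>

lemma repr_perturb:
  assumes w: "w \<in> D"
  obtains \<epsilon> C where "\<epsilon> > 0" "0 \<le> C" "\<And>h. cmod h < \<epsilon> \<Longrightarrow> w + h \<in> D"
    "\<And>h. cmod h < \<epsilon> \<Longrightarrow> N (\<lambda>z. repr n (w + h) z - (repr n w z + cnj h * repr (Suc n) w z)) \<le> C * (cmod h)\<^sup>2"
proof -
  obtain \<epsilon> C where \<epsilon>: "\<epsilon> > 0" "ball w \<epsilon> \<subseteq> D" and C: "0 \<le> C"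
    "\<And>f y. f \<in> H \<Longrightarrow> y \<in> ball w \<epsilon> \<Longrightarrow> cmod ((deriv ^^ (Suc (Suc n))) f y) \<le> C * N f"
    using higher_deriv_bound[OF w, of "Suc (Suc n)"] by metis
  have whD: "w + h \<in> D" if "cmod h < \<epsilon>" for h
    using \<epsilon> that by (auto simp: dist_norm)
  have taylor: "cmod ((deriv ^^ n) f (w + h) - ((deriv ^^ n) f w + h * (deriv ^^ (Suc n)) f w)) \<le> C * N f * (cmod h)\<^sup>2"
    if f: "f \<in> H" and h: "cmod h < \<epsilon>" for f h
  proof -
    have der: "((deriv ^^ (n + i)) f has_field_derivative (deriv ^^ (n + Suc i)) f x) (at x within ball w \<epsilon>)"
      if "x \<in> ball w \<epsilon>" for i x
    proof -
      have "(deriv ^^ (n + i)) f holomorphic_on D" by (intro holomorphic_higher_deriv H_hol f open_D)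
      then have "((deriv ^^ (n + i)) f has_field_derivative deriv ((deriv ^^ (n + i)) f) x) (at x)"
        using holomorphic_derivI open_D that \<epsilon> by blast
      then show ?thesis by (simp add: has_field_derivative_at_within)
    qed
    have "cmod ((deriv ^^ (n + 0)) f (w + h) - (\<Sum>i\<le>1. (deriv ^^ (n + i)) f w * (w + h - w) ^ i / fact i))
        \<le> C * N f * cmod (w + h - w) ^ Suc 1 / fact 1"
    proof (rule complex_Taylor[of "ball w \<epsilon>" 1 "\<lambda>i. (deriv ^^ (n + i)) f"])
      show "cmod ((deriv ^^ (n + Suc 1)) f x) \<le> C * N f" if "x \<in> ball w \<epsilon>" for x
        using C(2)[OF f that] by simp
    qed (use der \<epsilon> h in \<open>auto simp: dist_norm\<close>)
    then show ?thesis by (simp add: power2_eq_square mult.commute)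
  qed
  have "N (\<lambda>z. repr n (w + h) z - (repr n w z + cnj h * repr (Suc n) w z)) \<le> C * (cmod h)\<^sup>2"
    if h: "cmod h < \<epsilon>" for h
  proof -
    define e where "e = (\<lambda>z. repr n (w + h) z - (repr n w z + cnj h * repr (Suc n) w z))"
    note r = repr[OF w] repr[OF whD[OF h]]
    have mem: "(\<lambda>z. cnj h * repr (Suc n) w z) \<in> H" "(\<lambda>z. repr n w z + cnj h * repr (Suc n) w z) \<in> H"
      by (intro H_add H_scale r(1))+
    have e: "e \<in> H" unfolding e_def by (intro H_diff mem r)
    have "ip e e = ip e (repr n (w + h)) - (ip e (repr n w) + h * ip e (repr (Suc n) w))"
      by (subst (2) e_def) (simp add: ip_diff_right ip_add_right ip_scale_right e mem r)
    also have "\<dots> = (deriv ^^ n) e (w + h) - ((deriv ^^ n) e w + h * (deriv ^^ (Suc n)) e w)"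
      by (simp only: r(2)[OF e] r(4)[OF e])
    finally have "cmod (ip e e) \<le> C * N e * (cmod h)\<^sup>2" using taylor[OF e h] by simp
    then have "N e * N e \<le> (C * (cmod h)\<^sup>2) * N e"
      by (simp add: ip_self[OF e] power2_eq_square norm_mult mult_ac N_nonneg[OF e])
    then have "N e \<le> C * (cmod h)\<^sup>2"
      using N_nonneg[OF e] C(1) by (cases "N e = 0") (auto simp: mult_le_cancel_right)
    then show ?thesis by (simp add: e_def)
  qed
  then show ?thesis using that[OF \<epsilon>(1) C(1)] whD by blast
qed

text \<open>The value on the diagonal of the derivative of the two-variable Bergman kernel, of order
  n in the first variable and of order m in the conjugate of the second.\<close>

definition gram :: "nat \<Rightarrow> nat \<Rightarrow> complex \<Rightarrow> complex" where
  "gram m n w = ip (repr m w) (repr n w)"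

lemma gram_sym: "gram n m w = cnj (gram m n w)"
  unfolding gram_def by (rule ip_sym)

text \<open>Both arguments of the inner product are expanded by \<open>repr_perturb\<close>. Since
  the derivative is again made of \<open>gram\<close> functions, a second application yields the
  mixed second derivative.\<close>

lemma gram_has_derivative:
  assumes w: "w \<in> D"
  shows "(gram m n has_derivative (\<lambda>h. cnj h * gram (Suc m) n w + h * gram m (Suc n) w)) (at w)"
proof -
  obtain \<epsilon>1 C1 where \<epsilon>1: "\<epsilon>1 > 0" "0 \<le> C1" "\<And>h. cmod h < \<epsilon>1 \<Longrightarrow> w + h \<in> D"
    "\<And>h. cmod h < \<epsilon>1 \<Longrightarrow> N (\<lambda>z. repr m (w + h) z - (repr m w z + cnj h * repr (Suc m) w z)) \<le> C1 * (cmod h)\<^sup>2"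
    using repr_perturb[OF w, of m] by blast
  obtain \<epsilon>2 C2 where \<epsilon>2: "\<epsilon>2 > 0" "0 \<le> C2" "\<And>h. cmod h < \<epsilon>2 \<Longrightarrow> w + h \<in> D"
    "\<And>h. cmod h < \<epsilon>2 \<Longrightarrow> N (\<lambda>z. repr n (w + h) z - (repr n w z + cnj h * repr (Suc n) w z)) \<le> C2 * (cmod h)\<^sup>2"
    using repr_perturb[OF w, of n] by blast
  obtain \<epsilon>3 C3 where \<epsilon>3: "\<epsilon>3 > 0" "ball w \<epsilon>3 \<subseteq> D" "0 \<le> C3"
    "\<And>f y. f \<in> H \<Longrightarrow> y \<in> ball w \<epsilon>3 \<Longrightarrow> cmod ((deriv ^^ n) f y) \<le> C3 * N f"
    using higher_deriv_bound[OF w, of n] by metis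
  define \<epsilon> where "\<epsilon> = min (min \<epsilon>1 \<epsilon>2) (min \<epsilon>3 1)"
  have \<epsilon>: "\<epsilon> > 0" "\<epsilon> \<le> \<epsilon>1" "\<epsilon> \<le> \<epsilon>2" "\<epsilon> \<le> \<epsilon>3" "\<epsilon> \<le> 1" using \<epsilon>1 \<epsilon>2 \<epsilon>3 by (auto simp: \<epsilon>_def)
  define a a' b b' where "a = repr m w" and "a' = repr (Suc m) w" and "b = repr n w" and "b' = repr (Suc n) w"
  have mem: "a \<in> H" "a' \<in> H" "b \<in> H" "b' \<in> H"
    using repr(1)[OF w] by (auto simp: a_def a'_def b_def b'_def)
  define M where "M = C3 * C1 + N a * C2 + N a' * C2 + N a' * N b'"
  show ?thesis
  proof (rule has_derivative_from_quadratic[OF _ \<epsilon>(1)])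
    show "bounded_linear (\<lambda>h. cnj h * gram (Suc m) n w + h * gram m (Suc n) w)"
      by (intro bounded_linear_add bounded_linear_mult_left bounded_linear_compose[OF bounded_linear_mult_left bounded_linear_cnj])
    fix h assume h: "cmod h < \<epsilon>"
    have whD: "w + h \<in> D" using \<epsilon>1(3) h \<epsilon> by simp
    define ah bh where "ah = repr m (w + h)" and "bh = repr n (w + h)"
    have memh: "ah \<in> H" "bh \<in> H" using repr(1)[OF whD] by (auto simp: ah_def bh_def)
    define e e' where "e = (\<lambda>z. ah z - (a z + cnj h * a' z))" and "e' = (\<lambda>z. bh z - (b z + cnj h * b' z))"
    have sm: "(\<lambda>z. cnj h * a' z) \<in> H" "(\<lambda>z. cnj h * b' z) \<in> H" "(\<lambda>z. a z + cnj h * a' z) \<in> H" "(\<lambda>z. b z + cnj h * b' z) \<in> H"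
      by (intro H_add H_scale mem)+
    have e: "e \<in> H" "e' \<in> H" unfolding e_def e'_def by (intro H_diff sm memh)+
    have Ne: "N e \<le> C1 * (cmod h)\<^sup>2" "N e' \<le> C2 * (cmod h)\<^sup>2"
      using \<epsilon>1(4)[of h] \<epsilon>2(4)[of h] h \<epsilon> by (auto simp: e_def e'_def ah_def bh_def a_def b_def a'_def b'_def)
    have 1: "ip e bh = ip ah bh - (ip a bh + cnj h * ip a' bh)"
      unfolding e_def by (simp add: ip_diff_left ip_add_left ip_scale_left mem memh sm)
    have 2: "ip a e' = ip a bh - (ip a b + h * ip a b')" "ip a' e' = ip a' bh - (ip a' b + h * ip a' b')"
      unfolding e'_def by (simp_all add: ip_diff_right ip_add_right ip_scale_right mem memh sm)
    have "gram m n (w + h) - gram m n w - (cnj h * gram (Suc m) n w + h * gram m (Suc n) w) =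
        ip ah bh - ip a b - (cnj h * ip a' b + h * ip a b')"
      by (simp add: gram_def a_def b_def a'_def b'_def ah_def bh_def)
    also have "\<dots> = ip e bh + ip a e' + cnj h * ip a' e' + cnj h * h * ip a' b'"
      unfolding 1 2 by (simp add: algebra_simps)
    finally have "cmod (gram m n (w + h) - gram m n w - (cnj h * gram (Suc m) n w + h * gram m (Suc n) w)) \<le>
        cmod (ip e bh) + cmod (ip a e') + cmod (cnj h * ip a' e') + cmod (cnj h * h * ip a' b')"
      by (metis (no_types, lifting) norm_triangle_le add_mono norm_triangle_ineq order_refl)
    also have "\<dots> \<le> C3 * (C1 * (cmod h)\<^sup>2) + N a * (C2 * (cmod h)\<^sup>2) + N a' * (C2 * (cmod h)\<^sup>2) + (cmod h)\<^sup>2 * (N a' * N b')"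
    proof (intro add_mono)
      \<comment> \<open>The reproducing property gives a constant independent of \<open>h\<close>,
        where Cauchy-Schwarz would involve the norm of \<open>bh\<close>.\<close>
      have "ip e bh = (deriv ^^ n) e (w + h)" unfolding bh_def by (rule repr(2)[OF whD e(1)])
      then have "cmod (ip e bh) \<le> C3 * N e" using \<epsilon>3(4)[OF e(1), of "w + h"] h \<epsilon> by (simp add: dist_norm)
      also have "\<dots> \<le> C3 * (C1 * (cmod h)\<^sup>2)" by (intro mult_left_mono Ne \<epsilon>3(3))
      finally show "cmod (ip e bh) \<le> C3 * (C1 * (cmod h)\<^sup>2)" .
      have "cmod (ip a e') \<le> N a * N e'" by (rule ip_Cauchy_Schwarz[OF mem(1) e(2)])
      also have "\<dots> \<le> N a * (C2 * (cmod h)\<^sup>2)" by (intro mult_left_mono Ne N_nonneg mem)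
      finally show "cmod (ip a e') \<le> N a * (C2 * (cmod h)\<^sup>2)" .
      have "cmod (cnj h * ip a' e') \<le> 1 * cmod (ip a' e')"
        unfolding norm_mult using h \<epsilon> by (intro mult_right_mono) auto
      also have "1 * cmod (ip a' e') \<le> N a' * N e'" using ip_Cauchy_Schwarz[OF mem(2) e(2)] by simp
      also have "\<dots> \<le> N a' * (C2 * (cmod h)\<^sup>2)" by (intro mult_left_mono Ne N_nonneg mem)
      finally show "cmod (cnj h * ip a' e') \<le> N a' * (C2 * (cmod h)\<^sup>2)" .
      show "cmod (cnj h * h * ip a' b') \<le> (cmod h)\<^sup>2 * (N a' * N b')"
        using mult_left_mono[OF ip_Cauchy_Schwarz[OF mem(2,4)], of "(cmod h)\<^sup>2"]
        by (simp add: norm_mult power2_eq_square)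
    qed
    also have "\<dots> = M * (cmod h)\<^sup>2" by (simp add: M_def algebra_simps)
    finally show "cmod (gram m n (w + h) - gram m n w - (cnj h * gram (Suc m) n w + h * gram m (Suc n) w)) \<le> M * (cmod h)\<^sup>2" .
  qed
qed

section \<open>The kernel and the metric as extremal quantities\<close>

lemma gram_diag: "w \<in> D \<Longrightarrow> gram n n w = of_real ((N (repr n w))\<^sup>2)"
  unfolding gram_def by (rule ip_self) (rule repr(1))

lemma repr_0_pos:
  assumes w: "w \<in> D"
  shows "0 < N (repr 0 w)"
proof -
  have "1 = cmod (ip (\<lambda>z. 1) (repr 0 w))" using repr(2)[OF w H_const[of 1], of 0] by simp
  also have "\<dots> \<le> N (\<lambda>z. 1) * N (repr 0 w)" by (rule ip_Cauchy_Schwarz[OF H_const repr(1)[OF w]])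
  finally have "N (repr 0 w) \<noteq> 0" by auto
  then show ?thesis using N_nonneg[OF repr(1)[OF w], of 0] by simp
qed

lemma eval_le_repr:
  assumes w: "w \<in> D" and f: "f \<in> H"
  shows "(cmod (f w))\<^sup>2 \<le> (N (repr 0 w))\<^sup>2 * (N f)\<^sup>2"
proof -
  have "cmod (f w) \<le> N f * N (repr 0 w)"
    using ip_Cauchy_Schwarz[OF f repr(1)[OF w, of 0]] repr(2)[OF w f, of 0] by simp
  then have "(cmod (f w))\<^sup>2 \<le> (N f * N (repr 0 w))\<^sup>2" by (intro power_mono) auto
  then show ?thesis by (simp add: power_mult_distrib mult.commute)
qed

lemma repr_self: "w \<in> D \<Longrightarrow> repr 0 w w = of_real ((N (repr 0 w))\<^sup>2)"
  using repr(2)[of w "repr 0 w" 0] repr(1)[of w 0] ip_self[of "repr 0 w"] by simp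

text \<open>The supremum is a maximum, attained by \<open>repr 0 w\<close>, whose value at
  \<open>w\<close> is its own squared norm.\<close>

lemma bergman_kernel_eq:
  assumes w: "w \<in> D"
  shows "bergman_kernel D w = (N (repr 0 w))\<^sup>2"
  unfolding bergman_kernel_def
proof (rule cSup_eq_maximum)
  have pos: "0 < N (repr 0 w)" by (rule repr_0_pos[OF w])
  have "cmod (repr 0 w w) = (N (repr 0 w))\<^sup>2" unfolding repr_self[OF w] norm_of_real by simp
  then have "(cmod (repr 0 w w))\<^sup>2 / (N (repr 0 w))\<^sup>2 = (N (repr 0 w))\<^sup>2"
    using pos by (simp add: power2_eq_square)
  moreover have "\<exists>z\<in>D. repr 0 w z \<noteq> 0" using w pos by (intro bexI[of _ w]) (auto simp: repr_self[OF w])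
  ultimately show "(N (repr 0 w))\<^sup>2 \<in> {(cmod (f w))\<^sup>2 / (N f)\<^sup>2 |f. f \<in> H \<and> (\<exists>w\<in>D. f w \<noteq> 0)}"
    using repr(1)[OF w, of 0] by force
  fix y assume "y \<in> {(cmod (f w))\<^sup>2 / (N f)\<^sup>2 |f. f \<in> H \<and> (\<exists>w\<in>D. f w \<noteq> 0)}"
  then obtain f where y: "y = (cmod (f w))\<^sup>2 / (N f)\<^sup>2" and f: "f \<in> H" by blast
  show "y \<le> (N (repr 0 w))\<^sup>2"
    \<comment> \<open>For \<open>N f = 0\<close> the quotient is 0 by convention.\<close>
    unfolding y using eval_le_repr[OF w f] by (cases "N f = 0") (auto simp: divide_le_eq)
qed

lemma bergman_kernel_pos: "w \<in> D \<Longrightarrow> 0 < bergman_kernel D w"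
  using repr_0_pos[of w] by (simp add: bergman_kernel_eq)

lemma bergman_kernel_ge:
  "w \<in> D \<Longrightarrow> f \<in> H \<Longrightarrow> (cmod (f w))\<^sup>2 \<le> bergman_kernel D w * (N f)\<^sup>2"
  by (simp add: bergman_kernel_eq eval_le_repr)

text \<open>The assumed bound is tested on the extremal function \<open>repr 0 w\<close>; cancelling
  one factor of its norm leaves a bound for the norm itself.\<close>

lemma bergman_kernel_le:
  assumes w: "w \<in> D" and M: "\<And>f. f \<in> H \<Longrightarrow> cmod (f w) \<le> N f * M"
  shows "bergman_kernel D w \<le> M\<^sup>2"
proof -
  have pos: "0 < N (repr 0 w)" by (rule repr_0_pos[OF w])
  have "(N (repr 0 w))\<^sup>2 \<le> N (repr 0 w) * M"
    using M[OF repr(1)[OF w, of 0]] by (simp add: repr_self[OF w] norm_power)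
  then have "N (repr 0 w) \<le> M" using pos by (simp add: power2_eq_square)
  then show ?thesis using pos by (simp add: bergman_kernel_eq[OF w] power_mono)
qed

lemma wirtinger_dzbar_ln_kernel:
  assumes w: "w \<in> D"
  shows "wirtinger_dzbar (\<lambda>w. complex_of_real (ln (bergman_kernel D w))) w = gram 1 0 w / gram 0 0 w"
proof -
  define R where "R = bergman_kernel D w"
  have R: "0 < R" unfolding R_def by (rule bergman_kernel_pos[OF w])
  have g00: "gram 0 0 u = of_real (bergman_kernel D u)" if "u \<in> D" for u
    by (simp add: gram_diag[OF that] bergman_kernel_eq[OF that])
  have "(gram 0 0 has_derivative (\<lambda>h. cnj h * gram 1 0 w + h * gram 0 1 w)) (at w)"
    using gram_has_derivative[OF w, of 0 0] by simp
  then have "((\<lambda>u. Re (gram 0 0 u)) has_derivative (\<lambda>h. Re (cnj h * gram 1 0 w + h * gram 0 1 w))) (at w)"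
    by (rule has_derivative_Re)
  then have "((\<lambda>u. bergman_kernel D u) has_derivative (\<lambda>h. Re (cnj h * gram 1 0 w + h * gram 0 1 w))) (at w)"
    by (rule has_derivative_transform_within_open[OF _ open_D w]) (simp add: g00)
  then have "((\<lambda>u. ln (bergman_kernel D u)) has_derivative (\<lambda>h. Re (cnj h * gram 1 0 w + h * gram 0 1 w) * (1 / R))) (at w)"
    using R unfolding R_def by (auto intro!: derivative_eq_intros simp: divide_inverse)
  then have "((\<lambda>u. complex_of_real (ln (bergman_kernel D u))) has_derivative
      (\<lambda>h. of_real (Re (cnj h * gram 1 0 w + h * gram 0 1 w) * (1 / R)))) (at w)"
    by (rule has_derivative_of_real)
  then have fd: "frechet_derivative (\<lambda>u. complex_of_real (ln (bergman_kernel D u))) (at w) =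
      (\<lambda>h. of_real (Re (cnj h * gram 1 0 w + h * gram 0 1 w) * (1 / R)))"
    by (rule frechet_derivative_at[symmetric])
  have "gram 0 1 w = cnj (gram 1 0 w)" by (rule gram_sym)
  then show ?thesis
    unfolding wirtinger_dzbar_def fd g00[OF w] R_def[symmetric]
    using R by (simp add: complex_eq_iff field_simps)
qed

text \<open>The quotient rule produces the Gram determinant of \<open>repr 0 w\<close> and
  \<open>repr 1 w\<close> as numerator.\<close>

lemma bergman_metric_eq:
  assumes w: "w \<in> D"
  shows "bergman_metric D w =
    ((N (repr 1 w))\<^sup>2 * bergman_kernel D w - (cmod (gram 1 0 w))\<^sup>2) / (bergman_kernel D w)\<^sup>2"
proof -
  define R where "R = bergman_kernel D w"
  have R: "0 < R" unfolding R_def by (rule bergman_kernel_pos[OF w])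
  have g00: "gram 0 0 w = of_real R"
    by (simp add: gram_diag[OF w] bergman_kernel_eq[OF w] R_def)
  have g01: "gram 0 1 w = cnj (gram 1 0 w)" by (rule gram_sym)
  have g11: "gram 1 1 w = of_real ((N (repr 1 w))\<^sup>2)" by (rule gram_diag[OF w])
  let ?Q = "\<lambda>h. ((cnj h * gram 2 0 w + h * gram 1 1 w) * gram 0 0 w - gram 1 0 w * (cnj h * gram 1 0 w + h * gram 0 1 w)) / (gram 0 0 w * gram 0 0 w)"
  have "((\<lambda>u. gram 1 0 u / gram 0 0 u) has_derivative ?Q) (at w)"
  proof -
    have 1: "(gram 1 0 has_derivative (\<lambda>h. cnj h * gram 2 0 w + h * gram 1 1 w)) (at w)"
      using gram_has_derivative[OF w, of 1 0] by (simp add: numeral_2_eq_2)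
    have 2: "(gram 0 0 has_derivative (\<lambda>h. cnj h * gram 1 0 w + h * gram 0 1 w)) (at w)"
      using gram_has_derivative[OF w, of 0 0] by simp
    show ?thesis using has_derivative_divide'[OF 1 2] g00 R by simp
  qed
  then have "(wirtinger_dzbar (\<lambda>w. complex_of_real (ln (bergman_kernel D w))) has_derivative ?Q) (at w)"
    by (rule has_derivative_transform_within_open[OF _ open_D w]) (simp add: wirtinger_dzbar_ln_kernel)
  then have fd: "frechet_derivative (wirtinger_dzbar (\<lambda>w. complex_of_real (ln (bergman_kernel D w)))) (at w) = ?Q"
    by (rule frechet_derivative_at[symmetric])
  \<comment> \<open>\<open>wirtinger_dz\<close> picks out the coefficient of \<open>h\<close>, so
    \<open>gram 2 0\<close>, which multiplies \<open>cnj h\<close>, drops out.\<close>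
  have "wirtinger_dz (wirtinger_dzbar (\<lambda>w. complex_of_real (ln (bergman_kernel D w)))) w =
      (gram 1 1 w * gram 0 0 w - gram 1 0 w * gram 0 1 w) / (gram 0 0 w * gram 0 0 w)"
    unfolding wirtinger_dz_def fd by (simp add: g00 field_simps R less_imp_neq[symmetric] complex_eq_iff)
  also have "\<dots> = of_real (((N (repr 1 w))\<^sup>2 * R - (cmod (gram 1 0 w))\<^sup>2) / R\<^sup>2)"
    unfolding g01 g11 g00 complex_norm_square[symmetric] by (simp add: power2_eq_square)
  finally show ?thesis unfolding bergman_metric_def R_def by simp
qed

text \<open>The function \<open>e\<close> below is the component of the representer of \<open>f \<mapsto> f' w\<close> orthogonal to the
  Bergman kernel at \<open>w\<close>; its norm squared is the numerator of the metric.\<close>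

lemma bergman_metric_le:
  assumes w: "w \<in> D" and M: "\<And>f. f \<in> H \<Longrightarrow> f w = 0 \<Longrightarrow> cmod (deriv f w) \<le> N f * M"
  shows "bergman_metric D w * bergman_kernel D w \<le> M\<^sup>2"
proof -
  define R where "R = bergman_kernel D w"
  have R: "0 < R" unfolding R_def by (rule bergman_kernel_pos[OF w])
  define k k' where "k = repr 0 w" and "k' = repr 1 w"
  have mem: "k \<in> H" "k' \<in> H" using repr(1)[OF w] by (auto simp: k_def k'_def)
  have ev: "ip f k = f w" "ip f k' = deriv f w" if "f \<in> H" for f
    using repr(2)[OF w that, of 0] repr(2)[OF w that, of 1] by (auto simp: k_def k'_def)
  define c where "c = ip k' k / of_real R"
  define e where "e = (\<lambda>z. k' z - c * k z)"
  have ck: "(\<lambda>z. c * k z) \<in> H" by (rule H_scale[OF mem(1)])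
  have e: "e \<in> H" unfolding e_def by (rule H_diff[OF mem(2) ck])
  have kk: "ip k k = of_real R"
    using ip_self[OF mem(1)] by (simp add: R_def bergman_kernel_eq[OF w] k_def)
  have ek: "ip e k = 0"
  proof -
    have "ip e k = ip k' k - c * ip k k" unfolding e_def by (simp add: ip_diff_left mem ck ip_scale_left)
    then show ?thesis using R by (simp add: kk c_def)
  qed
  have ek': "ip e k' = of_real (bergman_metric D w * R)"
  proof -
    have "ip e k' = ip k' k' - c * cnj (ip k' k)"
      unfolding e_def by (simp add: ip_diff_left mem ck ip_scale_left ip_sym[of k k'])
    also have "\<dots> = of_real ((N k')\<^sup>2) - of_real ((cmod (ip k' k))\<^sup>2 / R)"
      by (simp add: c_def ip_self[OF mem(2)] complex_norm_square del: of_real_power)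
    also have "\<dots> = of_real (((N k')\<^sup>2 * R - (cmod (ip k' k))\<^sup>2) / R\<^sup>2 * R)"
      using R by (simp add: field_simps power2_eq_square)
    finally show ?thesis
      unfolding bergman_metric_eq[OF w] R_def[symmetric] by (simp add: gram_def k_def k'_def)
  qed
  have "ip e e = ip e k'"
    by (subst (2) e_def) (simp add: ip_diff_right e mem ck ip_scale_right ek)
  then have sq: "(N e)\<^sup>2 = bergman_metric D w * R"
    unfolding ek' ip_self[OF e] by (simp only: of_real_eq_iff)
  have "cmod (ip e k') \<le> N e * M" using M[OF e] ek ev[OF e] by simp
  then have "(N e)\<^sup>2 \<le> N e * M" unfolding ek' sq[symmetric] by (simp add: norm_power)
  then have "N e \<le> M \<or> N e = 0" using N_nonneg[OF e] by (auto simp: power2_eq_square)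
  then have "(N e)\<^sup>2 \<le> M\<^sup>2" using N_nonneg[OF e] by (auto intro: power_mono)
  then show ?thesis by (simp add: sq R_def)
qed

end

section \<open>Upper bounds on the negative axis\<close>

locale arcs =
  fixes r t :: real and \<alpha> :: "nat \<Rightarrow> real"
  assumes r_pos: "0 < r" and r_less: "r < 1 / 4"
    and t_pos: "0 < t" and t_less: "t < 1 / 2"
    and \<alpha>: "\<And>k. k \<ge> 1 \<Longrightarrow> 0 < \<alpha> k \<and> \<alpha> k < pi / 2 \<and> sin (\<alpha> k) = exp (- (t powi (- int k)))"
begin

section \<open>Geometry of the domain\<close>

abbreviation D :: "complex set" where "D \<equiv> arc_domain r \<alpha>"

text \<open>The logarithm of the ratio of \<open>r ^ k\<close> to the capacity
  \<open>r ^ k * sin (\<alpha> k)\<close>; its reciprocal is the energy scale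
  \<open>t ^ k\<close>.\<close>

definition T :: "nat \<Rightarrow> real" where "T k = (1 / t) ^ k"

lemma sin_\<alpha>: "k \<ge> 1 \<Longrightarrow> sin (\<alpha> k) = exp (- T k)"
  using \<alpha>[of k] by (simp add: T_def power_int_minus power_one_over inverse_eq_divide)

lemma arc_setE:
  assumes "z \<in> arc_set r \<alpha> k"
  obtains \<theta> where "z = of_real (r ^ k) * exp (\<i> * of_real \<theta>)" "\<bar>\<theta>\<bar> \<le> 2 * \<alpha> k"
proof -
  obtain \<theta> where "z = of_real (r ^ k) * exp (\<i> * of_real \<theta>)" "- 2 * \<alpha> k \<le> \<theta>" "\<theta> \<le> 2 * \<alpha> k"
    using assms unfolding arc_set_def by blast
  then show ?thesis by (intro that[of \<theta>]) auto
qed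

lemma norm_arc: "z \<in> arc_set r \<alpha> k \<Longrightarrow> cmod z = r ^ k"
  using r_pos by (auto simp: norm_mult norm_power elim!: arc_setE)

text \<open>The chord from the midpoint to the point at angle \<theta> has length 2 r^k |sin
  (\<theta> / 2)|, and |\<theta>| / 2 is at most \<open>\<alpha> k\<close>: the arc fits into a disc
  of radius twice its capacity.\<close>

lemma arc_near_center:
  assumes k: "k \<ge> 1" and z: "z \<in> arc_set r \<alpha> k"
  shows "cmod (z - of_real (r ^ k)) \<le> 2 * r ^ k * exp (- T k)"
proof -
  obtain \<theta> where \<theta>: "z = of_real (r ^ k) * exp (\<i> * of_real \<theta>)" "\<bar>\<theta>\<bar> \<le> 2 * \<alpha> k"
    using z by (rule arc_setE)
  have "z - of_real (r ^ k) = of_real (r ^ k) * (exp (\<i> * of_real \<theta>) - 1)"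
    by (simp add: \<theta>(1) algebra_simps)
  then have "cmod (z - of_real (r ^ k)) = r ^ k * (2 * \<bar>sin (\<theta> / 2)\<bar>)"
    using r_pos by (simp only: norm_mult dist_exp_i_1) (simp add: norm_power)
  also have "\<bar>sin (\<theta> / 2)\<bar> \<le> sin (\<alpha> k)"
  proof -
    have "\<bar>sin (\<theta> / 2)\<bar> = sin \<bar>\<theta> / 2\<bar>"
      using \<theta>(2) \<alpha>[OF k] sin_ge_zero[of "\<bar>\<theta> / 2\<bar>"] by (cases "\<theta> \<ge> 0") auto
    also have "\<dots> \<le> sin (\<alpha> k)" using \<theta>(2) \<alpha>[OF k] by (intro sin_monotone_2pi_le) auto
    finally show ?thesis .
  qed
  finally show ?thesis using r_pos by (simp add: sin_\<alpha>[OF k] mult.assoc)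
qed

lemma compact_arc: "compact (arc_set r \<alpha> k)"
proof -
  have "arc_set r \<alpha> k = (\<lambda>\<theta>. of_real (r ^ k) * exp (\<i> * of_real \<theta>)) ` {- 2 * \<alpha> k..2 * \<alpha> k}"
    by (auto simp: arc_set_def)
  then show ?thesis by (auto intro!: compact_continuous_image continuous_intros)
qed

lemma D_iff: "z \<in> D \<longleftrightarrow> cmod z < 1 \<and> z \<noteq> 0 \<and> (\<forall>k\<ge>1. z \<notin> arc_set r \<alpha> k)"
  by (auto simp: arc_domain_def arc_union_def)

lemma ex_r_power_less: "\<epsilon> > 0 \<Longrightarrow> \<exists>n. r ^ n < \<epsilon>"
  using r_less by (intro real_arch_pow_inv) auto

text \<open>The arcs accumulate only at 0, so near a point of \<open>D\<close> only finitely many of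
  them have to be avoided, and a finite union of them is closed.\<close>

lemma open_D: "open D"
proof (rule openI)
  fix w assume w: "w \<in> D"
  then obtain n where n: "r ^ n < cmod w / 2" using ex_r_power_less[of "cmod w / 2"] by (auto simp: D_iff)
  define S where "S = {z. cmod z < 1} \<inter> {z. cmod w / 2 < cmod z} - (\<Union>k\<in>{1..n}. arc_set r \<alpha> k)"
  have "open S" unfolding S_def
    by (intro open_Diff open_Int open_Collect_less continuous_intros compact_imp_closed compact_UN compact_arc) auto
  moreover have "w \<in> S" using w by (auto simp: S_def D_iff)
  moreover have "S \<subseteq> D"
  proof
    fix z assume z: "z \<in> S"
    have "z \<notin> arc_set r \<alpha> k" if "k \<ge> 1" for k
    proof
      assume a: "z \<in> arc_set r \<alpha> k"
      have "k > n" using z a that by (force simp: S_def)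
      then have "r ^ k \<le> r ^ n" using r_pos r_less by (intro power_decreasing) auto
      then show False using norm_arc[OF a] z n by (simp add: S_def)
    qed
    then show "z \<in> D" using z by (auto simp: S_def D_iff)
  qed
  ultimately show "\<exists>e>0. ball w e \<subseteq> D" using open_contains_ball_eq[of S] by blast
qed

lemma bounded_D: "bounded D"
  by (rule bounded_subset[OF bounded_ball[of 0 1]]) (auto simp: D_iff)

sublocale bergman_space D
  by unfold_locales (rule open_D bounded_D)+

text \<open>On the circle of radius \<open>r ^ k\<close> the point of the negative axis has distance
  \<open>2 * r ^ k\<close> from \<open>r ^ k\<close>, more than \<open>arc_near_center\<close>
  permits for points of the arc.\<close>

lemma neg_real_in_D:
  assumes "0 < y" "y < 1"
  shows "- of_real y \<in> D"
proof -
  have "- complex_of_real y \<notin> arc_set r \<alpha> k" if k: "k \<ge> 1" for k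
  proof
    assume "- complex_of_real y \<in> arc_set r \<alpha> k"
    then have le: "cmod (- complex_of_real y - of_real (r ^ k)) \<le> 2 * r ^ k * exp (- T k)"
      and y: "cmod (- complex_of_real y) = r ^ k"
      using arc_near_center[OF k] norm_arc by blast+
    have "T k > 0" using t_pos by (simp add: T_def)
    then have "2 * r ^ k * exp (- T k) < 2 * r ^ k * 1" using r_pos by (intro mult_strict_left_mono) auto
    moreover have "cmod (- complex_of_real y - of_real (r ^ k)) = y + r ^ k"
    proof -
      have "- complex_of_real y - of_real (r ^ k) = - of_real (y + r ^ k)" by simp
      then show ?thesis using assms r_pos by (simp only: norm_minus_cancel norm_of_real) simp
    qed
    ultimately show False using le y assms by simp
  qed
  then show ?thesis using assms by (auto simp: D_iff)
qed

lemma zero_frontier: "0 \<in> frontier D"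
proof -
  have "(\<lambda>n. - complex_of_real (1 / real (n + 2))) \<longlonglongrightarrow> - of_real 0"
    by (intro tendsto_intros) real_asymp
  then have "(\<lambda>n. - complex_of_real (1 / real (n + 2))) \<longlonglongrightarrow> 0" by (simp only: of_real_0 minus_zero)
  moreover have "\<forall>n. - complex_of_real (1 / real (n + 2)) \<in> D" by (intro allI neg_real_in_D) auto
  ultimately have "0 \<in> closure D"
    unfolding closure_sequential by (intro exI[of _ "\<lambda>n. - complex_of_real (1 / real (n + 2))"] conjI)
  then show ?thesis using interior_subset[of D] by (auto simp: frontier_def D_iff)
qed

section \<open>Cutoffs around the arcs\<close>

lemma ln_128: "ln (128 :: real) \<le> 7"
proof -
  have "ln (128 :: real) = 7 * ln 2" using ln_realpow[of 2 7] by simp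
  then show ?thesis using ln_2_less_1 by simp
qed

lemma T_ge:
  assumes "t < 1 / 16" "k \<ge> 1"
  shows "16 \<le> T k"
proof -
  have "16 \<le> (1 / t) ^ 1" using assms t_pos by (simp add: field_simps)
  also have "\<dots> \<le> (1 / t) ^ k" using assms t_pos by (intro power_increasing) auto
  finally show ?thesis by (simp add: T_def)
qed

lemma inv_sqrt_T: "1 / sqrt (T k) = sqrt t ^ k"
  using t_pos by (simp add: T_def real_sqrt_power real_sqrt_divide power_one_over)

text \<open>The inner radius is twice the bound of \<open>arc_near_center\<close>, so the cutoff
  vanishes on a neighbourhood of the arc. It leads to L = 2 T - ln 128, which is at least T because
  T is at least 16. The outer radius r^k / 2 keeps the gradient at distance at least r^k / 2 + y
  from a point -y of the negative axis.\<close>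

lemma arc_cutoff:
  assumes t: "t < 1 / 16" and k: "k \<ge> 1"
  obtains \<eta> G where "cutoff \<eta> G (46 * sqrt t ^ k)"
    "\<And>z. cmod (z - of_real (r ^ k)) \<le> 4 * r ^ k * exp (- T k) \<Longrightarrow> \<eta> z = 0"
    "\<And>z. r ^ k / 2 \<le> cmod (z - of_real (r ^ k)) \<Longrightarrow> \<eta> z = 1"
    "\<And>z. G z \<noteq> 0 \<Longrightarrow> cmod (z - of_real (r ^ k)) < r ^ k / 2"
proof -
  define a where "a = 4 * r ^ k * exp (- T k)"
  have a: "a > 0" and b: "r ^ k / 2 > 0" using r_pos by (auto simp: a_def)
  have T16: "16 \<le> T k" by (rule T_ge[OF t k])
  have "(r ^ k / 2)\<^sup>2 / (2 * a\<^sup>2) = exp (T k) ^ 2 / 128"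
    using r_pos by (simp add: a_def power2_eq_square exp_minus field_simps)
  also have "\<dots> = exp (2 * T k) / 128" by (simp add: exp_double)
  finally have e: "(r ^ k / 2)\<^sup>2 / (2 * a\<^sup>2) = exp (2 * T k) / 128" .
  have L: "ln ((r ^ k / 2)\<^sup>2 / (2 * a\<^sup>2)) = 2 * T k - ln 128" unfolding e by (simp add: ln_div)
  have LT: "T k \<le> 2 * T k - ln 128" "1 \<le> 2 * T k - ln 128" using T16 ln_128 by linarith+
  obtain \<eta> G where \<eta>: "cutoff \<eta> G (46 / sqrt (2 * T k - ln 128))"
    "\<And>z. cmod (z - of_real (r ^ k)) \<le> a \<Longrightarrow> \<eta> z = 0" "\<And>z. r ^ k / 2 \<le> cmod (z - of_real (r ^ k)) \<Longrightarrow> \<eta> z = 1"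
    "\<And>z. G z \<noteq> 0 \<Longrightarrow> a < cmod (z - of_real (r ^ k)) \<and> cmod (z - of_real (r ^ k)) < r ^ k / 2"
    using log_cutoff[OF a b, of "of_real (r ^ k)", unfolded L, OF LT(2)] by blast
  have "46 / sqrt (2 * T k - ln 128) \<le> 46 / sqrt (T k)"
    using LT T16 by (intro divide_left_mono mult_pos_pos) auto
  also have "\<dots> = 46 * sqrt t ^ k" using inv_sqrt_T[of k] by simp
  finally have "cutoff \<eta> G (46 * sqrt t ^ k)" by (rule cutoff_mono[OF \<eta>(1)])
  then show ?thesis by (rule that) (use \<eta>(2-4) in \<open>auto simp: a_def\<close>)
qed

text \<open>The cutoffs vanish near \<open>0\<close>, near the arcs outside the neighbourhood of \<open>0\<close>, and near
  the unit circle. The logarithmic profile makes the Dirichlet energy of the \<open>j\<close>-th one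
  comparable to \<open>t\<^sup>j\<close>, the reciprocal of the logarithm of the capacity of the arc.\<close>

lemma negative_axis_bounds:
  assumes t: "t < 1 / 16" and y: "0 < y" "y < 1 / 8" and \<Lambda>: "1 \<le> \<Lambda>" and f: "f \<in> H"
  shows "\<exists>n. cmod (f (- of_real y)) \<le>
      N f * (46 / sqrt \<Lambda> / (y / 2) + 46 / (1 / 8) + (\<Sum>j=1..n. 46 * sqrt t ^ j / (r ^ j / 2 + y)))"
    "f (- of_real y) = 0 \<Longrightarrow> \<exists>n. cmod (deriv f (- of_real y)) \<le>
      N f * (46 / sqrt \<Lambda> / (y / 2)\<^sup>2 + 46 / (1 / 8)\<^sup>2 + (\<Sum>j=1..n. 46 * sqrt t ^ j / (r ^ j / 2 + y)\<^sup>2))"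
proof -
  define x where "x = - complex_of_real y"
  have low: "y - cmod z \<le> cmod (z - x)" "cmod z - y \<le> cmod (z - x)" for z
    using norm_diff_ineq[of "of_real y" z] norm_diff_ineq[of z "of_real y"] y
    by (auto simp: x_def add.commute)
  have far: "r ^ j + y \<le> cmod (z - x) + cmod (z - of_real (r ^ j))" for j z
  proof -
    have "r ^ j + y = cmod (of_real (r ^ j) + complex_of_real y)"
      using r_pos y by (simp only: of_real_add[symmetric] norm_of_real) simp
    also have "of_real (r ^ j) + complex_of_real y = (z - x) - (z - of_real (r ^ j))" by (simp add: x_def)
    finally show ?thesis by (simp only: norm_triangle_ineq4)
  qed
  define b where "b = y / 2"
  \<comment> \<open>Chosen so that the logarithm of the cutoff at 0 equals \<Lambda>. A point has
    capacity zero, so this energy can be made as small as desired by letting \<Lambda> depend on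
    \<open>y\<close>.\<close>
  define a where "a = b / (sqrt 2 * exp (\<Lambda> / 2))"
  have b: "b > 0" and a: "a > 0" using y by (auto simp: a_def b_def)
  have "b\<^sup>2 / (2 * a\<^sup>2) = exp (\<Lambda> / 2) ^ 2"
    using b by (simp add: a_def power_divide power_mult_distrib)
  also have "\<dots> = exp \<Lambda>" by (simp add: exp_double[symmetric])
  finally have La: "ln (b\<^sup>2 / (2 * a\<^sup>2)) = \<Lambda>" by simp
  obtain \<eta>0 G0 where inner: "cutoff \<eta>0 G0 (46 / sqrt \<Lambda>)"
    "\<And>z. cmod (z - 0) \<le> a \<Longrightarrow> \<eta>0 z = 0" "\<And>z. b \<le> cmod (z - 0) \<Longrightarrow> \<eta>0 z = 1"
    "\<And>z. G0 z \<noteq> 0 \<Longrightarrow> a < cmod (z - 0) \<and> cmod (z - 0) < b"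
    using log_cutoff[OF a b, of 0, unfolded La, OF \<Lambda>] by blast
  \<comment> \<open>The cutoff near the unit circle is 1 up to radius 3/10, so its gradient stays at
    distance more than 1/8 from \<open>x\<close> because \<open>y < 1 / 8\<close>.\<close>
  have h9: "0 < (9 / 10 :: real)" by simp
  obtain \<eta>1 G1 where outer: "cutoff \<eta>1 G1 46"
    "\<And>z. cmod (z - 0) \<le> (9 / 10) / 3 \<Longrightarrow> \<eta>1 z = 1" "\<And>z. 9 / 10 \<le> cmod (z - 0) \<Longrightarrow> \<eta>1 z = 0"
    "\<And>z. G1 z \<noteq> 0 \<Longrightarrow> (9 / 10) / 3 < cmod (z - 0) \<and> cmod (z - 0) < 9 / 10"
    using outer_cutoff[OF h9, of 0] by blast
  define ak where "ak k = 4 * r ^ k * exp (- T k)" for k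
  have "\<forall>k. \<exists>p. k \<ge> 1 \<longrightarrow> cutoff (fst p) (snd p) (46 * sqrt t ^ k) \<and>
    (\<forall>z. cmod (z - of_real (r ^ k)) \<le> ak k \<longrightarrow> fst p z = 0) \<and>
    (\<forall>z. r ^ k / 2 \<le> cmod (z - of_real (r ^ k)) \<longrightarrow> fst p z = 1) \<and>
    (\<forall>z. snd p z \<noteq> 0 \<longrightarrow> cmod (z - of_real (r ^ k)) < r ^ k / 2)" (is "\<forall>k. \<exists>p. ?P k p")
  proof
    fix k show "\<exists>p. ?P k p"
    proof (cases "k \<ge> 1")
      case True
      obtain \<eta> G where "cutoff \<eta> G (46 * sqrt t ^ k)"
        "\<And>z. cmod (z - of_real (r ^ k)) \<le> ak k \<Longrightarrow> \<eta> z = 0"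
        "\<And>z. r ^ k / 2 \<le> cmod (z - of_real (r ^ k)) \<Longrightarrow> \<eta> z = 1"
        "\<And>z. G z \<noteq> 0 \<Longrightarrow> cmod (z - of_real (r ^ k)) < r ^ k / 2"
        unfolding ak_def using arc_cutoff[OF t True] by blast
      then show ?thesis by (intro exI[of _ "(\<eta>, G)"]) simp
    qed simp
  qed
  then obtain p where "\<forall>k. ?P k (p k)" by (rule choice[THEN exE])
  then have arc: "cutoff (fst (p k)) (snd (p k)) (46 * sqrt t ^ k)"
    "cmod (z - of_real (r ^ k)) \<le> ak k \<Longrightarrow> fst (p k) z = 0"
    "r ^ k / 2 \<le> cmod (z - of_real (r ^ k)) \<Longrightarrow> fst (p k) z = 1"
    "snd (p k) z \<noteq> 0 \<Longrightarrow> cmod (z - of_real (r ^ k)) < r ^ k / 2" if "k \<ge> 1" for k z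
    using that by blast+
  \<comment> \<open>All arcs beyond the n-th lie in the disc where the cutoff at 0 vanishes, so
    finitely many factors suffice. Below, index 0 is the cutoff at 0 and index \<open>Suc n\<close>
    the one at the unit circle.\<close>
  obtain n where n: "r ^ n < a" using ex_r_power_less[OF a] by blast
  define \<eta> where "\<eta> j = (if j = 0 then \<eta>0 else if j = Suc n then \<eta>1 else fst (p j))" for j
  define G where "G j = (if j = 0 then G0 else if j = Suc n then G1 else snd (p j))" for j
  define E where "E j = (if j = 0 then 46 / sqrt \<Lambda> else if j = Suc n then 46 else 46 * sqrt t ^ j)" for j
  define d where "d j = (if j = 0 then y / 2 else if j = Suc n then 1 / 8 else r ^ j / 2 + y)" for j
  define K where "K = {z. cmod z \<le> 9 / 10} \<inter> {z. a \<le> cmod z} \<inter> (\<Inter>k\<in>{1..n}. {z. ak k \<le> cmod (z - of_real (r ^ k))})"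
  have "closed K" unfolding K_def
    by (intro closed_Int closed_INT ballI closed_Collect_le continuous_intros)
  moreover have "bounded K" by (rule bounded_subset[OF bounded_cball[of 0 "9 / 10"]]) (auto simp: K_def)
  ultimately have cK: "compact K" by (simp add: compact_eq_bounded_closed)
  have KD: "K \<subseteq> D"
  proof
    fix z assume z: "z \<in> K"
    have "z \<notin> arc_set r \<alpha> k" if k: "k \<ge> 1" for k
    proof
      assume za: "z \<in> arc_set r \<alpha> k"
      show False
      proof (cases "k \<le> n")
        case True
        then have "ak k \<le> cmod (z - of_real (r ^ k))" using z k by (auto simp: K_def)
        also have "\<dots> \<le> 2 * r ^ k * exp (- T k)" by (rule arc_near_center[OF k za])
        also have "\<dots> < ak k" using r_pos by (simp add: ak_def)
        finally show False by simp
      next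
        case False
        then have "r ^ k \<le> r ^ n" using r_pos r_less by (intro power_decreasing) auto
        then show False using norm_arc[OF za] z n by (simp add: K_def)
      qed
    qed
    then show "z \<in> D" using z a by (auto simp: K_def D_iff)
  qed
  interpret cutoff_family D x "{0..Suc n}" \<eta> G E d K "y / 2"
  proof
    show "open D" by (rule open_D)
    show "x \<in> D" unfolding x_def using y by (intro neg_real_in_D) auto
    show "finite {0..Suc n}" by simp
    show "compact K" "K \<subseteq> D" by (rule cK KD)+
    show "0 < y / 2" using y by simp
    show "cutoff (\<eta> j) (G j) (E j)" if "j \<in> {0..Suc n}" for j
      using inner(1) outer(1) arc(1) by (auto simp: \<eta>_def G_def E_def)
    show "0 < d j" if "j \<in> {0..Suc n}" for j
      using y r_pos by (auto simp: d_def intro: add_pos_pos)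
    show "d j \<le> cmod (z - x)" if "j \<in> {0..Suc n}" "G j z \<noteq> 0" for j z
    proof -
      consider "j = 0" | "j = Suc n" | "j \<noteq> 0" "j \<noteq> Suc n" by blast
      then show ?thesis
      proof cases
        case 1
        then show ?thesis using that inner(4)[of z] low[of z] by (simp add: G_def d_def b_def)
      next
        case 2
        then show ?thesis using that outer(4)[of z] low[of z] y by (simp add: G_def d_def)
      next
        case 3
        then show ?thesis using that arc(4)[of j z] far[of j z] by (simp add: G_def d_def)
      qed
    qed
    show "\<exists>j\<in>{0..Suc n}. \<eta> j z = 0" if zK: "z \<notin> K" for z
    proof -
      have K: "z \<in> K" if "\<not> 9 / 10 \<le> cmod z" "\<not> cmod z \<le> a"
        "\<And>k. k \<in> {1..n} \<Longrightarrow> \<not> cmod (z - of_real (r ^ k)) \<le> ak k"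
        unfolding K_def using that by (simp add: not_le less_imp_le)
      consider "9 / 10 \<le> cmod z" | "cmod z \<le> a" | k where "k \<in> {1..n}" "cmod (z - of_real (r ^ k)) \<le> ak k"
        using zK K by blast
      then show ?thesis
      proof cases
        case 1
        then show ?thesis using outer(3)[of z] by (intro bexI[of _ "Suc n"]) (auto simp: \<eta>_def)
      next
        case 2
        then show ?thesis using inner(2)[of z] by (intro bexI[of _ 0]) (auto simp: \<eta>_def)
      next
        case 3
        then show ?thesis using arc(2)[of k z] by (intro bexI[of _ k]) (auto simp: \<eta>_def)
      qed
    qed
    show "\<eta> j z = 1" if "j \<in> {0..Suc n}" "cmod (z - x) < y / 2" for j z
    proof -
      consider "j = 0" | "j = Suc n" | "j \<noteq> 0" "j \<noteq> Suc n" by blast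
      then show ?thesis
      proof cases
        case 1
        then show ?thesis using low[of z] that inner(3)[of z] by (simp add: \<eta>_def b_def)
      next
        case 2
        then show ?thesis using low[of z] that y outer(2)[of z] by (simp add: \<eta>_def)
      next
        case 3
        have "r ^ j > 0" using r_pos by simp
        then have "r ^ j / 2 \<le> cmod (z - of_real (r ^ j))" using that y far[of j z] by linarith
        then show ?thesis using 3 arc(3)[of j z] by (simp add: \<eta>_def)
      qed
    qed
  qed
  have split: "{0..Suc n} = insert 0 (insert (Suc n) {1..n})" by auto
  have sums: "(\<Sum>j=0..Suc n. E j / d j ^ m) =
      46 / sqrt \<Lambda> / (y / 2) ^ m + 46 / (1 / 8) ^ m + (\<Sum>j=1..n. 46 * sqrt t ^ j / (r ^ j / 2 + y) ^ m)" for m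
    unfolding split by (simp add: E_def d_def)
  show "\<exists>n. cmod (f (- of_real y)) \<le>
      N f * (46 / sqrt \<Lambda> / (y / 2) + 46 / (1 / 8) + (\<Sum>j=1..n. 46 * sqrt t ^ j / (r ^ j / 2 + y)))"
    using eval_bound[OF f] sums[of 1] unfolding x_def by (intro exI[of _ n]) simp
  show "\<exists>n. cmod (deriv f (- of_real y)) \<le>
      N f * (46 / sqrt \<Lambda> / (y / 2)\<^sup>2 + 46 / (1 / 8)\<^sup>2 + (\<Sum>j=1..n. 46 * sqrt t ^ j / (r ^ j / 2 + y)\<^sup>2))"
    if "f (- of_real y) = 0"
    using deriv_bound[OF f] that sums[of 2] unfolding x_def by (intro exI[of _ n]) simp
qed

section \<open>Summing the contributions of the arcs\<close>

lemma geometric_le: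
  fixes q :: real
  assumes "0 \<le> q" "q < 1"
  shows "(\<Sum>j=1..n. q ^ j) \<le> 1 / (1 - q)"
proof -
  have "(\<Sum>j=1..n. q ^ j) \<le> (\<Sum>j. q ^ j)"
    using assms by (intro sum_le_suminf summable_geometric) auto
  then show ?thesis using assms by (simp add: suminf_geometric)
qed

text \<open>The bound is uniform in \<open>y\<close>: as sqrt t / r is below 1, the arcs contribute
  a geometric series even after \<open>y\<close> is dropped from the denominators.\<close>

lemma eval_bound_negative_axis:
  assumes t: "t < r\<^sup>2" and y: "0 < y" "y < 1 / 8" and f: "f \<in> H"
  shows "cmod (f (- of_real y)) \<le> N f * (369 + 92 / (1 - sqrt t / r))"
proof -
  have r2: "r\<^sup>2 < (1 / 4)\<^sup>2" using r_pos r_less by (intro power_strict_mono) auto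
  then have t16: "t < 1 / 16" using t by (simp add: power2_eq_square)
  have "sqrt t < sqrt (r\<^sup>2)" using t by (rule real_sqrt_less_mono)
  then have q: "0 \<le> sqrt t / r" "sqrt t / r < 1" using r_pos t_pos by auto
  \<comment> \<open>Makes the contribution 92 / (y sqrt \<Lambda>) of the cutoff at 0 at most 1. The
    other constants are 368 = 46 * 8 from the unit circle and 92 = 46 * 2 from the arcs.\<close>
  define \<Lambda> where "\<Lambda> = max 1 ((92 / y)\<^sup>2)"
  have \<Lambda>: "1 \<le> \<Lambda>" by (simp add: \<Lambda>_def)
  obtain n where le: "cmod (f (- of_real y)) \<le> N f * (46 / sqrt \<Lambda> / (y / 2) + 46 / (1 / 8) +
      (\<Sum>j=1..n. 46 * sqrt t ^ j / (r ^ j / 2 + y)))"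
    using negative_axis_bounds(1)[OF t16 y \<Lambda> f] by (elim exE)
  have "46 / sqrt \<Lambda> / (y / 2) + 46 / (1 / 8) + (\<Sum>j=1..n. 46 * sqrt t ^ j / (r ^ j / 2 + y))
      \<le> 1 + 368 + 92 / (1 - sqrt t / r)"
  proof (intro add_mono)
    have "92 / y \<le> sqrt \<Lambda>" using y by (intro real_le_rsqrt) (simp add: \<Lambda>_def)
    then show "46 / sqrt \<Lambda> / (y / 2) \<le> 1" using y \<Lambda> by (simp add: field_simps)
    have "46 * sqrt t ^ j / (r ^ j / 2 + y) \<le> 92 * (sqrt t / r) ^ j" for j
    proof -
      have "46 * sqrt t ^ j / (r ^ j / 2 + y) \<le> 46 * sqrt t ^ j / (r ^ j / 2)"
        using r_pos y t_pos by (intro divide_left_mono) (auto intro!: mult_pos_pos add_pos_pos)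
      also have "\<dots> = 92 * (sqrt t / r) ^ j" by (simp add: power_divide)
      finally show ?thesis .
    qed
    then have "(\<Sum>j=1..n. 46 * sqrt t ^ j / (r ^ j / 2 + y)) \<le> (\<Sum>j=1..n. 92 * (sqrt t / r) ^ j)"
      by (rule sum_mono)
    also have "\<dots> \<le> 92 * (1 / (1 - sqrt t / r))"
      unfolding sum_distrib_left[symmetric] by (intro mult_left_mono geometric_le q) auto
    finally show "(\<Sum>j=1..n. 46 * sqrt t ^ j / (r ^ j / 2 + y)) \<le> 92 / (1 - sqrt t / r)" by simp
  qed auto
  then have "N f * (46 / sqrt \<Lambda> / (y / 2) + 46 / (1 / 8) +
      (\<Sum>j=1..n. 46 * sqrt t ^ j / (r ^ j / 2 + y))) \<le> N f * (369 + 92 / (1 - sqrt t / r))"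
    using N_nonneg[OF f] by (intro mult_left_mono) auto
  with le show ?thesis by (rule order_trans)
qed

text \<open>As sqrt t is at most r^2, the j-th term is at most 46 (u / (u / 2 + y))^2 with u = r^j.
  This is of constant size for the roughly log (1 / y) arcs with u > y. The weaker estimate 4 sqrt
  (u / y) for the squared quotient makes the sum geometric with ratio sqrt r, at most 1/2, and the
  resulting growth 1 / sqrt y is still integrable.\<close>

lemma deriv_bound_negative_axis:
  assumes t: "t \<le> r ^ 4" and y: "0 < y" "y < 1 / 8" and f: "f \<in> H" and f0: "f (- of_real y) = 0"
  shows "cmod (deriv f (- of_real y)) \<le> N f * (3313 / sqrt y)"
proof -
  have r4: "r ^ 4 < (1 / 4) ^ 4" using r_pos r_less by (intro power_strict_mono) auto
  then have t16: "t < 1 / 16" using t by (simp add: power_def)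
  have "t \<le> (r\<^sup>2)\<^sup>2" using t by (simp add: power_mult[symmetric])
  then have st: "sqrt t \<le> r\<^sup>2" by (intro real_le_lsqrt) auto
  have sr: "0 \<le> sqrt r" "sqrt r \<le> 1 / 2"
    using r_pos r_less real_sqrt_le_mono[of r "1 / 4"] by (auto simp: real_sqrt_divide)
  \<comment> \<open>Makes the contribution 184 / (y^2 sqrt \<Lambda>) of the cutoff at 0 at most
    1.\<close>
  define \<Lambda> where "\<Lambda> = max 1 ((184 / y\<^sup>2)\<^sup>2)"
  have \<Lambda>: "1 \<le> \<Lambda>" by (simp add: \<Lambda>_def)
  obtain n where le: "cmod (deriv f (- of_real y)) \<le> N f * (46 / sqrt \<Lambda> / (y / 2)\<^sup>2 + 46 / (1 / 8)\<^sup>2 +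
      (\<Sum>j=1..n. 46 * sqrt t ^ j / (r ^ j / 2 + y)\<^sup>2))"
    using negative_axis_bounds(2)[OF t16 y \<Lambda> f f0] by (elim exE)
  have "46 / sqrt \<Lambda> / (y / 2)\<^sup>2 + 46 / (1 / 8)\<^sup>2 + (\<Sum>j=1..n. 46 * sqrt t ^ j / (r ^ j / 2 + y)\<^sup>2)
      \<le> 1 + 2944 + 368 / sqrt y"
  proof (intro add_mono)
    have "184 / y\<^sup>2 \<le> sqrt \<Lambda>" using y by (intro real_le_rsqrt) (simp add: \<Lambda>_def)
    then show "46 / sqrt \<Lambda> / (y / 2)\<^sup>2 \<le> 1" using y \<Lambda> by (simp add: field_simps power2_eq_square)
    show "46 / (1 / 8)\<^sup>2 \<le> (2944 :: real)" by (simp add: power2_eq_square)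
    have "46 * sqrt t ^ j / (r ^ j / 2 + y)\<^sup>2 \<le> 184 / sqrt y * sqrt r ^ j" for j
    proof -
      define u where "u = r ^ j"
      have u: "u > 0" using r_pos by (simp add: u_def)
      have "sqrt t ^ j \<le> (r\<^sup>2) ^ j" using st t_pos by (intro power_mono) auto
      then have tu: "sqrt t ^ j \<le> u\<^sup>2" by (simp add: u_def power_mult[symmetric] mult.commute)
      have "u\<^sup>2 / (u / 2 + y)\<^sup>2 \<le> 4 * sqrt (u / y)"
      proof (cases "u \<le> y")
        case True
        have "u\<^sup>2 / (u / 2 + y)\<^sup>2 \<le> u\<^sup>2 / y\<^sup>2"
          using u y by (intro divide_left_mono power_mono) auto
        also have "\<dots> = (u / y)\<^sup>2" by (simp add: power_divide)
        also have "\<dots> \<le> sqrt (u / y)"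
        proof -
          have uy: "0 \<le> u / y" "u / y \<le> 1" using u y True by auto
          then have p2: "(u / y)\<^sup>2 \<le> u / y" using power_decreasing[of 1 2 "u / y"] by simp
          also have "u / y \<le> sqrt (u / y)" using p2 by (rule real_le_rsqrt)
          finally show ?thesis .
        qed
        also have "\<dots> \<le> 4 * sqrt (u / y)" using u y by simp
        finally show ?thesis .
      next
        case False
        have "u\<^sup>2 / (u / 2 + y)\<^sup>2 \<le> u\<^sup>2 / (u / 2)\<^sup>2"
          using u y by (intro divide_left_mono power_mono) auto
        also have "\<dots> = 4" using u by (simp add: power_divide)
        also have "\<dots> \<le> 4 * sqrt (u / y)" using u y False by simp
        finally show ?thesis .
      qed
      moreover have "46 * sqrt t ^ j / (u / 2 + y)\<^sup>2 \<le> 46 * u\<^sup>2 / (u / 2 + y)\<^sup>2"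
        using tu by (intro divide_right_mono) auto
      ultimately have "46 * sqrt t ^ j / (u / 2 + y)\<^sup>2 \<le> 46 * (4 * sqrt (u / y))" by simp
      then show ?thesis by (simp add: u_def real_sqrt_divide real_sqrt_power)
    qed
    then have "(\<Sum>j=1..n. 46 * sqrt t ^ j / (r ^ j / 2 + y)\<^sup>2) \<le> (\<Sum>j=1..n. 184 / sqrt y * sqrt r ^ j)"
      by (rule sum_mono)
    also have "\<dots> \<le> 184 / sqrt y * 2"
      unfolding sum_distrib_left[symmetric]
    proof (intro mult_left_mono)
      have "(\<Sum>j=1..n. sqrt r ^ j) \<le> 1 / (1 - sqrt r)" using sr by (intro geometric_le) linarith+
      also have "\<dots> \<le> 1 / (1 / 2)" using sr by (intro divide_left_mono mult_pos_pos) linarith+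
      finally show "(\<Sum>j=1..n. sqrt r ^ j) \<le> 2" by simp
    qed (use y in auto)
    finally show "(\<Sum>j=1..n. 46 * sqrt t ^ j / (r ^ j / 2 + y)\<^sup>2) \<le> 368 / sqrt y" by simp
  qed
  \<comment> \<open>3313 = 1 + 2944 + 368, since 1 is at most 1 / sqrt y.\<close>
  also have "\<dots> \<le> 3313 / sqrt y"
  proof -
    have "sqrt y \<le> 1" "sqrt y > 0" using y by auto
    then show ?thesis by (simp add: field_simps)
  qed
  finally have "N f * (46 / sqrt \<Lambda> / (y / 2)\<^sup>2 + 46 / (1 / 8)\<^sup>2 +
      (\<Sum>j=1..n. 46 * sqrt t ^ j / (r ^ j / 2 + y)\<^sup>2)) \<le> N f * (3313 / sqrt y)"
    using N_nonneg[OF f] by (intro mult_left_mono) auto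
  with le show ?thesis by (rule order_trans)
qed

section \<open>Failure of exhaustiveness and of completeness\<close>

lemma not_exhaustive:
  assumes t: "t < r\<^sup>2"
  shows "\<not> bergman_exhaustive D"
proof
  assume "bergman_exhaustive D"
  then have lim: "filterlim (bergman_kernel D) at_top (at 0 within D)"
    using zero_frontier by (simp add: bergman_exhaustive_def bergman_exhaustive_at_def)
  define M where "M = 369 + 92 / (1 - sqrt t / r)"
  \<comment> \<open>The shift by 9 keeps the points between -1/8 and 0, where the evaluation bound
    holds.\<close>
  define x where "x n = - complex_of_real (1 / real (n + 9))" for n
  have xD: "x n \<in> D" for n unfolding x_def by (rule neg_real_in_D) auto
  have "x \<longlonglongrightarrow> - of_real 0" unfolding x_def by (intro tendsto_intros) real_asymp
  moreover have "x n \<noteq> 0" for n unfolding x_def neg_equal_0_iff_equal of_real_eq_0_iff by simp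
  ultimately have "filterlim x (at 0 within D) sequentially"
    using xD by (simp add: filterlim_at)
  then have "filterlim (\<lambda>n. bergman_kernel D (x n)) at_top sequentially"
    by (rule filterlim_compose[OF lim])
  then have "\<forall>\<^sub>F n in sequentially. M\<^sup>2 + 1 \<le> bergman_kernel D (x n)"
    by (simp add: filterlim_at_top)
  then obtain n where "M\<^sup>2 + 1 \<le> bergman_kernel D (x n)" by (meson eventually_sequentially order_refl)
  moreover have "bergman_kernel D (x n) \<le> M\<^sup>2"
  proof (rule bergman_kernel_le[OF xD])
    fix f assume f: "f \<in> H"
    show "cmod (f (x n)) \<le> N f * M"
      unfolding x_def M_def by (rule eval_bound_negative_axis[OF t _ _ f]) auto
  qed
  ultimately show False by simp
qed

text \<open>\<open>bergman_metric_le\<close> controls the product of metric and kernel. Constants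
  lie in \<open>H\<close> because \<open>D\<close> is bounded, and they bound the kernel below by 1
  / A, which leaves a bound for the metric alone.\<close>

lemma metric_negative_axis:
  assumes t: "t \<le> r ^ 4"
  obtains C where "0 \<le> C" "\<And>y. 0 < y \<Longrightarrow> y < 1 / 8 \<Longrightarrow> sqrt (bergman_metric D (- of_real y)) \<le> C / sqrt y"
proof -
  define A where "A = (N (\<lambda>z. 1))\<^sup>2"
  have A: "0 \<le> A" by (simp add: A_def)
  have "sqrt (bergman_metric D (- of_real y)) \<le> 3313 * sqrt A / sqrt y" if y: "0 < y" "y < 1 / 8" for y
  proof -
    define x where "x = - complex_of_real y"
    have xD: "x \<in> D" unfolding x_def using y by (intro neg_real_in_D) auto
    have K: "0 < bergman_kernel D x" by (rule bergman_kernel_pos[OF xD])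
    have KA: "1 \<le> bergman_kernel D x * A" using bergman_kernel_ge[OF xD H_const[of 1]] by (simp add: A_def)
    have "bergman_metric D x * bergman_kernel D x \<le> (3313 / sqrt y)\<^sup>2"
      by (rule bergman_metric_le[OF xD]) (use deriv_bound_negative_axis[OF t y] in \<open>auto simp: x_def\<close>)
    then have le: "bergman_metric D x * bergman_kernel D x * A \<le> (3313 / sqrt y)\<^sup>2 * A"
      using A by (intro mult_right_mono)
    have "bergman_metric D x \<le> (3313 / sqrt y)\<^sup>2 * A"
    proof (cases "bergman_metric D x \<le> 0")
      case True
      then show ?thesis using A by (meson order_trans mult_nonneg_nonneg zero_le_power2)
    next
      case False
      then have "bergman_metric D x * 1 \<le> bergman_metric D x * (bergman_kernel D x * A)"
        using KA by (intro mult_left_mono) auto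
      then show ?thesis using le by (simp add: mult.assoc)
    qed
    then have "sqrt (bergman_metric D x) \<le> sqrt ((3313 / sqrt y)\<^sup>2 * A)" by (rule real_sqrt_le_mono)
    also have "\<dots> = 3313 * sqrt A / sqrt y" using y by (simp add: real_sqrt_mult)
    finally show ?thesis by (simp add: x_def)
  qed
  then show ?thesis using that[of "3313 * sqrt A"] A by auto
qed

text \<open>Along the parametrisation \<open>- u\<^sup>2\<close> of the negative axis the length element
  \<open>C / \<surd>y \<bar>dy\<bar>\<close> becomes constant.\<close>

lemma dist_negative_axis:
  assumes C: "0 \<le> C" "\<And>y. 0 < y \<Longrightarrow> y < 1 / 8 \<Longrightarrow> sqrt (bergman_metric D (- of_real y)) \<le> C / sqrt y"
    and a: "0 < a" "a \<le> 1 / 3" and b: "0 < b" "b \<le> 1 / 3"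
  shows "bergman_dist D (- of_real (a\<^sup>2)) (- of_real (b\<^sup>2)) \<le> ennreal (2 * C * \<bar>b - a\<bar>)"
proof -
  define p where "p s = (1 - s) * a + s * b" for s
  define \<gamma> where "\<gamma> s = - complex_of_real ((p s)\<^sup>2)" for s
  have p: "0 < p s" "p s \<le> 1 / 3" if "s \<in> {0..1}" for s
  proof -
    show "p s \<le> 1 / 3" unfolding p_def using that a b by (intro convex_bound_le) auto
    show "0 < p s"
    proof (cases "s = 0")
      case False
      then have "0 < s * b" "0 \<le> (1 - s) * a" using that a b by auto
      then show ?thesis unfolding p_def by linarith
    qed (use a in \<open>simp add: p_def\<close>)
  qed
  have p8: "0 < (p s)\<^sup>2" "(p s)\<^sup>2 < 1 / 8" if "s \<in> {0..1}" for s
  proof -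
    have "(p s)\<^sup>2 \<le> (1 / 3)\<^sup>2" using p[OF that] by (intro power_mono) auto
    also have "\<dots> < (1 / 8 :: real)" by (simp add: power2_eq_square)
    finally show "(p s)\<^sup>2 < 1 / 8" .
    show "0 < (p s)\<^sup>2" using p[OF that] by simp
  qed
  have "(p has_real_derivative (b - a)) (at s)" for s
    unfolding p_def[abs_def] by (auto intro!: derivative_eq_intros)
  then have "((\<lambda>s. (p s)\<^sup>2) has_real_derivative 2 * p s * (b - a)) (at s)" for s
    by (auto intro!: derivative_eq_intros)
  then have "((\<lambda>s. complex_of_real ((p s)\<^sup>2)) has_vector_derivative of_real (2 * p s * (b - a))) (at s)" for s
    by (intro has_vector_derivative_of_real) (simp add: has_real_derivative_iff_has_vector_derivative)
  then have d\<gamma>: "(\<gamma> has_vector_derivative - of_real (2 * p s * (b - a))) (at s)" for s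
    unfolding \<gamma>_def[abs_def] by (rule has_vector_derivative_minus)
  have "continuous_on {0..1} (\<lambda>s. - complex_of_real (2 * p s * (b - a)))"
    unfolding p_def by (intro continuous_intros)
  then have "\<gamma> C1_differentiable_on {0..1}"
    unfolding C1_differentiable_on_def using d\<gamma>
    by (intro exI[of _ "\<lambda>s. - complex_of_real (2 * p s * (b - a))"] conjI ballI)
  then have "valid_path \<gamma>"
    unfolding valid_path_def by (rule C1_differentiable_imp_piecewise)
  moreover have "path_image \<gamma> \<subseteq> D"
  proof
    fix z assume "z \<in> path_image \<gamma>"
    then obtain s where s: "s \<in> {0..1}" "z = \<gamma> s" by (auto simp: path_image_def)
    then show "z \<in> D" unfolding s \<gamma>_def using p8[OF s(1)] by (intro neg_real_in_D) auto
  qed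
  moreover have "pathstart \<gamma> = - of_real (a\<^sup>2)" "pathfinish \<gamma> = - of_real (b\<^sup>2)"
    by (auto simp: pathstart_def pathfinish_def \<gamma>_def p_def)
  ultimately have "bergman_dist D (- of_real (a\<^sup>2)) (- of_real (b\<^sup>2)) \<le> bergman_length D \<gamma>"
    unfolding bergman_dist_def by (intro INF_lower) auto
  also have "bergman_length D \<gamma> \<le> (\<integral>\<^sup>+ s\<in>{0..1::real}. ennreal (2 * C * \<bar>b - a\<bar>) \<partial>lebesgue)"
    unfolding bergman_length_def
  proof (rule nn_integral_mono)
    fix s :: real
    show "ennreal (sqrt (bergman_metric D (\<gamma> s)) * cmod (vector_derivative \<gamma> (at s))) * indicator {0..1} s
      \<le> ennreal (2 * C * \<bar>b - a\<bar>) * indicator {0..1} s"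
    proof (cases "s \<in> {0..1}")
      case True
      have vd: "cmod (vector_derivative \<gamma> (at s)) = 2 * p s * \<bar>b - a\<bar>"
        using vector_derivative_at[OF d\<gamma>[of s]] p[OF True]
        by (simp only: norm_minus_cancel norm_of_real) (simp add: abs_mult)
      have "sqrt (bergman_metric D (\<gamma> s)) \<le> C / sqrt ((p s)\<^sup>2)"
        unfolding \<gamma>_def by (rule C(2)[OF p8[OF True]])
      then have "sqrt (bergman_metric D (\<gamma> s)) * (2 * p s * \<bar>b - a\<bar>) \<le> C / p s * (2 * p s * \<bar>b - a\<bar>)"
        using p[OF True] by (intro mult_right_mono) auto
      also have "\<dots> = 2 * C * \<bar>b - a\<bar>" using p[OF True] by simp
      finally show ?thesis using True by (simp add: vd ennreal_leI)
    qed simp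
  qed
  also have "\<dots> = ennreal (2 * C * \<bar>b - a\<bar>)"
    by (simp add: nn_integral_cmult_indicator)
  finally show ?thesis .
qed

lemma not_complete:
  assumes t: "t \<le> r ^ 4"
  shows "\<not> bergman_complete D"
proof
  assume complete: "bergman_complete D"
  obtain C where C: "0 \<le> C" "\<And>y. 0 < y \<Longrightarrow> y < 1 / 8 \<Longrightarrow> sqrt (bergman_metric D (- of_real y)) \<le> C / sqrt y"
    using metric_negative_axis[OF t] by blast
  \<comment> \<open>With \<open>u n\<close> at most 1/3 the points \<open>- (u n)\<^sup>2\<close>
    stay between -1/8 and 0. Their distances are governed by differences of \<open>u\<close>, so
    convergence of \<open>u\<close> makes them a Cauchy sequence.\<close>
  define u where "u n = 1 / real (n + 3)" for n
  have u: "0 < u n" "u n \<le> 1 / 3" for n by (auto simp: u_def field_simps)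
  have u0: "u \<longlonglongrightarrow> 0" unfolding u_def by real_asymp
  define x where "x n = - complex_of_real ((u n)\<^sup>2)" for n
  have xD: "x n \<in> D" for n
  proof -
    have "(u n)\<^sup>2 \<le> (1 / 3)\<^sup>2" using u[of n] by (intro power_mono) auto
    then have "(u n)\<^sup>2 < 1" by (simp add: power2_eq_square)
    then show ?thesis unfolding x_def using u[of n] by (intro neg_real_in_D) auto
  qed
  have "bergman_Cauchy D x"
    unfolding bergman_Cauchy_def
  proof (intro allI impI)
    fix \<epsilon> :: real assume \<epsilon>: "\<epsilon> > 0"
    have "(\<lambda>n. 4 * C * u n) \<longlonglongrightarrow> 4 * C * 0" by (intro tendsto_intros u0)
    then have "\<forall>\<^sub>F n in sequentially. 4 * C * u n < \<epsilon>" using \<epsilon> by (intro order_tendstoD(2)) auto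
    then obtain M where M: "\<And>n. n \<ge> M \<Longrightarrow> 4 * C * u n < \<epsilon>" by (auto simp: eventually_sequentially)
    have "bergman_dist D (x m) (x n) < ennreal \<epsilon>" if "m \<ge> M" "n \<ge> M" for m n
    proof -
      have "bergman_dist D (x m) (x n) \<le> ennreal (2 * C * \<bar>u n - u m\<bar>)"
        unfolding x_def by (rule dist_negative_axis[OF C u u])
      moreover have "2 * C * \<bar>u n - u m\<bar> < \<epsilon>"
      proof -
        have "2 * C * \<bar>u n - u m\<bar> \<le> 2 * C * (u n + u m)"
          using C(1) u(1)[of n] u(1)[of m] by (intro mult_left_mono) auto
        also have "\<dots> = (4 * C * u n + 4 * C * u m) / 2" by (simp add: algebra_simps)
        also have "\<dots> < \<epsilon>" using M[OF that(1)] M[OF that(2)] by simp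
        finally show ?thesis .
      qed
      ultimately show ?thesis using \<epsilon> by (auto intro: le_less_trans simp: ennreal_less_iff C(1))
    qed
    then show "\<exists>N. \<forall>m\<ge>N. \<forall>n\<ge>N. bergman_dist D (x m) (x n) < ennreal \<epsilon>" by blast
  qed
  then obtain l where l: "l \<in> D" "x \<longlonglongrightarrow> l"
    using complete xD unfolding bergman_complete_def by blast
  have "x \<longlonglongrightarrow> - of_real (0\<^sup>2)" unfolding x_def by (intro tendsto_intros u0)
  then have "l = 0" using LIMSEQ_unique[OF l(2)] by simp
  then show False using l(1) by (simp add: D_iff)
qed

end

section \<open>Peak functions\<close>

text \<open>Maps the arc \<open>R e\<^sup>i\<^sup>\<theta>\<close>, \<open>\<bar>\<theta> - \<phi>\<bar> \<le> \<gamma>\<close>, onto the nonpositive reals (with \<open>\<infinity>\<close>), so that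
  branches of roots are defined off the arc.\<close>

definition arc_mob :: "real \<Rightarrow> real \<Rightarrow> real \<Rightarrow> complex \<Rightarrow> complex" where
  "arc_mob R \<phi> \<gamma> w = cis \<gamma> * (w - of_real R * cis (\<phi> - \<gamma>)) / (w - of_real R * cis (\<phi> + \<gamma>))"

text \<open>Solving m = -l for \<open>w\<close> gives w = R cis \<phi> cis \<gamma> cnj u / u with u
  = cis \<gamma> + l, so the angle of \<open>w\<close> is \<phi> + \<gamma> - 2 Arg u. As l >= 0,
  the argument of \<open>u\<close> lies between 0 and \<gamma>.\<close>

lemma arc_mob_nonpos:
  assumes \<gamma>: "0 < \<gamma>" "\<gamma> < pi" and w: "w \<noteq> of_real R * cis (\<phi> + \<gamma>)" and m: "arc_mob R \<phi> \<gamma> w \<in> \<real>\<^sub>\<le>\<^sub>0"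
  obtains \<theta> where "\<phi> - \<gamma> \<le> \<theta>" "\<theta> \<le> \<phi> + \<gamma>" "w = of_real R * cis \<theta>"
proof -
  obtain l where l: "0 \<le> l" "arc_mob R \<phi> \<gamma> w = - of_real l"
    using m by (elim nonpos_Reals_cases) (metis minus_minus neg_0_le_iff_le of_real_minus)
  define u where "u = cis \<gamma> + of_real l"
  have sin: "0 < sin \<gamma>" using \<gamma> by (rule sin_gt_zero)
  have Imu: "0 < Im u" using sin by (simp add: u_def)
  then have u0: "u \<noteq> 0" by auto
  have "cis \<gamma> * (w - of_real R * cis (\<phi> - \<gamma>)) = - of_real l * (w - of_real R * cis (\<phi> + \<gamma>))"
    using l(2) w by (simp add: arc_mob_def field_simps)
  then have "w * u = of_real R * (cis \<gamma> * cis (\<phi> - \<gamma>) + of_real l * cis (\<phi> + \<gamma>))"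
    by (simp add: u_def algebra_simps)
  also have "cis \<gamma> * cis (\<phi> - \<gamma>) = cis \<phi>" by (simp add: cis_mult)
  also have "cis (\<phi> + \<gamma>) = cis \<phi> * cis \<gamma>" by (simp add: cis_mult)
  also have "cis \<phi> + of_real l * (cis \<phi> * cis \<gamma>) = cis \<phi> * (cis \<gamma> * cnj u)"
  proof -
    have "cis \<gamma> * cnj u = 1 + of_real l * cis \<gamma>"
      by (simp add: u_def distrib_left cis_cnj cis_mult mult.commute)
    then show ?thesis by (simp add: algebra_simps)
  qed
  finally have wu: "w * u = of_real R * (cis \<phi> * (cis \<gamma> * cnj u))" .
  define \<psi> where "\<psi> = Arg u"
  have u: "u = of_real (cmod u) * cis \<psi>"
    using rcis_cmod_Arg[of u] by (simp add: \<psi>_def rcis_def)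
  have \<psi>b: "- pi < \<psi>" "\<psi> \<le> pi" using Arg_bounded[of u] by (auto simp: \<psi>_def)
  have "Im u = cmod u * sin \<psi>" using arg_cong[OF u, of Im] by simp
  then have s\<psi>: "0 < sin \<psi>" using Imu by (simp add: zero_less_mult_iff)
  have \<psi>0: "0 < \<psi>"
  proof (rule ccontr)
    assume "\<not> 0 < \<psi>"
    then have "0 \<le> sin (- \<psi>)" using \<psi>b by (intro sin_ge_zero) auto
    then show False using s\<psi> by simp
  qed
  have cu: "cis \<gamma> * cnj u = of_real (cmod u) * cis (\<gamma> - \<psi>)"
  proof -
    have "cnj u = of_real (cmod u) * cis (- \<psi>)" using arg_cong[OF u, of cnj] by (simp add: cis_cnj)
    moreover have "cis \<gamma> * cis (- \<psi>) = cis (\<gamma> - \<psi>)" by (simp add: cis_mult)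
    ultimately show ?thesis by (metis mult.left_commute)
  qed
  have "Im (cis \<gamma> * cnj u) = l * sin \<gamma>" by (simp add: u_def algebra_simps)
  then have "0 \<le> cmod u * sin (\<gamma> - \<psi>)" using cu l sin by simp
  then have s: "0 \<le> sin (\<gamma> - \<psi>)" using u0 by (simp add: zero_le_mult_iff)
  have \<psi>\<gamma>: "\<psi> \<le> \<gamma>"
  proof (rule ccontr)
    assume "\<not> \<psi> \<le> \<gamma>"
    then have "0 < sin (\<psi> - \<gamma>)" using \<psi>b \<gamma> by (intro sin_gt_zero) auto
    then show False using s sin_minus[of "\<psi> - \<gamma>"] by simp
  qed
  have "w * u = of_real R * cis (\<phi> + \<gamma> - 2 * \<psi>) * u"
  proof -
    have "cis \<phi> * cis (\<gamma> - \<psi>) = cis (\<phi> + \<gamma> - 2 * \<psi>) * cis \<psi>"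
      by (simp add: cis_mult add_diff_eq)
    then show ?thesis unfolding wu cu by (subst (2) u) (simp add: mult_ac)
  qed
  then have "w = of_real R * cis (\<phi> + \<gamma> - 2 * \<psi>)" using u0 by simp
  then show ?thesis by (rule that[rotated 2]) (use \<psi>0 \<psi>\<gamma> in auto)
qed

lemma arc_endpoints_distinct:
  assumes "0 < \<gamma>" "\<gamma> < pi" "R \<noteq> 0"
  shows "complex_of_real R * cis (\<phi> - \<gamma>) \<noteq> of_real R * cis (\<phi> + \<gamma>)"
proof
  assume "complex_of_real R * cis (\<phi> - \<gamma>) = of_real R * cis (\<phi> + \<gamma>)"
  then have "cis (\<phi> - \<gamma>) = cis (\<phi> + \<gamma>)" using assms by simp
  then have "cis (\<phi> - \<gamma>) * cis (- \<phi>) = cis (\<phi> + \<gamma>) * cis (- \<phi>)" by simp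
  then have "cis (- \<gamma>) = cis \<gamma>" by (simp add: cis_mult)
  then have "sin \<gamma> = 0" by (simp add: complex_eq_iff)
  then show False using sin_gt_zero[of \<gamma>] assms by simp
qed

context bergman_space
begin

lemma bounded_in_H:
  assumes hol: "f holomorphic_on D" and bnd: "\<And>z. z \<in> D \<Longrightarrow> cmod (f z) \<le> B"
  shows "f \<in> H"
proof -
  have "integrable lborel (\<lambda>z. B\<^sup>2 * indicat_real D z)"
    using open_D emeasure_bounded_finite[OF bounded_D]
    by (intro integrable_mult_right integrable_real_indicator) auto
  then have "integrable lborel (\<lambda>z. (cmod (restr D f z))\<^sup>2)"
  proof (rule Bochner_Integration.integrable_bound)
    show "(\<lambda>z. (cmod (restr D f z))\<^sup>2) \<in> borel_measurable lborel"
      using borel_measurable_holomorphic_indicator[OF open_D hol] by measurable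
    show "AE z in lborel. norm ((cmod (restr D f z))\<^sup>2) \<le> norm (B\<^sup>2 * indicat_real D z)"
      using bnd by (intro AE_I2) (auto simp: indicator_def intro!: power_mono)
  qed
  then show ?thesis using hol by (simp only: L2_hol_iff[OF open_D] simp_thms)
qed

lemma exhaustive_atI:
  assumes "\<And>\<epsilon>. \<epsilon> > 0 \<Longrightarrow> \<exists>f\<in>H. (N f)\<^sup>2 \<le> \<epsilon> \<and> (\<forall>\<^sub>F z in at z0 within D. 1 / 2 \<le> cmod (f z))"
  shows "bergman_exhaustive_at D z0"
  unfolding bergman_exhaustive_at_def filterlim_at_top
proof
  fix Z :: real
  \<comment> \<open>(1 / 2)^2 / \<epsilon> is \<open>max Z 1\<close>; the maximum keeps \<epsilon>
    positive when \<open>Z\<close> is not.\<close>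
  define \<epsilon> where "\<epsilon> = 1 / (4 * max Z 1)"
  have \<epsilon>: "\<epsilon> > 0" by (simp add: \<epsilon>_def)
  obtain f where f: "f \<in> H" "(N f)\<^sup>2 \<le> \<epsilon>" "\<forall>\<^sub>F z in at z0 within D. 1 / 2 \<le> cmod (f z)"
    using assms[OF \<epsilon>] by blast
  have "\<forall>\<^sub>F z in at z0 within D. z \<in> D" by (simp add: eventually_at_filter)
  with f(3) show "\<forall>\<^sub>F z in at z0 within D. Z \<le> bergman_kernel D z"
  proof eventually_elim
    case (elim z)
    have "(1 / 2)\<^sup>2 \<le> (cmod (f z))\<^sup>2" using elim by (intro power_mono) auto
    also have "\<dots> \<le> bergman_kernel D z * (N f)\<^sup>2" by (rule bergman_kernel_ge[OF elim(2) f(1)])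
    also have "\<dots> \<le> bergman_kernel D z * \<epsilon>"
      using bergman_kernel_pos[OF elim(2)] f(2) by (intro mult_left_mono) auto
    finally have "max Z 1 \<le> bergman_kernel D z" by (simp add: \<epsilon>_def power2_eq_square field_simps)
    then show ?case by simp
  qed
qed

text \<open>The peak functions \<open>1 / (1 + n \<surd>m)\<close> are bounded by one because \<open>Re \<surd>m \<ge> 0\<close>.\<close>

lemma exhaustive_at_of_slit_map:
  assumes m: "m holomorphic_on D" and slit: "\<And>w. w \<in> D \<Longrightarrow> m w \<notin> \<real>\<^sub>\<le>\<^sub>0"
    and lim: "(m \<longlongrightarrow> 0) (at z0 within D)"
  shows "bergman_exhaustive_at D z0"
proof (rule exhaustive_atI)
  define f where "f n w = 1 / (1 + of_nat n * csqrt (m w))" for n :: nat and w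
  have ge: "1 \<le> cmod (1 + of_nat n * csqrt (m w))" for n w
  proof -
    have "1 \<le> Re (1 + of_nat n * csqrt (m w))" using Re_csqrt[of "m w"] by simp
    then show ?thesis using complex_Re_le_cmod order_trans by blast
  qed
  then have nz: "1 + of_nat n * csqrt (m w) \<noteq> 0" for n w by (metis norm_zero not_one_le_zero)
  have le1: "cmod (f n w) \<le> 1" for n w
    using ge[of n w] by (simp add: f_def norm_divide divide_le_eq)
  have hol: "f n holomorphic_on D" for n
    unfolding f_def[abs_def] using m slit nz by (intro holomorphic_intros) auto
  have fH: "f n \<in> H" for n by (rule bounded_in_H[OF hol le1])
  have tends: "(\<lambda>n. f n w) \<longlonglongrightarrow> 0" if w: "w \<in> D" for w
  proof (rule Lim_null_comparison)
    define c where "c = csqrt (m w)"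
    have c: "c \<noteq> 0" "0 \<le> Re c" using slit[OF w] Re_csqrt[of "m w"] by (auto simp: c_def)
    have "cmod (f n w) \<le> 1 / (real n * cmod c)" if n: "n \<ge> 1" for n
    proof -
      have "(real n * cmod c)\<^sup>2 \<le> (cmod (1 + of_nat n * c))\<^sup>2"
        using c unfolding cmod_power2 power_mult_distrib by (simp add: power2_eq_square algebra_simps)
      then have "real n * cmod c \<le> cmod (1 + of_nat n * c)" by (rule power2_le_imp_le) simp
      then show ?thesis using n c ge[of n w] by (auto simp: f_def norm_divide c_def intro!: divide_left_mono mult_pos_pos)
    qed
    then show "\<forall>\<^sub>F n in sequentially. cmod (f n w) \<le> 1 / (real n * cmod c)"
      unfolding eventually_sequentially by blast
    show "(\<lambda>n. 1 / (real n * cmod c)) \<longlonglongrightarrow> 0"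
      using tendsto_mult_right[OF lim_1_over_n, of "1 / cmod c"] by simp
  qed
  have Nlim: "(\<lambda>n. (N (f n))\<^sup>2) \<longlonglongrightarrow> 0"
  proof -
    have "(\<lambda>n. \<integral>z. (cmod (restr D (f n) z))\<^sup>2 \<partial>lborel) \<longlonglongrightarrow> integral\<^sup>L lborel (\<lambda>_::complex. 0)"
    proof (rule integral_dominated_convergence[of _ _ _ "indicat_real D"])
      show "integrable lborel (indicat_real D)"
        using open_D emeasure_bounded_finite[OF bounded_D] by (intro integrable_real_indicator) auto
      show "(\<lambda>z. (cmod (restr D (f n) z))\<^sup>2) \<in> borel_measurable lborel" for n
        using H_measurable[OF fH] by measurable
      show "AE z in lborel. (\<lambda>n. (cmod (restr D (f n) z))\<^sup>2) \<longlonglongrightarrow> 0"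
      proof (rule AE_I2)
        fix z
        have "(\<lambda>n. (cmod (restr D (f n) z))\<^sup>2) \<longlonglongrightarrow> (cmod (indicator D z *\<^sub>R 0))\<^sup>2"
          by (cases "z \<in> D") (auto intro!: tendsto_eq_intros tends)
        then show "(\<lambda>n. (cmod (restr D (f n) z))\<^sup>2) \<longlonglongrightarrow> 0" by simp
      qed
      show "AE z in lborel. norm ((cmod (restr D (f n) z))\<^sup>2) \<le> indicat_real D z" for n
        using le1 by (intro AE_I2) (auto simp: indicator_def power_le_one)
    qed simp
    then show ?thesis by (simp add: N_square[OF fH] del: norm_scaleR)
  qed
  fix \<epsilon> :: real assume "\<epsilon> > 0"
  then have "\<forall>\<^sub>F n in sequentially. (N (f n))\<^sup>2 < \<epsilon>" using Nlim by (intro order_tendstoD(2)) auto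
  then obtain n where n: "(N (f n))\<^sup>2 < \<epsilon>" by (meson eventually_sequentially order_refl)
  have "((\<lambda>z. real n * sqrt (cmod (m z))) \<longlongrightarrow> real n * sqrt (cmod 0)) (at z0 within D)"
    by (intro tendsto_intros lim)
  then have "\<forall>\<^sub>F z in at z0 within D. real n * sqrt (cmod (m z)) < 1" by (intro order_tendstoD(2)) auto
  then have "\<forall>\<^sub>F z in at z0 within D. 1 / 2 \<le> cmod (f n z)"
  proof eventually_elim
    case (elim z)
    have "cmod (1 + of_nat n * csqrt (m z)) \<le> 2"
      using norm_triangle_ineq[of 1 "of_nat n * csqrt (m z)"] elim by (simp add: norm_mult)
    then have "1 / 2 \<le> 1 / cmod (1 + of_nat n * csqrt (m z))"
      using ge[of n z] by (intro divide_left_mono) linarith+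
    then show ?case by (simp add: f_def norm_divide)
  qed
  then show "\<exists>f\<in>H. (N f)\<^sup>2 \<le> \<epsilon> \<and> (\<forall>\<^sub>F z in at z0 within D. 1 / 2 \<le> cmod (f z))"
    using fH n by (intro bexI[of _ "f n"]) auto
qed

end

context arcs
begin

section \<open>Boundary points other than the origin\<close>

lemma arc_setI:
  assumes "\<bar>\<theta>\<bar> \<le> 2 * \<alpha> k"
  shows "of_real (r ^ k) * cis \<theta> \<in> arc_set r \<alpha> k"
  using assms unfolding arc_set_def cis_conv_exp by (auto intro!: exI[of _ \<theta>])

text \<open>Any subarc of the k-th arc may serve as the slit, since it lies outside
  \<open>D\<close>; this freedom lets the zero of the map be placed at a prescribed point of the
  arc.\<close>

lemma arc_mob_slit:
  assumes k: "k \<ge> 1" and \<gamma>: "0 < \<gamma>" "\<gamma> < pi" and sub: "- 2 * \<alpha> k \<le> \<phi> - \<gamma>" "\<phi> + \<gamma> \<le> 2 * \<alpha> k" and w: "w \<in> D"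
  shows "w \<noteq> of_real (r ^ k) * cis (\<phi> + \<gamma>)" "w \<noteq> of_real (r ^ k) * cis (\<phi> - \<gamma>)"
    "arc_mob (r ^ k) \<phi> \<gamma> w \<notin> \<real>\<^sub>\<le>\<^sub>0"
proof -
  have na: "w \<notin> arc_set r \<alpha> k" using w k by (simp add: D_iff)
  show 1: "w \<noteq> of_real (r ^ k) * cis (\<phi> + \<gamma>)" "w \<noteq> of_real (r ^ k) * cis (\<phi> - \<gamma>)"
    using na arc_setI[of "\<phi> + \<gamma>" k] arc_setI[of "\<phi> - \<gamma>" k] sub \<gamma> by auto
  show "arc_mob (r ^ k) \<phi> \<gamma> w \<notin> \<real>\<^sub>\<le>\<^sub>0"
  proof
    assume "arc_mob (r ^ k) \<phi> \<gamma> w \<in> \<real>\<^sub>\<le>\<^sub>0"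
    then obtain \<theta> where \<theta>: "\<phi> - \<gamma> \<le> \<theta>" "\<theta> \<le> \<phi> + \<gamma>" "w = of_real (r ^ k) * cis \<theta>"
      using arc_mob_nonpos[OF \<gamma> 1(1)] by blast
    have "\<bar>\<theta>\<bar> \<le> 2 * \<alpha> k" using \<theta>(1,2) sub by linarith
    then show False using na arc_setI[of \<theta> k] \<theta>(3) by simp
  qed
qed

text \<open>The slit map must vanish at \<open>z0\<close>, and \<open>arc_mob\<close> vanishes at
  the end of its arc with the smaller angle. So the subarc from \<theta> to
  \<open>2 * \<alpha> k\<close> is taken. If \<open>z0\<close> is that last endpoint itself, the
  whole arc is used with the reciprocal map, since reciprocals preserve the slit plane.\<close>

lemma exhaustive_at_arc:
  assumes k: "k \<ge> 1" and z0: "z0 \<in> arc_set r \<alpha> k"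
  shows "bergman_exhaustive_at D z0"
proof -
  obtain \<theta> where \<theta>: "z0 = of_real (r ^ k) * exp (\<i> * of_real \<theta>)" "\<bar>\<theta>\<bar> \<le> 2 * \<alpha> k"
    using z0 by (rule arc_setE)
  have z: "z0 = of_real (r ^ k) * cis \<theta>" by (simp add: \<theta>(1) cis_conv_exp)
  have \<alpha>k: "0 < \<alpha> k" "\<alpha> k < pi / 2" using \<alpha>[OF k] by auto
  have R: "r ^ k \<noteq> 0" using r_pos by simp
  show ?thesis
  proof (cases "\<theta> < 2 * \<alpha> k")
    case True
    define \<phi> \<gamma> where "\<phi> = (\<theta> + 2 * \<alpha> k) / 2" and "\<gamma> = (2 * \<alpha> k - \<theta>) / 2"
    have \<gamma>: "0 < \<gamma>" "\<gamma> < pi" using True \<theta>(2) \<alpha>k by (auto simp: \<gamma>_def)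
    have e: "\<phi> - \<gamma> = \<theta>" "\<phi> + \<gamma> = 2 * \<alpha> k" by (auto simp: \<phi>_def \<gamma>_def field_simps)
    have sub: "- 2 * \<alpha> k \<le> \<phi> - \<gamma>" "\<phi> + \<gamma> \<le> 2 * \<alpha> k" using e \<theta>(2) by auto
    note slit = arc_mob_slit[OF k \<gamma> sub]
    have z': "z0 = of_real (r ^ k) * cis (\<phi> - \<gamma>)" by (simp add: z e)
    show ?thesis
    proof (rule exhaustive_at_of_slit_map)
      show "arc_mob (r ^ k) \<phi> \<gamma> holomorphic_on D"
        unfolding arc_mob_def[abs_def] using slit(1) by (intro holomorphic_intros) auto
      show "\<And>w. w \<in> D \<Longrightarrow> arc_mob (r ^ k) \<phi> \<gamma> w \<notin> \<real>\<^sub>\<le>\<^sub>0" by (rule slit(3))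
      have "((\<lambda>w. cis \<gamma> * (w - of_real (r ^ k) * cis (\<phi> - \<gamma>)) / (w - of_real (r ^ k) * cis (\<phi> + \<gamma>))) \<longlongrightarrow>
          cis \<gamma> * (z0 - of_real (r ^ k) * cis (\<phi> - \<gamma>)) / (z0 - of_real (r ^ k) * cis (\<phi> + \<gamma>))) (at z0 within D)"
        using arc_endpoints_distinct[OF \<gamma> R, of \<phi>] unfolding z'[symmetric] by (intro tendsto_intros) auto
      then show "(arc_mob (r ^ k) \<phi> \<gamma> \<longlongrightarrow> 0) (at z0 within D)"
        unfolding arc_mob_def[abs_def] by (simp add: z')
    qed
  next
    case False
    define \<gamma> where "\<gamma> = 2 * \<alpha> k"
    have \<gamma>: "0 < \<gamma>" "\<gamma> < pi" using \<alpha>k by (auto simp: \<gamma>_def)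
    have z': "z0 = of_real (r ^ k) * cis (0 + \<gamma>)" 
    proof -
      have "\<theta> = 2 * \<alpha> k" using False \<theta>(2) by linarith
      then show ?thesis by (simp add: z \<gamma>_def)
    qed
    have sub: "- 2 * \<alpha> k \<le> 0 - \<gamma>" "0 + \<gamma> \<le> 2 * \<alpha> k" by (auto simp: \<gamma>_def)
    note slit = arc_mob_slit[OF k \<gamma> sub]
    have inv: "inverse (arc_mob (r ^ k) 0 \<gamma> w) =
        cis (- \<gamma>) * (w - of_real (r ^ k) * cis (0 + \<gamma>)) / (w - of_real (r ^ k) * cis (0 - \<gamma>))" for w
      by (simp add: arc_mob_def cis_inverse[symmetric] field_simps)
    show ?thesis
    proof (rule exhaustive_at_of_slit_map)
      show "(\<lambda>w. inverse (arc_mob (r ^ k) 0 \<gamma> w)) holomorphic_on D"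
        unfolding inv using slit(2) by (intro holomorphic_intros) auto
      show "inverse (arc_mob (r ^ k) 0 \<gamma> w) \<notin> \<real>\<^sub>\<le>\<^sub>0" if w: "w \<in> D" for w
      proof
        assume "inverse (arc_mob (r ^ k) 0 \<gamma> w) \<in> \<real>\<^sub>\<le>\<^sub>0"
        then obtain a where a: "a \<le> 0" "inverse (arc_mob (r ^ k) 0 \<gamma> w) = of_real a" by (elim nonpos_Reals_cases) auto
        then have "arc_mob (r ^ k) 0 \<gamma> w = of_real (inverse a)"
          by (metis inverse_inverse_eq of_real_inverse)
        then show False using slit(3)[OF w] a(1) by simp
      qed
      have "((\<lambda>w. cis (- \<gamma>) * (w - of_real (r ^ k) * cis (0 + \<gamma>)) / (w - of_real (r ^ k) * cis (0 - \<gamma>))) \<longlongrightarrow>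
          cis (- \<gamma>) * (z0 - of_real (r ^ k) * cis (0 + \<gamma>)) / (z0 - of_real (r ^ k) * cis (0 - \<gamma>))) (at z0 within D)"
        using arc_endpoints_distinct[OF \<gamma> R, of 0] unfolding z'[symmetric] by (intro tendsto_intros) auto
      then show "((\<lambda>w. inverse (arc_mob (r ^ k) 0 \<gamma> w)) \<longlongrightarrow> 0) (at z0 within D)"
        unfolding inv by (simp add: z')
    qed
  qed
qed

text \<open>The map 1 - w / z0 sends the disc into the right half-plane, which avoids the
  slit.\<close>

lemma exhaustive_at_circle:
  assumes z0: "cmod z0 = 1"
  shows "bergman_exhaustive_at D z0"
proof (rule exhaustive_at_of_slit_map)
  have nz: "z0 \<noteq> 0" using z0 by auto
  then show "(\<lambda>w. 1 - w / z0) holomorphic_on D" by (intro holomorphic_intros)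
  show "1 - w / z0 \<notin> \<real>\<^sub>\<le>\<^sub>0" if "w \<in> D" for w
  proof -
    define v where "v = w / z0"
    have "cmod v < 1" using that z0 by (simp add: v_def D_iff norm_divide)
    then have "Re v < 1" using complex_Re_le_cmod[of v] by linarith
    then show ?thesis by (auto simp: complex_nonpos_Reals_iff v_def[symmetric])
  qed
  have "((\<lambda>w. 1 - w / z0) \<longlongrightarrow> 1 - z0 / z0) (at z0 within D)" by (intro tendsto_intros nz)
  then show "((\<lambda>w. 1 - w / z0) \<longlongrightarrow> 0) (at z0 within D)" using nz by simp
qed

lemma frontier_cases:
  assumes "z0 \<in> frontier D"
  obtains "cmod z0 = 1" | k where "k \<ge> 1" "z0 \<in> arc_set r \<alpha> k" | "z0 = 0"
proof -
  have "closure D \<subseteq> cball 0 1" by (rule closure_minimal) (auto simp: D_iff)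
  then have "cmod z0 \<le> 1" "z0 \<notin> D"
    using assms open_D by (auto simp: frontier_def interior_open)
  then show ?thesis using that by (auto simp: D_iff)
qed

end

section \<open>Exhaustiveness at the origin\<close>

context arcs
begin

text \<open>Conformal map of the complement of the k-th arc onto the right half-plane. It takes
  infinity to \<open>cis (\<alpha> k)\<close> and the origin to \<open>cis (- \<alpha> k)\<close>,
  the points that enter \<open>block\<close>.\<close>

definition slit_root :: "nat \<Rightarrow> complex \<Rightarrow> complex" where
  "slit_root k w = csqrt (arc_mob (r ^ k) 0 (2 * \<alpha> k) w)"

text \<open>The first quotient is the conformal map of the complement of the \<open>k\<close>-th arc to the unit disc
  that vanishes at \<open>\<infinity>\<close>; its value at the origin is the second denominator.\<close>

definition block :: "nat \<Rightarrow> complex \<Rightarrow> complex" where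
  "block k w = (slit_root k w - cis (\<alpha> k)) / (slit_root k w + cis (- \<alpha> k)) / (- \<i> * sin (\<alpha> k) * cis (\<alpha> k))"

text \<open>The end of the arc where the Moebius map has its pole. The arc has size comparable to
  \<open>r ^ k * sin (\<alpha> k)\<close>, so beyond that scale the distance to \<open>tip k\<close>
  stands for the distance to the arc.\<close>

definition tip :: "nat \<Rightarrow> complex" where
  "tip k = of_real (r ^ k) * cis (2 * \<alpha> k)"

lemma \<alpha>_bounds: "k \<ge> 1 \<Longrightarrow> 0 < \<alpha> k" "k \<ge> 1 \<Longrightarrow> \<alpha> k < pi / 2"
  using \<alpha> by auto

lemma sin_\<alpha>_pos: "k \<ge> 1 \<Longrightarrow> 0 < sin (\<alpha> k)"
  by (simp add: sin_\<alpha>)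

lemma cos_\<alpha>_pos: "k \<ge> 1 \<Longrightarrow> 0 < cos (\<alpha> k)"
  using \<alpha>_bounds[of k] by (intro cos_gt_zero) auto

text \<open>Since t < 1/2, \<open>T k\<close> is at least 2 and the sine at most 1/3. The value 4/5
  makes the quotient 4 / (4 / 5) in \<open>block_le_inverse_dist\<close> equal to 5.\<close>

lemma cos_\<alpha>_square: assumes k: "k \<ge> 1" shows "4 / 5 \<le> (cos (\<alpha> k))\<^sup>2"
proof -
  have "2 \<le> (1 / t) ^ 1" using t_pos t_less by (simp add: field_simps)
  also have "\<dots> \<le> T k" unfolding T_def using t_pos t_less k by (intro power_increasing) auto
  finally have "3 \<le> exp (T k)" using exp_ge_add_one_self[of "T k"] by linarith
  then have "sin (\<alpha> k) \<le> 1 / 3" by (simp add: sin_\<alpha>[OF k] exp_minus field_simps)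
  then have "(sin (\<alpha> k))\<^sup>2 \<le> (1 / 3)\<^sup>2" using sin_\<alpha>_pos[OF k] by (intro power_mono) auto
  then show ?thesis using sin_cos_squared_add[of "\<alpha> k"] by (simp add: power2_eq_square)
qed

lemma full_arc_slit:
  assumes k: "k \<ge> 1" and w: "w \<in> D"
  shows "w \<noteq> tip k" "arc_mob (r ^ k) 0 (2 * \<alpha> k) w \<notin> \<real>\<^sub>\<le>\<^sub>0"
  using arc_mob_slit[OF k, of "2 * \<alpha> k" 0 w] \<alpha>_bounds[OF k] w by (auto simp: tip_def)

lemma slit_root_denominators:
  assumes k: "k \<ge> 1"
  shows "cos (\<alpha> k) \<le> cmod (slit_root k w + cis (\<alpha> k))" "cos (\<alpha> k) \<le> cmod (slit_root k w + cis (- \<alpha> k))"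
proof -
  have "0 \<le> Re (slit_root k w)" unfolding slit_root_def by (rule Re_csqrt)
  then have "cos (\<alpha> k) \<le> Re (slit_root k w + cis (\<alpha> k))" "cos (\<alpha> k) \<le> Re (slit_root k w + cis (- \<alpha> k))" by auto
  then show "cos (\<alpha> k) \<le> cmod (slit_root k w + cis (\<alpha> k))" "cos (\<alpha> k) \<le> cmod (slit_root k w + cis (- \<alpha> k))"
    using complex_Re_le_cmod order_trans by blast+
qed

lemma slit_root_denominators_nz:
  assumes k: "k \<ge> 1"
  shows "slit_root k w + cis (\<alpha> k) \<noteq> 0" "slit_root k w + cis (- \<alpha> k) \<noteq> 0"
  using slit_root_denominators[OF k, of w] cos_\<alpha>_pos[OF k] by auto

lemma norm_block_denominator: "k \<ge> 1 \<Longrightarrow> cmod (- \<i> * sin (\<alpha> k) * cis (\<alpha> k)) = sin (\<alpha> k)"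
  using sin_\<alpha>_pos[of k] by (simp add: norm_mult)

lemma block_holomorphic:
  assumes k: "k \<ge> 1"
  shows "block k holomorphic_on D"
proof -
  have "arc_mob (r ^ k) 0 (2 * \<alpha> k) holomorphic_on D"
    unfolding arc_mob_def[abs_def] using full_arc_slit(1)[OF k] by (intro holomorphic_intros) (auto simp: tip_def)
  then have "slit_root k holomorphic_on D"
    unfolding slit_root_def[abs_def] using full_arc_slit(2)[OF k] by (intro holomorphic_on_csqrt') auto
  then show ?thesis
    unfolding block_def[abs_def] using slit_root_denominators_nz[OF k] sin_\<alpha>_pos[OF k]
    by (intro holomorphic_intros) auto
qed

text \<open>A Cayley quotient (s - c) / (s + cnj c) with Re c > 0 has modulus at most 1 on the right
  half-plane, so only the normalising factor remains. This bound is the one used close to the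
  tip.\<close>

lemma block_le_inverse_sin:
  assumes k: "k \<ge> 1"
  shows "cmod (block k w) \<le> 1 / sin (\<alpha> k)"
proof -
  define s where "s = slit_root k w"
  have "0 \<le> Re s" unfolding s_def slit_root_def by (rule Re_csqrt)
  then have "0 \<le> Re s * cos (\<alpha> k)" using cos_\<alpha>_pos[OF k] by simp
  then have "(Re s - cos (\<alpha> k))\<^sup>2 \<le> (Re s + cos (\<alpha> k))\<^sup>2" by (simp add: power2_sum power2_diff)
  then have "(cmod (s - cis (\<alpha> k)))\<^sup>2 \<le> (cmod (s + cis (- \<alpha> k)))\<^sup>2" by (simp add: cmod_power2)
  then have le: "cmod (s - cis (\<alpha> k)) \<le> cmod (s + cis (- \<alpha> k))" by (rule power2_le_imp_le) simp
  have "cmod (block k w) = cmod (s - cis (\<alpha> k)) / cmod (s + cis (- \<alpha> k)) / sin (\<alpha> k)"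
    unfolding block_def norm_divide norm_block_denominator[OF k] s_def ..
  also have "\<dots> \<le> 1 / sin (\<alpha> k)"
    using le sin_\<alpha>_pos[OF k] by (intro divide_right_mono) (auto simp: divide_le_eq_1)
  finally show ?thesis .
qed

text \<open>Extending the quotient by \<open>s + cis (\<alpha> k)\<close> makes the numerator
  \<open>s\<^sup>2 - cis (2 * \<alpha> k)\<close>, whose modulus is the chord of the arc divided by
  the distance to the tip. The chord is at most 4 r^k sin \<alpha>, so the normalisation 1 / sin
  \<alpha> cancels, however short the arc is.\<close>

lemma block_le_inverse_dist:
  assumes k: "k \<ge> 1" and w: "w \<noteq> tip k"
  shows "cmod (block k w) \<le> 5 * r ^ k / cmod (w - tip k)"
proof -
  define s where "s = slit_root k w"
  define p where "p = of_real (r ^ k) * cis (- 2 * \<alpha> k)"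
  have m: "s\<^sup>2 = cis (2 * \<alpha> k) * (w - p) / (w - tip k)"
    by (simp add: s_def slit_root_def arc_mob_def p_def tip_def)
  have nz: "s + cis (\<alpha> k) \<noteq> 0" "s + cis (- \<alpha> k) \<noteq> 0"
    using slit_root_denominators_nz[OF k] by (auto simp: s_def)
  have "(s - cis (\<alpha> k)) * (s + cis (\<alpha> k)) = s\<^sup>2 - cis (2 * \<alpha> k)"
    by (simp add: algebra_simps power2_eq_square cis_mult)
  also have "\<dots> = cis (2 * \<alpha> k) * (tip k - p) / (w - tip k)"
    using w unfolding m by (simp add: field_simps)
  finally have num: "cmod (s - cis (\<alpha> k)) * cmod (s + cis (\<alpha> k)) = cmod (tip k - p) / cmod (w - tip k)"
    by (simp add: norm_mult[symmetric]) (simp add: norm_mult norm_divide)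
  have "tip k - p = of_real (r ^ k) * (2 * \<i> * of_real (sin (2 * \<alpha> k)))"
    by (simp add: tip_def p_def complex_eq_iff algebra_simps)
  then have "cmod (tip k - p) = r ^ k * (2 * sin (2 * \<alpha> k))"
    using r_pos sin_gt_zero[of "2 * \<alpha> k"] \<alpha>_bounds[OF k] by (simp add: norm_mult norm_power)
  also have "sin (2 * \<alpha> k) = 2 * sin (\<alpha> k) * cos (\<alpha> k)" by (rule sin_double)
  also have "r ^ k * (2 * (2 * sin (\<alpha> k) * cos (\<alpha> k))) \<le> r ^ k * (4 * sin (\<alpha> k) * 1)"
    using r_pos sin_\<alpha>_pos[OF k] by (intro mult_left_mono) (auto simp: mult_left_le)
  finally have tp: "cmod (tip k - p) \<le> 4 * r ^ k * sin (\<alpha> k)" by simp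
  have den: "4 / 5 \<le> cmod (s + cis (\<alpha> k)) * cmod (s + cis (- \<alpha> k))"
  proof -
    have "4 / 5 \<le> cos (\<alpha> k) * cos (\<alpha> k)" using cos_\<alpha>_square[OF k] by (simp add: power2_eq_square)
    also have "\<dots> \<le> cmod (s + cis (\<alpha> k)) * cmod (s + cis (- \<alpha> k))"
      using slit_root_denominators[OF k, of w] cos_\<alpha>_pos[OF k] unfolding s_def by (intro mult_mono) auto
    finally show ?thesis .
  qed
  have wq: "0 < cmod (w - tip k)" using w by simp
  have "cmod (block k w) = cmod (s - cis (\<alpha> k)) / cmod (s + cis (- \<alpha> k)) / sin (\<alpha> k)"
    unfolding block_def norm_divide norm_block_denominator[OF k] s_def ..
  also have "\<dots> = (cmod (s - cis (\<alpha> k)) * cmod (s + cis (\<alpha> k))) / (cmod (s + cis (\<alpha> k)) * cmod (s + cis (- \<alpha> k))) / sin (\<alpha> k)"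
    using nz by simp
  also have "\<dots> \<le> (4 * r ^ k * sin (\<alpha> k) / cmod (w - tip k)) / (4 / 5) / sin (\<alpha> k)"
    unfolding num using tp den wq sin_\<alpha>_pos[OF k] r_pos
    by (intro divide_right_mono frac_le) (auto intro!: divide_nonneg_pos)
  also have "\<dots> = 5 * r ^ k / cmod (w - tip k)" using sin_\<alpha>_pos[OF k] by simp
  finally show ?thesis .
qed

lemma block_tendsto:
  assumes k: "k \<ge> 1"
  shows "(block k \<longlongrightarrow> 1) (at 0 within D)"
proof -
  have R: "complex_of_real (r ^ k) \<noteq> 0" using r_pos by simp
  have m0: "arc_mob (r ^ k) 0 (2 * \<alpha> k) 0 = (cis (- \<alpha> k))\<^sup>2"
  proof -
    have "arc_mob (r ^ k) 0 (2 * \<alpha> k) 0 = cis (2 * \<alpha> k) * cis (- (2 * \<alpha> k)) / cis (2 * \<alpha> k)"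
      using r_pos by (simp add: arc_mob_def)
    also have "\<dots> = (cis (- \<alpha> k))\<^sup>2" by (simp only: cis_divide cis_mult power2_eq_square) simp
    finally show ?thesis .
  qed
  have s0: "slit_root k 0 = cis (- \<alpha> k)"
    unfolding slit_root_def m0 using cos_\<alpha>_pos[OF k] by (intro csqrt_square) simp
  have "Im ((cis (- \<alpha> k))\<^sup>2) = - (2 * sin (\<alpha> k) * cos (\<alpha> k))" by (simp add: power2_eq_square)
  then have slit: "arc_mob (r ^ k) 0 (2 * \<alpha> k) 0 \<notin> \<real>\<^sub>\<le>\<^sub>0"
    unfolding m0 complex_nonpos_Reals_iff using cos_\<alpha>_pos[OF k] sin_\<alpha>_pos[OF k] by simp
  have "isCont (arc_mob (r ^ k) 0 (2 * \<alpha> k)) 0"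
    unfolding arc_mob_def[abs_def] using R by (intro continuous_intros) auto
  then have "isCont (slit_root k) 0"
    unfolding slit_root_def[abs_def]
    by (rule isCont_o2) (rule continuous_at_csqrt[OF slit])
  then have "isCont (block k) 0"
    unfolding block_def[abs_def] using slit_root_denominators_nz[OF k] sin_\<alpha>_pos[OF k]
    by (intro continuous_intros) auto
  moreover have "block k 0 = 1"
  proof -
    have num: "cis (- \<alpha> k) - cis (\<alpha> k) = - 2 * \<i> * of_real (sin (\<alpha> k))" by (simp add: complex_eq_iff)
    have den: "cis (- \<alpha> k) + cis (- \<alpha> k) = 2 * cis (- \<alpha> k)" by simp
    have "cis (- \<alpha> k) * cis (\<alpha> k) = 1" by (simp add: cis_mult)
    then have "2 * cis (- \<alpha> k) * (- \<i> * of_real (sin (\<alpha> k)) * cis (\<alpha> k)) = - 2 * \<i> * of_real (sin (\<alpha> k))"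
      by (simp add: mult_ac)
    then show ?thesis
      unfolding block_def s0 num den divide_divide_eq_left using sin_\<alpha>_pos[OF k] by simp
  qed
  ultimately have "(block k \<longlongrightarrow> 1) (at 0)" by (simp add: isCont_def)
  then show ?thesis by (rule tendsto_within_subset) simp
qed

text \<open>Outer and inner radius have ratio 4, so \<open>r < 1 / 4\<close> makes the annuli
  disjoint.\<close>

definition annulus :: "nat \<Rightarrow> complex set" where
  "annulus k = {w. r ^ k / 2 < cmod w \<and> cmod w < 2 * r ^ k}"

lemma annulus_unique: "w \<in> annulus i \<Longrightarrow> w \<in> annulus j \<Longrightarrow> i = j"
proof (induction i j rule: linorder_wlog)
  case (le i j)
  show ?case
  proof (rule ccontr)
    assume "i \<noteq> j"
    then have "r ^ j \<le> r ^ Suc i" using le r_pos r_less by (intro power_decreasing) auto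
    also have "\<dots> \<le> 1 / 4 * r ^ i" using r_pos r_less by simp
    finally show False using le by (simp add: annulus_def)
  qed
qed auto

text \<open>Off the annulus the distance to the tip is at least half of the larger of
  \<open>r ^ k\<close> and \<open>cmod w\<close>, which turns the factor 5 of
  \<open>block_le_inverse_dist\<close> into 10.\<close>

lemma block_off_annulus:
  assumes k: "k \<ge> 1" and w: "w \<in> D" "w \<notin> annulus k"
  shows "cmod (block k w) \<le> 10 * min 1 (r ^ k / cmod w)"
proof -
  have R: "0 < r ^ k" using r_pos by simp
  have q: "cmod (tip k) = r ^ k" using r_pos by (simp add: tip_def norm_mult norm_power)
  have tri: "r ^ k - cmod w \<le> cmod (w - tip k)" "cmod w - r ^ k \<le> cmod (w - tip k)"
    using norm_triangle_ineq2[of w "tip k"] norm_triangle_ineq2[of "tip k" w] by (auto simp: q norm_minus_commute)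
  have w0: "0 < cmod w" using w by (simp add: D_iff)
  note le = block_le_inverse_dist[OF k full_arc_slit(1)[OF k w(1)]]
  consider "cmod w \<le> r ^ k / 2" | "2 * r ^ k \<le> cmod w" using w(2) by (force simp: annulus_def)
  then show ?thesis
  proof cases
    case 1
    then have "5 * r ^ k / cmod (w - tip k) \<le> 5 * r ^ k / (r ^ k / 2)"
      using tri R by (intro divide_left_mono mult_pos_pos) linarith+
    also have "\<dots> = 10" using r_pos by simp
    finally have "cmod (block k w) \<le> 10" using le by linarith
    moreover have "cmod w \<le> r ^ k" using 1 w0 by linarith
    then have "min 1 (r ^ k / cmod w) = 1" using w0 by (simp add: le_divide_eq)
    ultimately show ?thesis by simp
  next
    case 2
    then have "5 * r ^ k / cmod (w - tip k) \<le> 5 * r ^ k / (cmod w / 2)"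
      using tri R w0 by (intro divide_left_mono mult_pos_pos) linarith+
    then have "cmod (block k w) \<le> 10 * (r ^ k / cmod w)" using le by simp
    moreover have "min 1 (r ^ k / cmod w) = r ^ k / cmod w" using 2 R w0 by (simp add: min_def field_simps)
    ultimately show ?thesis by simp
  qed
qed

text \<open>Within distance R sin \<alpha> of the tip the bound 1 / sin \<alpha> contributes pi R^2;
  further out the bound 5 R / |w - tip| gives a shell integral of order R^2 (1 + T k). The
  hypothesis on \<open>t\<close> enters as R^2 T k = (r^2 / t)^k <= 1.\<close>

lemma block_on_annulus:
  assumes k: "k \<ge> 1" and t: "r\<^sup>2 \<le> t"
  obtains b :: "complex \<Rightarrow> real" where "integrable lborel b" "(\<integral>w. b w \<partial>lborel) \<le> 2804" "\<And>w. 0 \<le> b w"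
    "\<And>w. w \<in> D \<Longrightarrow> w \<in> annulus k \<Longrightarrow> (cmod (block k w))\<^sup>2 \<le> b w"
proof -
  define R where "R = r ^ k"
  have R: "0 < R" "R \<le> 1" using r_pos r_less by (auto simp: R_def power_le_one)
  define \<sigma> where "\<sigma> = sin (\<alpha> k)"
  have \<sigma>: "0 < \<sigma>" "\<sigma> \<le> 1" using sin_\<alpha>_pos[OF k] by (auto simp: \<sigma>_def)
  have a: "0 < R * \<sigma>" using R \<sigma> by simp
  have ab: "R * \<sigma> \<le> 3 * R" using R \<sigma> by (simp add: mult_left_le)
  define h where "h w = indicat_real {w. R * \<sigma> \<le> cmod (w - tip k) \<and> cmod (w - tip k) \<le> 3 * R} w / (cmod (w - tip k))\<^sup>2" for w
  note h = shell_integral[OF a ab, of "tip k", folded h_def]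
  define c where "c w = (1 / \<sigma>)\<^sup>2 * indicat_real (cball (tip k) (R * \<sigma>)) w" for w
  have ic: "integrable lborel c"
    unfolding c_def using emeasure_lborel_cball_finite
    by (intro integrable_mult_right integrable_real_indicator) auto
  have intc: "(\<integral>w. c w \<partial>lborel) = pi * R\<^sup>2"
    unfolding c_def using a \<sigma> by (simp add: measure_ball_complex power_mult_distrib power_divide)
  define b where "b w = c w + 25 * R\<^sup>2 * h w" for w
  have "integrable lborel b" unfolding b_def[abs_def] using ic h(1) by simp
  moreover have "(\<integral>w. b w \<partial>lborel) \<le> 2804"
  proof -
    have "R\<^sup>2 * T k = (r\<^sup>2 / t) ^ k"
      by (simp add: R_def T_def power_divide power_mult[symmetric] mult.commute)
    also have "\<dots> \<le> 1" using t t_pos by (intro power_le_one) auto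
    finally have RT: "R\<^sup>2 * T k \<le> 1" .
    have R2: "R\<^sup>2 \<le> 1" using R by (simp add: power_le_one)
    have "ln (3 * R / (R * \<sigma>)) = ln 3 + T k"
      using R by (simp add: \<sigma>_def sin_\<alpha>[OF k] ln_div)
    moreover have "ln 3 \<le> (2 :: real)" using ln_le_minus_one[of 3] by simp
    ultimately have lnle: "ln (3 * R / (R * \<sigma>)) \<le> 2 + T k" by simp
    have T0: "0 < T k" using t_pos by (simp add: T_def)
    have "ln (3 * R / (R * \<sigma>)) / ln 2 \<le> (2 + T k) / (1 / 2)"
      using lnle T0 ln2_ge_two_thirds ab a by (intro frac_le) auto
    then have l: "1 + ln (3 * R / (R * \<sigma>)) / ln 2 \<le> 5 + 2 * T k" by simp
    have "(\<integral>w. b w \<partial>lborel) = pi * R\<^sup>2 + 25 * R\<^sup>2 * (\<integral>w. h w \<partial>lborel)"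
      unfolding b_def using ic h(1) by (simp add: intc)
    also have "\<dots> \<le> pi * R\<^sup>2 + 25 * R\<^sup>2 * (4 * pi * (5 + 2 * T k))"
      using order_trans[OF h(2) mult_left_mono[OF l, of "4 * pi"]] by (intro add_left_mono mult_left_mono) auto
    also have "\<dots> = pi * (501 * R\<^sup>2 + 200 * (R\<^sup>2 * T k))" by (simp add: algebra_simps)
    also have "\<dots> \<le> pi * (501 * 1 + 200 * 1)" using R2 RT by (intro mult_left_mono add_mono) auto
    \<comment> \<open>501 + 200 = 701, and 701 * 4 = 2804.\<close>
    also have "\<dots> \<le> 2804" using pi_less_4 by simp
    finally show ?thesis .
  qed
  moreover have "0 \<le> b w" for w unfolding b_def c_def h_def by simp
  moreover have "(cmod (block k w))\<^sup>2 \<le> b w" if w: "w \<in> D" "w \<in> annulus k" for w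
  proof -
    define x where "x = cmod (w - tip k)"
    have q: "cmod (tip k) = R" using r_pos by (simp add: tip_def norm_mult norm_power R_def)
    have x3: "x \<le> 3 * R" using w(2) norm_triangle_ineq4[of w "tip k"] by (simp add: x_def q annulus_def R_def)
    have x0: "0 < x" using full_arc_slit(1)[OF k w(1)] by (simp add: x_def)
    have c0: "0 \<le> c w" and h0: "0 \<le> 25 * R\<^sup>2 * h w" by (auto simp: c_def h_def)
    show ?thesis
    proof (cases "x \<le> R * \<sigma>")
      case True
      then have "c w = (1 / \<sigma>)\<^sup>2" by (simp add: c_def x_def dist_norm norm_minus_commute)
      moreover have "(cmod (block k w))\<^sup>2 \<le> (1 / \<sigma>)\<^sup>2"
        using block_le_inverse_sin[OF k, of w] by (intro power_mono) (auto simp: \<sigma>_def)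
      ultimately show ?thesis using h0 unfolding b_def by linarith
    next
      case False
      then have hw: "h w = 1 / x\<^sup>2" using x3 by (simp add: h_def x_def)
      have "(cmod (block k w))\<^sup>2 \<le> (5 * R / x)\<^sup>2"
        using block_le_inverse_dist[OF k full_arc_slit(1)[OF k w(1)]]
        by (intro power_mono) (auto simp: R_def x_def)
      also have "\<dots> = 25 * R\<^sup>2 * h w" by (simp add: hw power_divide power_mult_distrib)
      finally show ?thesis using c0 by (simp add: b_def)
    qed
  qed
  ultimately show ?thesis by (rule that)
qed

text \<open>At each point at most one block escapes the bound of \<open>block_off_annulus\<close>.
  The others, summed and divided by n, are dominated by \<open>u n\<close>, which is at most 10 and
  tends to 0 pointwise because the sum of the r^k converges. The escaping blocks contribute a
  multiple of n / n^2 to the squared norm.\<close>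

lemma exhaustive_at_zero:
  assumes t: "r\<^sup>2 \<le> t"
  shows "bergman_exhaustive_at D 0"
proof (rule exhaustive_atI)
  define f where "f n w = (\<Sum>k=1..n. block k w) / of_nat n" for n w
  define u where "u n w = indicat_real D w * ((\<Sum>k=1..n. 10 * min 1 (r ^ k / cmod w)) / real n)" for n w
  have hol: "f n holomorphic_on D" for n
    unfolding f_def[abs_def] divide_inverse by (intro holomorphic_intros block_holomorphic) auto
  have fH: "f n \<in> H" for n
  proof (rule bounded_in_H[OF hol])
    fix w assume "w \<in> D"
    have "cmod (f n w) \<le> (\<Sum>k=1..n. cmod (block k w)) / real n"
      unfolding f_def norm_divide norm_of_nat by (intro divide_right_mono norm_sum) auto
    also have "\<dots> \<le> (\<Sum>k=1..n. 1 / sin (\<alpha> k)) / real n"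
      by (intro divide_right_mono sum_mono block_le_inverse_sin) auto
    finally show "cmod (f n w) \<le> (\<Sum>k=1..n. 1 / sin (\<alpha> k)) / real n" .
  qed
  have um: "u n \<in> borel_measurable lborel" for n
  proof -
    have [measurable]: "D \<in> sets borel" using open_D by simp
    have [measurable]: "(\<lambda>w::complex. min 1 (r ^ k / cmod w)) \<in> borel_measurable borel" for k
      by (intro borel_measurable_min borel_measurable_divide) auto
    show ?thesis unfolding u_def[abs_def] by measurable
  qed
  have u0: "0 \<le> u n w" for n w
    unfolding u_def using r_pos by (auto intro!: mult_nonneg_nonneg divide_nonneg_nonneg sum_nonneg)
  have u10: "u n w \<le> 10 * indicat_real D w" for n w
  proof -
    have "(\<Sum>k=1..n. 10 * min 1 (r ^ k / cmod w)) \<le> (\<Sum>k=1..n. 10)" by (intro sum_mono) auto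
    then have "(\<Sum>k=1..n. 10 * min 1 (r ^ k / cmod w)) / real n \<le> 10" by (cases "n = 0") (auto simp: field_simps)
    then show ?thesis by (simp add: u_def indicator_def)
  qed
  have utend: "(\<lambda>n. u n w) \<longlonglongrightarrow> 0" for w
  proof (cases "w \<in> D")
    case True
    have w0: "0 < cmod w" using True by (simp add: D_iff)
    have "u n w \<le> 20 / cmod w * (1 / real n)" for n
    proof -
      have "(\<Sum>k=1..n. 10 * min 1 (r ^ k / cmod w)) \<le> (\<Sum>k=1..n. 10 / cmod w * r ^ k)"
        by (intro sum_mono) auto
      also have "\<dots> \<le> 10 / cmod w * (1 / (1 - r))"
        unfolding sum_distrib_left[symmetric] using r_pos r_less by (intro mult_left_mono geometric_le) auto
      also have "\<dots> \<le> 10 / cmod w * 2"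
        using r_less by (intro mult_left_mono) (auto simp: divide_le_eq)
      finally have "(\<Sum>k=1..n. 10 * min 1 (r ^ k / cmod w)) / real n \<le> (10 / cmod w * 2) / real n"
        by (intro divide_right_mono) auto
      then show ?thesis using True by (simp add: u_def)
    qed
    then have b: "\<forall>\<^sub>F n in sequentially. norm (u n w) \<le> 20 / cmod w * (1 / real n)"
      using u0 by (intro always_eventually) auto
    have "(\<lambda>n. 20 / cmod w * (1 / real n)) \<longlonglongrightarrow> 20 / cmod w * 0"
      by (intro tendsto_intros lim_1_over_n)
    then show ?thesis using Lim_null_comparison[OF b] by simp
  qed (simp add: u_def)
  have u2: "(u n w)\<^sup>2 \<le> 100 * indicat_real D w" for n w
  proof -
    have "(u n w)\<^sup>2 \<le> (10 * indicat_real D w)\<^sup>2" using u0 u10 by (intro power_mono)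
    then show ?thesis by (cases "w \<in> D") auto
  qed
  have iu: "integrable lborel (\<lambda>w. (u n w)\<^sup>2)" for n
  proof (rule Bochner_Integration.integrable_bound)
    show "integrable lborel (\<lambda>w. 100 * indicat_real D w)"
      using open_D emeasure_bounded_finite[OF bounded_D] by (intro integrable_mult_right integrable_real_indicator) auto
    show "AE w in lborel. norm ((u n w)\<^sup>2) \<le> norm (100 * indicat_real D w)"
      using u2 by (intro AE_I2) simp
  qed (use um in measurable)
  have ulim: "(\<lambda>n. \<integral>w. (u n w)\<^sup>2 \<partial>lborel) \<longlonglongrightarrow> integral\<^sup>L lborel (\<lambda>_::complex. 0 :: real)"
  proof (rule integral_dominated_convergence[of _ _ _ "\<lambda>w. 100 * indicat_real D w"])
    show "integrable lborel (\<lambda>w. 100 * indicat_real D w)"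
      using open_D emeasure_bounded_finite[OF bounded_D] by (intro integrable_mult_right integrable_real_indicator) auto
    show "AE w in lborel. norm ((u n w)\<^sup>2) \<le> 100 * indicat_real D w" for n
      using u2 by (intro AE_I2) simp
    have "(\<lambda>n. (u n w)\<^sup>2) \<longlonglongrightarrow> 0\<^sup>2" for w by (intro tendsto_power utend)
    then show "AE w in lborel. (\<lambda>n. (u n w)\<^sup>2) \<longlonglongrightarrow> 0" by simp
  qed (use um in measurable)
  define bb where "bb k = (SOME b. integrable lborel b \<and> (\<integral>w. b w \<partial>lborel) \<le> 2804 \<and> (\<forall>w. 0 \<le> b w) \<and>
    (\<forall>w. w \<in> D \<longrightarrow> w \<in> annulus k \<longrightarrow> (cmod (block k w))\<^sup>2 \<le> b w))" for k
  have bb: "integrable lborel (bb k)" "(\<integral>w. bb k w \<partial>lborel) \<le> 2804" "0 \<le> bb k w"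
    "w \<in> D \<Longrightarrow> w \<in> annulus k \<Longrightarrow> (cmod (block k w))\<^sup>2 \<le> bb k w" if k: "k \<ge> 1" for k w
  proof -
    have "\<exists>b. integrable lborel b \<and> (\<integral>w. b w \<partial>lborel) \<le> 2804 \<and> (\<forall>w. 0 \<le> b w) \<and>
      (\<forall>w. w \<in> D \<longrightarrow> w \<in> annulus k \<longrightarrow> (cmod (block k w))\<^sup>2 \<le> b w)"
      by (rule block_on_annulus[OF k t]) blast
    from someI_ex[OF this] show "integrable lborel (bb k)" "(\<integral>w. bb k w \<partial>lborel) \<le> 2804" "0 \<le> bb k w"
      "w \<in> D \<Longrightarrow> w \<in> annulus k \<Longrightarrow> (cmod (block k w))\<^sup>2 \<le> bb k w"
      unfolding bb_def by blast+
  qed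
  have pw: "(cmod (restr D (f n) w))\<^sup>2 \<le> 2 * (u n w)\<^sup>2 + 2 / (real n)\<^sup>2 * (\<Sum>k=1..n. bb k w)" for n w
  proof (cases "w \<in> D")
    case True
    define A where "A = {k \<in> {1..n}. w \<in> annulus k}"
    have A: "A \<subseteq> {1..n}" by (auto simp: A_def)
    have "(\<Sum>k=1..n. block k w) = (\<Sum>k\<in>A. block k w) + (\<Sum>k\<in>{1..n} - A. block k w)"
      using sum.subset_diff[of A "{1..n}" "\<lambda>k. block k w"] A by (simp only: finite_atLeastAtMost add.commute)
    then have "cmod (\<Sum>k=1..n. block k w) \<le> cmod (\<Sum>k\<in>A. block k w) + cmod (\<Sum>k\<in>{1..n} - A. block k w)"
      by (simp add: norm_triangle_ineq)
    then have "cmod (f n w) \<le> cmod (\<Sum>k\<in>A. block k w) / real n + cmod (\<Sum>k\<in>{1..n} - A. block k w) / real n"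
      unfolding f_def norm_divide norm_of_nat add_divide_distrib[symmetric] by (intro divide_right_mono) auto
    also have "cmod (\<Sum>k\<in>{1..n} - A. block k w) / real n \<le> u n w"
    proof -
      have "cmod (\<Sum>k\<in>{1..n} - A. block k w) \<le> (\<Sum>k\<in>{1..n} - A. 10 * min 1 (r ^ k / cmod w))"
        by (rule order_trans[OF norm_sum], intro sum_mono block_off_annulus True) (auto simp: A_def)
      also have "\<dots> \<le> (\<Sum>k=1..n. 10 * min 1 (r ^ k / cmod w))"
        using r_pos by (intro sum_mono2) auto
      finally show ?thesis using True by (simp add: u_def divide_right_mono)
    qed
    finally have le: "cmod (f n w) \<le> cmod (\<Sum>k\<in>A. block k w) / real n + u n w" by simp
    \<comment> \<open>\<open>A\<close> has at most one element, so no cross terms occur.\<close>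
    have A2: "(cmod (\<Sum>k\<in>A. block k w))\<^sup>2 \<le> (\<Sum>k=1..n. bb k w)"
    proof (cases "A = {}")
      case True
      then show ?thesis by (auto intro!: sum_nonneg bb)
    next
      case False
      then obtain j where j: "j \<in> A" by blast
      then have "A = {j}" using annulus_unique by (auto simp: A_def)
      then have "(cmod (\<Sum>k\<in>A. block k w))\<^sup>2 = (cmod (block j w))\<^sup>2" by simp
      also have "\<dots> \<le> bb j w" using j True by (intro bb) (auto simp: A_def)
      also have "\<dots> \<le> (\<Sum>k=1..n. bb k w)" using j by (intro member_le_sum bb) (auto simp: A_def)
      finally show ?thesis .
    qed
    have "(cmod (f n w))\<^sup>2 \<le> (cmod (\<Sum>k\<in>A. block k w) / real n + u n w)\<^sup>2"
      using le by (intro power_mono) auto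
    also have "\<dots> \<le> 2 * (cmod (\<Sum>k\<in>A. block k w) / real n)\<^sup>2 + 2 * (u n w)\<^sup>2"
      using sum_squares_bound[of "cmod (\<Sum>k\<in>A. block k w) / real n" "u n w"] by (simp add: power2_sum)
    also have "(cmod (\<Sum>k\<in>A. block k w) / real n)\<^sup>2 \<le> (\<Sum>k=1..n. bb k w) / (real n)\<^sup>2"
      unfolding power_divide by (intro divide_right_mono A2) auto
    finally show ?thesis using True by simp
  next
    case False
    have "0 \<le> (\<Sum>k=1..n. bb k w)" by (intro sum_nonneg bb) simp
    then show ?thesis using False by simp
  qed
  \<comment> \<open>5608 is 2 * 2804, and 1 / n arises from n bounded integrals divided by
    n^2.\<close>
  define v where "v n = 2 * (\<integral>w. (u n w)\<^sup>2 \<partial>lborel) + 5608 * (1 / real n)" for n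
  have Nle: "(N (f n))\<^sup>2 \<le> v n" for n
  proof -
    have ib: "integrable lborel (\<lambda>w. \<Sum>k=1..n. bb k w)"
      by (intro Bochner_Integration.integrable_sum bb) auto
    have "(N (f n))\<^sup>2 \<le> (\<integral>w. 2 * (u n w)\<^sup>2 + 2 / (real n)\<^sup>2 * (\<Sum>k=1..n. bb k w) \<partial>lborel)"
      unfolding N_square[OF fH] using iu ib
      by (intro integral_mono pw H_integrable_square[OF fH] Bochner_Integration.integrable_add integrable_mult_right)
    also have "\<dots> = 2 * (\<integral>w. (u n w)\<^sup>2 \<partial>lborel) + 2 / (real n)\<^sup>2 * (\<integral>w. (\<Sum>k=1..n. bb k w) \<partial>lborel)"
      using iu[of n] ib by (subst Bochner_Integration.integral_add) auto
    also have "(\<integral>w. (\<Sum>k=1..n. bb k w) \<partial>lborel) = (\<Sum>k=1..n. \<integral>w. bb k w \<partial>lborel)"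
      by (intro Bochner_Integration.integral_sum bb) auto
    also have "2 / (real n)\<^sup>2 * (\<Sum>k=1..n. \<integral>w. bb k w \<partial>lborel) \<le> 2 / (real n)\<^sup>2 * (\<Sum>k=1..n. 2804)"
      by (intro mult_left_mono sum_mono bb) auto
    also have "2 / (real n)\<^sup>2 * (\<Sum>k=1..n. 2804) = 5608 * (1 / real n)"
      by (simp add: power2_eq_square)
    finally show ?thesis by (simp add: v_def)
  qed
  have "v \<longlonglongrightarrow>
      2 * integral\<^sup>L lborel (\<lambda>_::complex. 0 :: real) + 5608 * 0"
    unfolding v_def by (intro tendsto_intros ulim lim_1_over_n)
  then have lim: "v \<longlonglongrightarrow> 0" by simp
  fix \<epsilon> :: real assume "\<epsilon> > 0"
  then have "\<forall>\<^sub>F n in sequentially. v n < \<epsilon>"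
    using lim by (intro order_tendstoD(2)) auto
  then obtain M where M: "\<And>n. n \<ge> M \<Longrightarrow> v n < \<epsilon>"
    unfolding eventually_sequentially by blast
  \<comment> \<open>\<open>f 0\<close> is 0 by division by zero, so the limit 1 at the origin
    requires n >= 1.\<close>
  define n where "n = max M 1"
  have n: "v n < \<epsilon>" "1 \<le> n"
    using M[of n] by (auto simp: n_def)
  have "(f n \<longlongrightarrow> (\<Sum>k=1..n. 1) / of_nat n) (at 0 within D)"
    unfolding f_def[abs_def] using n(2) by (intro tendsto_intros block_tendsto) auto
  then have "(f n \<longlongrightarrow> 1) (at 0 within D)" using n(2) by simp
  then have "((\<lambda>z. cmod (f n z)) \<longlongrightarrow> cmod 1) (at 0 within D)" by (rule tendsto_norm)
  then have "\<forall>\<^sub>F z in at 0 within D. 1 / 2 < cmod (f n z)" by (intro order_tendstoD(1)) auto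
  then have "\<forall>\<^sub>F z in at 0 within D. 1 / 2 \<le> cmod (f n z)" by eventually_elim simp
  then show "\<exists>f\<in>H. (N f)\<^sup>2 \<le> \<epsilon> \<and> (\<forall>\<^sub>F z in at 0 within D. 1 / 2 \<le> cmod (f z))"
    using fH[of n] order_trans[OF Nle[of n] less_imp_le[OF n(1)]] by blast
qed

lemma exhaustive_iff: "bergman_exhaustive D \<longleftrightarrow> r\<^sup>2 \<le> t"
proof
  show "r\<^sup>2 \<le> t" if "bergman_exhaustive D"
    using that not_exhaustive by (meson not_le)
  assume t: "r\<^sup>2 \<le> t"
  show "bergman_exhaustive D"
    unfolding bergman_exhaustive_def
  proof
    fix z0 assume "z0 \<in> frontier D"
    then show "bergman_exhaustive_at D z0"
      by (cases rule: frontier_cases)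
        (auto intro: exhaustive_at_circle exhaustive_at_arc exhaustive_at_zero[OF t])
  qed
qed

end

theorem theorem1:
  fixes r t :: real and \<alpha> :: "nat \<Rightarrow> real"
  assumes "0 < r" and "r < 1/4"
    and "0 < t" and "t < 1/2"
    and "\<And>k. k \<ge> 1 \<Longrightarrow> 0 < \<alpha> k \<and> \<alpha> k < pi/2 \<and> sin (\<alpha> k) = exp (- (t powi (- int k)))"
  shows "(bergman_exhaustive (arc_domain r \<alpha>) \<longleftrightarrow> r\<^sup>2 \<le> t) \<and>
         (t \<le> r ^ 4 \<longrightarrow> \<not> bergman_complete (arc_domain r \<alpha>))"
proof -
  interpret arcs r t \<alpha> by unfold_locales (use assms in auto)
  show ?thesis using exhaustive_iff not_complete by blast
qed

end
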